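(* In the standing setup, for any full rate linear dispersive code (full rank $\mathbf G$) with multiplexing gain $r\in[0,n_t]$ and diversity gain $d(r)$, the SD complexity exponent satisfies $c(r)\le\bar c(r)$, where $$\bar c(r)=\max_{\boldsymbol\alpha\in\mathbb R^{n_t}}\ \sum_{i=1}^{n_t}T\min\Big(\frac{r}{n_t}-1+\alpha_i,\ \frac{r}{n_t}\Big)^{+}$$ subject to $\sum_{i=1}^{n_t}(n_r-n_t+2i-1)\alpha_i\le d(r)$ and $\alpha_1\ge\alpha_2\ge\dots\ge\alpha_{n_t}\ge0$.
   Context: $(a)^+=\max(a,0)$. Standing setup. Let $\rho>0$ (SNR) tend to infinity; $\log$ is base 2. For functions of $\rho$, $f(\rho)\doteq\rho^a$ means $\lim_{\rho\to\infty}\log f(\rho)/\log\rho=a$. Channel: $\mathbf Y=\mathbf H\mathbf X+\mathbf W$ with $\mathbf H\in\mathbb C^{n_r\times n_t}$ ($n_r\ge n_t$) having i.i.d. $\mathcal{CN}(0,1)$ entries, $\mathbf W\in\mathbb C^{n_r\times T}$ with i.i.d. $\mathcal{CN}(0,1)$ entries, independent of $\mathbf H$ and of the codeword. Full rate linear dispersive code: $\kappa=n_tT$, $\mathbf X=\theta\sum_{i=1}^\kappa s_i\mathbf D_i$ with linearly independent $\mathbf D_i\in\mathbb C^{n_t\times T}$, symbols $s_i$ drawn i.i.d. uniformly from $\mathcal Q_\eta=\{s\in\mathbb C:\Re s,\Im s\in\mathbb Z\cap[-\eta,\eta]\}$. The generator matrix is $\mathbf G=[\mathrm{vec}(\mathbf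 D_1)\cdots\mathrm{vec}(\mathbf D_\kappa)]\in\mathbb C^{\kappa\times\kappa}$ (full rank), so $\mathrm{vec}(\mathbf X)=\theta\mathbf G\mathbf s$. For multiplexing gain $r\in[0,n_t]$, $\eta\doteq\rho^{rT/(2\kappa)}$ and $\theta^2\doteq\rho^{1-rT/\kappa}$. The diversity gain is $d(r)=-\lim_{\rho\to\infty}\log\Pr(\hat{\mathbf X}_{\mathrm{ML}}\ne\mathbf X)/\log\rho$ with $\hat{\mathbf X}_{\mathrm{ML}}=\arg\min_{\mathbf X'}\|\mathbf Y-\mathbf H\mathbf X'\|_F^2$ over the codebook. Sphere decoder: $\mathbf M=\theta(\mathbf I_T\otimes\mathbf H)\mathbf G$, thin QR decomposition $\mathbf M=\mathbf Q\mathbf R$, $\mathbf r=\mathbf Q^H\mathrm{vec}(\mathbf Y)$; $\mathbf r_k$ = last $k$ entries of $\mathbf r$, $\mathbf R_k$ = lower-right $k\times k$ block of $\mathbf R$; $N_k=|\{\hat{\mathbf s}_k\in\mathcal Q_\eta^k:\|\mathbf r_k-\mathbf R_k\hat{\mathbf s}_k\|^2\le\xi^2\}|$, $N=\sum_{k=1}^\kappa N_k$, with radius $\xi^2=z\log\rho$, $z>d(r)$ constant. $\Psi(x)=-\lim_{\rho\to\infty}\log\Pr(N\ge\rho^x)/\log\rho$ and SD complexity exponent $c(r)=\inf\{x:\Psi(x)>d(r)\}$ (limits assumed to exist). *)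

theory Defs
  imports "HOL-Probability.Probability"
begin

text \<open>Conventions. Matrices are functions of natural-number indices (0-based), with the
dimensions kept explicit. The channel matrix H (n_r x n_t) and noise W (n_r x T) are
functions on index pairs (row, column). vec is column-major: entry (a,t) of an
n x T matrix is entry a + n*t of its vec. kappa = n_t * T.\<close>

definition CN :: "complex measure" where
  "CN = density lborel (\<lambda>z. ennreal (exp (- (cmod z)\<^sup>2) / pi))"

definition Qset :: "real \<Rightarrow> complex set" where
  "Qset \<eta> = {s. Re s \<in> \<int> \<and> Im s \<in> \<int> \<and> \<bar>Re s\<bar> \<le> \<eta> \<and> \<bar>Im s\<bar> \<le> \<eta>}"

text \<open>Full-rank (kappa x kappa) generator: its columns vec(D_i) are linearly independent.\<close>
definition full_rank_gen :: "nat \<Rightarrow> (nat \<Rightarrow> nat \<Rightarrow> complex) \<Rightarrow> bool" where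
  "full_rank_gen \<kappa> G \<longleftrightarrow>
     (\<forall>c. (\<forall>j<\<kappa>. (\<Sum>i<\<kappa>. G j i * c i) = 0) \<longrightarrow> (\<forall>i<\<kappa>. c i = 0))"

definition codevec :: "nat \<Rightarrow> (nat \<Rightarrow> nat \<Rightarrow> complex) \<Rightarrow> real \<Rightarrow> (nat \<Rightarrow> complex) \<Rightarrow> nat \<Rightarrow> complex" where
  "codevec \<kappa> G \<theta> s j = complex_of_real \<theta> * (\<Sum>i<\<kappa>. G j i * s i)"

text \<open>(H X)(b,t) where X is given by its vec xv (X(a,t) = xv (a + n_t t)).\<close>
definition HX :: "nat \<Rightarrow> (nat \<times> nat \<Rightarrow> complex) \<Rightarrow> (nat \<Rightarrow> complex) \<Rightarrow> nat \<Rightarrow> nat \<Rightarrow> complex" where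
  "HX nt H xv b t = (\<Sum>a<nt. H (b, a) * xv (a + nt * t))"

definition rcv :: "nat \<Rightarrow> nat \<Rightarrow> (nat \<Rightarrow> nat \<Rightarrow> complex) \<Rightarrow> real \<Rightarrow>
    (nat \<times> nat \<Rightarrow> complex) \<Rightarrow> (nat \<times> nat \<Rightarrow> complex) \<Rightarrow> (nat \<Rightarrow> complex) \<Rightarrow> nat \<Rightarrow> nat \<Rightarrow> complex" where
  "rcv nt T G \<theta> H W s b t = HX nt H (codevec (nt * T) G \<theta> s) b t + W (b, t)"

definition frob2 :: "nat \<Rightarrow> nat \<Rightarrow> (nat \<Rightarrow> nat \<Rightarrow> complex) \<Rightarrow> (nat \<Rightarrow> nat \<Rightarrow> complex) \<Rightarrow> real" where
  "frob2 nr T Y Z = (\<Sum>b<nr. \<Sum>t<T. (cmod (Y b t - Z b t))\<^sup>2)"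

text \<open>ML decoding error: some other codeword is at least as close to Y as the transmitted one
 (differs from the event for any fixed tie-breaking rule only on a null set).\<close>
definition mld_error :: "nat \<Rightarrow> nat \<Rightarrow> nat \<Rightarrow> (nat \<Rightarrow> nat \<Rightarrow> complex) \<Rightarrow> real \<Rightarrow> real \<Rightarrow>
    (nat \<times> nat \<Rightarrow> complex) \<Rightarrow> (nat \<times> nat \<Rightarrow> complex) \<Rightarrow> (nat \<Rightarrow> complex) \<Rightarrow> bool" where
  "mld_error nr nt T G \<eta> \<theta> H W s \<longleftrightarrow>
     (\<exists>s' \<in> PiE {..<nt * T} (\<lambda>_. Qset \<eta>). s' \<noteq> s \<and>
        frob2 nr T (rcv nt T G \<theta> H W s) (HX nt H (codevec (nt * T) G \<theta> s'))
          \<le> frob2 nr T (rcv nt T G \<theta> H W s) (HX nt H (codevec (nt * T) G \<theta> s)))"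

text \<open>M = theta (I_T kron H) G, an (n_r T) x kappa matrix; row l = b + n_r t.\<close>
definition Mmat :: "nat \<Rightarrow> nat \<Rightarrow> (nat \<Rightarrow> nat \<Rightarrow> complex) \<Rightarrow> real \<Rightarrow> (nat \<times> nat \<Rightarrow> complex) \<Rightarrow> nat \<Rightarrow> nat \<Rightarrow> complex" where
  "Mmat nr nt G \<theta> H l j =
     complex_of_real \<theta> * (\<Sum>a<nt. H (l mod nr, a) * G (a + nt * (l div nr)) j)"

definition is_thin_QR :: "nat \<Rightarrow> nat \<Rightarrow> (nat \<Rightarrow> nat \<Rightarrow> complex) \<Rightarrow> (nat \<Rightarrow> nat \<Rightarrow> complex) \<Rightarrow> (nat \<Rightarrow> nat \<Rightarrow> complex) \<Rightarrow> bool" where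
  "is_thin_QR m n M Q R \<longleftrightarrow>
     (\<forall>i<n. \<forall>j<n. (\<Sum>l<m. cnj (Q l i) * Q l j) = (if i = j then 1 else 0)) \<and>
     (\<forall>i<n. \<forall>j<n. j < i \<longrightarrow> R i j = 0) \<and>
     (\<forall>l<m. \<forall>j<n. M l j = (\<Sum>i<n. Q l i * R i j))"

definition sd_count :: "nat \<Rightarrow> nat \<Rightarrow> nat \<Rightarrow> (nat \<Rightarrow> nat \<Rightarrow> complex) \<Rightarrow> real \<Rightarrow> real \<Rightarrow> real \<Rightarrow>
    (nat \<times> nat \<Rightarrow> complex) \<Rightarrow> (nat \<times> nat \<Rightarrow> complex) \<Rightarrow> (nat \<Rightarrow> complex) \<Rightarrow> nat" where
  "sd_count nr nt T G \<eta> \<theta> xi2 H W s =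
    (let \<kappa> = nt * T; m = nr * T; M = Mmat nr nt G \<theta> H;
         QR = (SOME QR. is_thin_QR m \<kappa> M (fst QR) (snd QR)); Q = fst QR; R = snd QR;
         y = (\<lambda>l. rcv nt T G \<theta> H W s (l mod nr) (l div nr));
         rv = (\<lambda>i. \<Sum>l<m. cnj (Q l i) * y l)
     in \<Sum>k\<in>{1..\<kappa>}. card {sh \<in> PiE {\<kappa> - k..<\<kappa>} (\<lambda>_. Qset \<eta>).
           (\<Sum>i\<in>{\<kappa> - k..<\<kappa>}. (cmod (rv i - (\<Sum>j\<in>{\<kappa> - k..<\<kappa>}. R i j * sh j)))\<^sup>2) \<le> xi2})"

definition sys_space :: "nat \<Rightarrow> nat \<Rightarrow> nat \<Rightarrow> real \<Rightarrow>
    (((nat \<times> nat \<Rightarrow> complex) \<times> (nat \<times> nat \<Rightarrow> complex)) \<times> (nat \<Rightarrow> complex)) measure" where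
  "sys_space nr nt T \<eta> =
     (PiM ({..<nr} \<times> {..<nt}) (\<lambda>_. CN) \<Otimes>\<^sub>M PiM ({..<nr} \<times> {..<T}) (\<lambda>_. CN))
       \<Otimes>\<^sub>M uniform_count_measure (PiE {..<nt * T} (\<lambda>_. Qset \<eta>))"

text \<open>Probability of an event (taken in the completed measure, so a.s.-defined quantities are fine).\<close>
definition Pr_sys :: "nat \<Rightarrow> nat \<Rightarrow> nat \<Rightarrow> real \<Rightarrow>
    ((nat \<times> nat \<Rightarrow> complex) \<Rightarrow> (nat \<times> nat \<Rightarrow> complex) \<Rightarrow> (nat \<Rightarrow> complex) \<Rightarrow> bool) \<Rightarrow> real" where
  "Pr_sys nr nt T \<eta> E =
     measure (completion (sys_space nr nt T \<eta>))
       {\<omega> \<in> space (sys_space nr nt T \<eta>). E (fst (fst \<omega>)) (snd (fst \<omega>)) (snd \<omega>)}"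

definition dot_eq :: "(real \<Rightarrow> real) \<Rightarrow> real \<Rightarrow> bool" where
  "dot_eq f a \<longleftrightarrow> eventually (\<lambda>\<rho>. f \<rho> > 0) at_top \<and>
     ((\<lambda>\<rho>. log 2 (f \<rho>) / log 2 \<rho>) \<longlongrightarrow> a) at_top"

definition elog_ratio :: "real \<Rightarrow> real \<Rightarrow> ereal" where
  "elog_ratio p \<rho> = (if p \<le> 0 then - \<infinity> else ereal (log 2 p / log 2 \<rho>))"

text \<open>Upper bound \<bar>c(r) (a maximum over a compact nonempty set, written as Sup).\<close>
definition cbar :: "nat \<Rightarrow> nat \<Rightarrow> nat \<Rightarrow> real \<Rightarrow> real \<Rightarrow> real" where
  "cbar nt nr T r d = Sup {(\<Sum>i=1..nt. real T * max 0 (min (r / real nt - 1 + \<alpha> i) (r / real nt))) | \<alpha>.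
      (\<Sum>i=1..nt. (real nr - real nt + 2 * real i - 1) * \<alpha> i) \<le> d \<and>
      (\<forall>i\<in>{1..<nt}. \<alpha> (Suc i) \<le> \<alpha> i) \<and> 0 \<le> \<alpha> nt}"

end

theory Submission
  imports Defs "Jordan_Normal_Form.Determinant" "HOL-Real_Asymp.Real_Asymp"
begin

text \<open>
  The differences of two points counted at one level of the sphere decoder do not depend on the centre
  of the sphere, so the noise plays no role and only the channel matrix \<open>H\<close> matters. Instead of
  singular values we use Gaussian elimination with complete pivoting: all multipliers are at most \<open>1\<close>,
  so the pivots control both sides of the argument up to constants.

  Counting: if the pivot at the stage with \<open>k + 1\<close> columns is of size \<open>P\<^sub>k\<close>, a lattice point of the
  sphere is a combination of boundedly many bounded vectors with coefficients of order \<open>\<xi> / (\<theta> P\<^sub>k)\<close>,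
  and the number of such Gaussian integer points in the constellation box is at most of order
  \<open>\<Prod>\<^sub>k (1 + min (\<xi> / (\<theta> P\<^sub>k)) \<eta>)\<^bsup>2T\<^esup>\<close>.

  Probability: the Gaussian density is bounded by \<open>1\<close>, and passing to the Schur complement is a
  translation of the remaining entries once the pivot row and column are fixed. Hence the event that
  the stages have size at most \<open>\<beta>\<^sub>k\<close> has probability at most of order
  \<open>\<Prod>\<^sub>k \<beta>\<^sub>k\<^bsup>2(n\<^sub>r - n\<^sub>t + 2k + 1)\<^esup>\<close>, which are the exponents of the Wishart eigenvalue density.

  With \<open>P\<^sub>k\<^sup>2 = \<rho>\<^bsup>-\<alpha>\<^esup>\<close> and \<open>\<alpha>\<close> rounded to a finite grid, a union bound over the cells gives the claim,
  because \<open>cbar\<close> depends continuously on \<open>d\<close>.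
\<close>

subsection \<open>Gram--Schmidt and QR\<close>

text \<open>The obstacle is that an intermediate level sees only a trailing block of
  \<open>R\<close>, whose law is not at hand. A trailing difference vector is therefore completed by
  leading entries for which the upper rows of \<open>R\<close> give zero. Then \<open>M\<close>
  applied to the completed vector is as small as the block residual, up to constants, and all levels
  reduce to one statement about short images under \<open>M\<close>. The leading entries are merely
  complex; integrality is used on the counted entries only. Pivots can replace singular values
  because only exponents of \<rho> are compared: constants depending on the dimensions and
  \<open>G\<close> alone, such as \<open>2 ^ nt\<close>, \<open>fact nt\<close> or the mass bound 2
  for \<open>CN\<close>, vanish in a small power of \<rho>. The range of \<alpha> is not bounded a
  priori. Negative values are confined by a tail bound that excludes channels with entries beyond a
  small power of \<rho>. Large values are cut off where a single coordinate already forces the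
  required rarity; channels with vanishing pivots fall there too.\<close>

lemma full_rank_gen_inverse:
  assumes "full_rank_gen n A"
  obtains B where "\<forall>i<n. \<forall>j<n. (\<Sum>k<n. B i k * A k j) = (if i = j then 1 else 0)"
    and "\<forall>i<n. \<forall>j<n. (\<Sum>k<n. A i k * B k j) = (if i = j then 1 else 0)"
proof -
  define M where "M = mat n n (\<lambda>(i,j). A i j)"
  have M: "M \<in> carrier_mat n n" by (simp add: M_def)
  have "det M \<noteq> 0"
  proof
    assume "det M = 0"
    then obtain v where v: "v \<in> carrier_vec n" "v \<noteq> 0\<^sub>v n" "M *\<^sub>v v = 0\<^sub>v n"
      using det_0_iff_vec_prod_zero_field[OF M] by blast
    have "(\<Sum>i<n. A j i * vec_index v i) = 0" if "j < n" for j
    proof -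
      have "vec_index (M *\<^sub>v v) j = (\<Sum>i<n. A j i * vec_index v i)"
        using v(1) that by (simp add: M_def scalar_prod_def lessThan_atLeast0)
      then show ?thesis using v(3) that by simp
    qed
    then have "\<forall>i<n. vec_index v i = 0"
      using assms unfolding full_rank_gen_def by blast
    then show False using v(1,2) by (auto intro!: eq_vecI)
  qed
  \<comment> \<open>A nonzero determinant gives a two-sided inverse. The left identity will serve
    for \<open>G\<close>, the right one for the leading block of \<open>R\<close>.\<close>
  then have "M \<in> Units (ring_mat TYPE(complex) n ())" by (rule det_non_zero_imp_unit[OF M])
  then obtain N where N: "N \<in> carrier_mat n n" "N * M = 1\<^sub>m n" "M * N = 1\<^sub>m n"
    unfolding Units_def ring_mat_def by auto
  show ?thesis
  proof (rule that[of "\<lambda>i j. index_mat N (i, j)"]; intro allI impI)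
    fix i j assume ij: "i < n" "j < n"
    have "index_mat (N * M) (i, j) = (\<Sum>k<n. index_mat N (i, k) * A k j)"
      using ij N(1) by (simp add: M_def scalar_prod_def lessThan_atLeast0)
    then show "(\<Sum>k<n. index_mat N (i, k) * A k j) = (if i = j then 1 else 0)"
      using N ij by simp
    have "index_mat (M * N) (i, j) = (\<Sum>k<n. A i k * index_mat N (k, j))"
      using ij N(1) by (simp add: M_def scalar_prod_def lessThan_atLeast0)
    then show "(\<Sum>k<n. A i k * index_mat N (k, j)) = (if i = j then 1 else 0)"
      using N ij by simp
  qed
qed

definition cdot :: "nat set \<Rightarrow> (nat \<Rightarrow> complex) \<Rightarrow> (nat \<Rightarrow> complex) \<Rightarrow> complex" where
  "cdot L v w = (\<Sum>l\<in>L. cnj (v l) * w l)"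

lemma cdot_diff_right: "cdot L v (\<lambda>l. x l - y l) = cdot L v x - cdot L v y"
  by (simp add: cdot_def right_diff_distrib sum_subtractf)

lemma cdot_sum_right: "cdot L v (\<lambda>l. \<Sum>i\<in>I. x i l * c i) = (\<Sum>i\<in>I. cdot L v (x i) * c i)"
  unfolding cdot_def
  by (simp add: sum_distrib_left sum_distrib_right mult.assoc) (rule sum.swap)

lemma cdot_scale_right: "cdot L v (\<lambda>l. x l * c) = cdot L v x * c"
  by (simp add: cdot_def sum_distrib_right mult.assoc)

lemma cdot_commute: "cdot L w v = cnj (cdot L v w)"
  by (simp add: cdot_def mult.commute)

lemma cdot_self: "cdot L v v = complex_of_real (\<Sum>l\<in>L. (cmod (v l))\<^sup>2)"
  by (simp add: cdot_def mult.commute complex_norm_square[symmetric])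

lemma cmod_cdot_le:
  fixes c :: real
  assumes "finite L" "\<And>l. l \<in> L \<Longrightarrow> cmod (v l) \<le> 1" "\<And>l. l \<in> L \<Longrightarrow> cmod (x l) \<le> c"
  shows "cmod (cdot L v x) \<le> card L * c"
proof -
  have "cmod (cdot L v x) \<le> (\<Sum>l\<in>L. cmod (cnj (v l) * x l))"
    unfolding cdot_def by (rule norm_sum)
  also have "\<dots> \<le> (\<Sum>l\<in>L. 1 * c)"
    unfolding norm_mult complex_mod_cnj using assms by (intro sum_mono mult_mono) auto
  finally show ?thesis by simp
qed

lemma cmod_le_1_if_cdot_self:
  assumes "finite L" "cdot L v v = 1" "l \<in> L"
  shows "cmod (v l) \<le> 1"
proof -
  have "(cmod (v l))\<^sup>2 \<le> (\<Sum>l\<in>L. (cmod (v l))\<^sup>2)"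
    using assms by (intro member_le_sum) auto
  also have "\<dots> = 1" using assms(2) unfolding cdot_self
    by (metis of_real_eq_1_iff)
  finally show ?thesis by (simp add: power2_le_imp_le abs_square_le_1)
qed

text \<open>A column that depends linearly on its predecessors gives a zero vector instead of
  shortening the family.\<close>
definition is_gram_schmidt ::
    "nat set \<Rightarrow> nat \<Rightarrow> (nat \<Rightarrow> nat \<Rightarrow> complex) \<Rightarrow> (nat \<Rightarrow> nat \<Rightarrow> complex) \<Rightarrow> (nat \<Rightarrow> nat \<Rightarrow> complex) \<Rightarrow> bool"
  where
  "is_gram_schmidt L q v w R \<longleftrightarrow>
     (\<forall>i<q. \<forall>j<q. i \<noteq> j \<longrightarrow> cdot L (w i) (w j) = 0)
     \<and> (\<forall>i<q. cdot L (w i) (w i) = 1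
          \<or> (\<forall>l. w i l = 0) \<and> (\<exists>c. \<forall>l\<in>L. v i l = (\<Sum>j<i. v j l * c j)))
     \<and> (\<forall>i<q. \<exists>c. \<forall>l\<in>L. w i l = (\<Sum>j<Suc i. v j l * c j))
     \<and> (\<forall>i j. j < i \<longrightarrow> R i j = 0)
     \<and> (\<forall>j<q. \<forall>l\<in>L. v j l = (\<Sum>i<q. w i l * R i j))"

lemma is_gram_schmidtD:
  assumes "is_gram_schmidt L q v w R"
  shows "i < q \<Longrightarrow> j < q \<Longrightarrow> i \<noteq> j \<Longrightarrow> cdot L (w i) (w j) = 0"
    and "i < q \<Longrightarrow> cdot L (w i) (w i) = 1
          \<or> (\<forall>l. w i l = 0) \<and> (\<exists>c. \<forall>l\<in>L. v i l = (\<Sum>j<i. v j l * c j))"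
    and "i < q \<Longrightarrow> \<exists>c. \<forall>l\<in>L. w i l = (\<Sum>j<Suc i. v j l * c j)"
    and "j < i \<Longrightarrow> R i j = 0"
    and "j < q \<Longrightarrow> l \<in> L \<Longrightarrow> v j l = (\<Sum>i<q. w i l * R i j)"
proof -
  note gs = assms[unfolded is_gram_schmidt_def]
  show "i < q \<Longrightarrow> j < q \<Longrightarrow> i \<noteq> j \<Longrightarrow> cdot L (w i) (w j) = 0"
    by (rule gs[THEN conjunct1, rule_format])
  show "i < q \<Longrightarrow> cdot L (w i) (w i) = 1
          \<or> (\<forall>l. w i l = 0) \<and> (\<exists>c. \<forall>l\<in>L. v i l = (\<Sum>j<i. v j l * c j))"
    by (rule gs[THEN conjunct2, THEN conjunct1, rule_format])
  show "i < q \<Longrightarrow> \<exists>c. \<forall>l\<in>L. w i l = (\<Sum>j<Suc i. v j l * c j)"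
    by (rule gs[THEN conjunct2, THEN conjunct2, THEN conjunct1, rule_format])
  show "j < i \<Longrightarrow> R i j = 0"
    by (rule gs[THEN conjunct2, THEN conjunct2, THEN conjunct2, THEN conjunct1, rule_format])
  show "j < q \<Longrightarrow> l \<in> L \<Longrightarrow> v j l = (\<Sum>i<q. w i l * R i j)"
    by (rule gs[THEN conjunct2, THEN conjunct2, THEN conjunct2, THEN conjunct2, rule_format])
qed

text \<open>Each step appends the normalised residual of column \<open>q\<close> after projection
  onto the earlier vectors. These lie in the span of the earlier columns, so a vanishing residual is
  exactly the linear dependence that is to be recorded.\<close>

lemma gram_schmidt_exists:
  fixes v :: "nat \<Rightarrow> nat \<Rightarrow> complex"
  assumes "finite L"
  shows "\<exists>w R. is_gram_schmidt L q v w R"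
proof (induction q)
  case 0
  then show ?case by (auto simp: is_gram_schmidt_def intro: exI[of _ "\<lambda>_ _. 0"])
next
  case (Suc q)
  then obtain w R where gs: "is_gram_schmidt L q v w R" by blast
  note orth = is_gram_schmidtD(1)[OF gs] and unit = is_gram_schmidtD(2)[OF gs]
    and spn = is_gram_schmidtD(3)[OF gs] and tri = is_gram_schmidtD(4)[OF gs]
    and dec = is_gram_schmidtD(5)[OF gs]
  define x where "x = (\<lambda>l. v q l - (\<Sum>i<q. w i l * cdot L (w i) (v q)))"
  define N where "N = sqrt (\<Sum>l\<in>L. (cmod (x l))\<^sup>2)"
  define u where "u = (\<lambda>l. if N = 0 then 0 else x l * complex_of_real (1 / N))"
  have x_orth: "cdot L (w i) x = 0" if "i < q" for i
  proof -
    have "cdot L (w i) x = cdot L (w i) (v q) - (\<Sum>j<q. cdot L (w i) (w j) * cdot L (w j) (v q))"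
      unfolding x_def cdot_diff_right cdot_sum_right ..
    also have "(\<Sum>j<q. cdot L (w i) (w j) * cdot L (w j) (v q))
        = (\<Sum>j<q. if j = i then cdot L (w i) (w i) * cdot L (w i) (v q) else 0)"
      using orth that by (intro sum.cong) auto
    also have "\<dots> = cdot L (w i) (w i) * cdot L (w i) (v q)" using that by simp
    \<comment> \<open>Either \<open>w i\<close> is a unit vector, or it is zero and both sides
      vanish.\<close>
    also have "\<dots> = cdot L (w i) (v q)" using unit[OF that] by (auto simp: cdot_def)
    finally show ?thesis by simp
  qed
  have u_orth: "cdot L (w i) u = 0" if "i < q" for i
    using x_orth[OF that] unfolding u_def
    by (cases "N = 0") (simp_all only: cdot_scale_right if_True if_False, auto simp: cdot_def)
  have u_orth': "cdot L u (w i) = 0" if "i < q" for i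
    using u_orth[OF that] cdot_commute[of L u "w i"] by simp
  have xu: "x l = u l * N" if "l \<in> L" for l
  proof (cases "N = 0")
    case True
    then have "(cmod (x l))\<^sup>2 = 0"
      using that assms unfolding N_def by (simp add: sum_nonneg_eq_0_iff)
    then show ?thesis using True by simp
  qed (simp add: u_def)
  obtain C where C: "\<And>i l. i < q \<Longrightarrow> l \<in> L \<Longrightarrow> w i l = (\<Sum>j<Suc i. v j l * C i j)"
    using spn by metis
  \<comment> \<open>Coefficient of \<open>v j\<close> in the projection of \<open>v q\<close>, every
    \<open>w i\<close> being rewritten through the columns that span it.\<close>
  define E where "E = (\<lambda>j. \<Sum>i<q. (if j < Suc i then C i j else 0) * cdot L (w i) (v q))"
  have wsum: "(\<Sum>i<q. w i l * cdot L (w i) (v q)) = (\<Sum>j<q. v j l * E j)" if "l \<in> L" for l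
  proof -
    have "w i l = (\<Sum>j<q. v j l * (if j < Suc i then C i j else 0))" if "i < q" for i
    proof -
      have "(\<Sum>j<q. v j l * (if j < Suc i then C i j else 0)) = (\<Sum>j<Suc i. v j l * C i j)"
        using that by (intro sum.mono_neutral_cong_right) auto
      then show ?thesis using C[OF that \<open>l \<in> L\<close>] by simp
    qed
    then have "(\<Sum>i<q. w i l * cdot L (w i) (v q))
      = (\<Sum>i<q. \<Sum>j<q. v j l * (if j < Suc i then C i j else 0) * cdot L (w i) (v q))"
      by (simp add: sum_distrib_right)
    also have "\<dots> = (\<Sum>j<q. v j l * E j)"
      unfolding E_def by (subst sum.swap) (simp add: sum_distrib_left mult.assoc)
    finally show ?thesis .
  qed
  define w' where "w' = w(q := u)"
  \<comment> \<open>The new column holds the projection coefficients, with the norm \<open>N\<close>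
    of the residual on the diagonal. Later columns are set to 0 because triangularity is asked for
    all indices, not only those below \<open>Suc q\<close>.\<close>
  define R' where "R' = (\<lambda>i j. if j < q then if i = q then 0 else R i j
      else if j = q then if i < q then cdot L (w i) (v q) else if i = q then complex_of_real N else 0
      else 0)"
  have u_unit: "cdot L u u = 1" if "N \<noteq> 0"
  proof -
    have "(\<Sum>l\<in>L. (cmod (u l))\<^sup>2) = (\<Sum>l\<in>L. (cmod (x l))\<^sup>2) / N\<^sup>2"
      using that by (simp add: u_def norm_divide power_divide sum_divide_distrib)
    also have "N\<^sup>2 = (\<Sum>l\<in>L. (cmod (x l))\<^sup>2)" unfolding N_def by (simp add: sum_nonneg)
    finally show ?thesis using that unfolding cdot_self by (simp add: N_def)
  qed
  have "is_gram_schmidt L (Suc q) v w' R'"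
    unfolding is_gram_schmidt_def
  proof (intro conjI allI impI ballI)
    fix i j assume "i < Suc q" "j < Suc q" "i \<noteq> j"
    then show "cdot L (w' i) (w' j) = 0"
      using orth[of i j] u_orth[of i] u_orth'[of j] by (cases "i = q"; cases "j = q") (simp_all add: w'_def)
  next
    fix i assume "i < Suc q"
    moreover have "\<exists>c. \<forall>l\<in>L. v q l = (\<Sum>j<q. v j l * c j)" if "N = 0"
      using xu wsum that by (intro exI[of _ E]) (simp add: x_def)
    ultimately show "cdot L (w' i) (w' i) = 1
        \<or> (\<forall>l. w' i l = 0) \<and> (\<exists>c. \<forall>l\<in>L. v i l = (\<Sum>j<i. v j l * c j))"
      using unit[of i] u_unit by (cases "i = q"; cases "N = 0") (simp_all add: w'_def u_def)
  next
    fix i assume i: "i < Suc q"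
    show "\<exists>c. \<forall>l\<in>L. w' i l = (\<Sum>j<Suc i. v j l * c j)"
    proof (cases "i = q")
      case True
      define D where "D = (\<lambda>j. if N = 0 then 0 else (if j = q then 1 else - E j) * complex_of_real (1/N))"
      have "u l = (\<Sum>j<Suc q. v j l * (if N = 0 then 0 else (if j = q then 1 else - E j) * complex_of_real (1/N)))"
        if "l \<in> L" for l
      proof (cases "N = 0")
        case False
        have "(\<Sum>j<q. v j l * ((if j = q then 1 else - E j) * complex_of_real (1/N)))
            = (\<Sum>j<q. - (v j l * E j * complex_of_real (1/N)))"
          by (intro sum.cong) auto
        then have "(\<Sum>j<Suc q. v j l * ((if j = q then 1 else - E j) * complex_of_real (1/N)))
            = (v q l - (\<Sum>j<q. v j l * E j)) * complex_of_real (1/N)"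
          by (simp only: sum.lessThan_Suc sum_negf sum_distrib_right[symmetric]) (simp add: left_diff_distrib diff_divide_distrib)
        then show ?thesis using False wsum[OF that] by (simp add: u_def x_def)
      qed (simp add: u_def)
      then have "\<forall>l\<in>L. w' q l = (\<Sum>j<Suc q. v j l * D j)"
        unfolding w'_def D_def by (simp only: fun_upd_same) simp
      then show ?thesis unfolding True by (rule exI[of _ D])
    next
      case False
      then show ?thesis using spn[of i] i by (simp add: w'_def)
    qed
  next
    fix i j :: nat assume "j < i"
    then show "R' i j = 0" using tri by (auto simp: R'_def)
  next
    fix j l assume "j < Suc q" "l \<in> L"
    then show "v j l = (\<Sum>i<Suc q. w' i l * R' i j)"
      using dec[of j l] xu[of l] by (cases "j = q") (simp_all add: w'_def R'_def x_def algebra_simps)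
  qed
  then show ?case by blast
qed

text \<open>Injectivity of \<open>M\<close> excludes the dependent alternative, so all Gram--Schmidt
  vectors are unit vectors. Existence is what gives the \<open>SOME\<close> in
  \<open>sd_count\<close> its meaning.\<close>

lemma thin_QR_exists:
  assumes inj: "\<And>c. (\<And>l. l < m \<Longrightarrow> (\<Sum>j<n. M l j * c j) = 0) \<Longrightarrow> (\<And>j. j < n \<Longrightarrow> c j = 0)"
  shows "\<exists>Q R. is_thin_QR m n M Q R"
proof -
  obtain w R where gs: "is_gram_schmidt {..<m} n (\<lambda>j l. M l j) w R"
    using gram_schmidt_exists[of "{..<m}" n "\<lambda>j l. M l j"] by auto
  note orth = is_gram_schmidtD(1)[OF gs] and unit = is_gram_schmidtD(2)[OF gs]
    and tri = is_gram_schmidtD(4)[OF gs] and dec = is_gram_schmidtD(5)[OF gs]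
  have "cdot {..<m} (w i) (w i) = 1" if i: "i < n" for i
  proof (rule ccontr)
    assume "cdot {..<m} (w i) (w i) \<noteq> 1"
    then obtain c where c: "\<forall>l\<in>{..<m}. M l i = (\<Sum>j<i. M l j * c j)"
      using unit[OF i] by blast
    define c' where "c' = (\<lambda>j. if j = i then -1 else if j < i then c j else 0)"
    have "(\<Sum>j<n. M l j * c' j) = 0" if "l < m" for l
    proof -
      have "(\<Sum>j<n. M l j * c' j) = (\<Sum>j<Suc i. M l j * c' j)"
        using i by (intro sum.mono_neutral_right) (auto simp: c'_def)
      also have "\<dots> = 0" using c that by (simp add: c'_def)
      finally show ?thesis .
    qed
    from inj[OF this i] show False by (simp add: c'_def)
  qed
  then show ?thesis
    using orth tri dec
    by (intro exI[of _ "\<lambda>l i. w i l"] exI[of _ R]) (simp add: is_thin_QR_def cdot_def)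
qed

subsection \<open>Gaussian integer points in a bounded frame\<close>

definition gaussian_int :: "complex \<Rightarrow> bool" where
  "gaussian_int s \<longleftrightarrow> Re s \<in> \<int> \<and> Im s \<in> \<int>"

lemma gaussian_int_diff: "gaussian_int a \<Longrightarrow> gaussian_int b \<Longrightarrow> gaussian_int (a - b)"
  by (simp add: gaussian_int_def)

lemma gaussian_int_eq_0:
  assumes "gaussian_int a" "cmod a < 1"
  shows "a = 0"
proof -
  have "\<bar>Re a\<bar> < 1" "\<bar>Im a\<bar> < 1"
    using assms(2) abs_Re_le_cmod[of a] abs_Im_le_cmod[of a] by linarith+
  then show ?thesis
    using assms(1) by (auto simp: gaussian_int_def complex_eq_iff elim!: Ints_cases)
qed

lemma card_floor_interval:
  fixes c :: real
  assumes "0 \<le> c"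
  shows "real (card {\<lfloor>- c\<rfloor>..\<lfloor>c\<rfloor>}) \<le> 2 * c + 2"
proof -
  have "\<lfloor>- c\<rfloor> \<le> \<lfloor>c\<rfloor>" using assms by (intro floor_mono) simp
  then have "real (card {\<lfloor>- c\<rfloor>..\<lfloor>c\<rfloor>}) = real_of_int (\<lfloor>c\<rfloor> - \<lfloor>- c\<rfloor> + 1)"
    by simp
  also have "\<dots> \<le> 2 * c + 2" by linarith
  finally show ?thesis .
qed

lemma floor_eq_abs_diff:
  fixes x y :: real
  assumes "\<lfloor>N * x\<rfloor> = \<lfloor>N * y\<rfloor>" "0 < N"
  shows "\<bar>x - y\<bar> \<le> 1 / N"
proof -
  have "\<bar>N * x - N * y\<bar> \<le> 1" using assms(1) by linarith
  also have "\<bar>N * x - N * y\<bar> = N * \<bar>x - y\<bar>"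
    using assms(2) by (simp add: abs_mult right_diff_distrib[symmetric])
  finally show ?thesis using assms(2) by (simp add: field_simps)
qed

text \<open>With \<open>w\<^sub>i\<close> the Gram--Schmidt vectors of the \<open>b\<^sub>j\<close>, the coordinate \<open>\<langle>w\<^sub>i, e\<rangle>\<close> is at most of
  order \<open>\<eta>\<close>, and at most of order \<open>r\<^sub>i\<close> because only the \<open>y\<^sub>j\<close> with \<open>j \<ge> i\<close> enter it. Rounding the
  coordinates to a fine grid separates Gaussian integer points.\<close>
lemma card_gaussian_int_points:
  fixes b :: "nat \<Rightarrow> nat \<Rightarrow> complex" and r :: "nat \<Rightarrow> real" and C \<eta> :: real
  assumes L: "finite L" and C: "0 \<le> C" and \<eta>: "0 \<le> \<eta>"
    and r0: "\<And>j. j < q \<Longrightarrow> 0 \<le> r j"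
    and r_anti: "\<And>i j. i \<le> j \<Longrightarrow> j < q \<Longrightarrow> r j \<le> r i"
    and b: "\<And>j l. j < q \<Longrightarrow> l \<in> L \<Longrightarrow> cmod (b j l) \<le> C"
    and E_ext: "E \<subseteq> extensional L"
    and E_int: "\<And>e l. e \<in> E \<Longrightarrow> l \<in> L \<Longrightarrow> gaussian_int (e l) \<and> cmod (e l) \<le> \<eta>"
    and E_span: "\<And>e. e \<in> E \<Longrightarrow> \<exists>y. (\<forall>j<q. cmod (y j) \<le> r j) \<and> (\<forall>l\<in>L. e l = (\<Sum>j<q. y j * b j l))"
  shows "real (card E)
    \<le> (\<Prod>i<q. (8 * (real q + 1) * (real (card L) + 1) * (real q * C + 1) * (min (r i) \<eta> + 1))\<^sup>2)"
proof -
  obtain w R where gs: "is_gram_schmidt L q b w R"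
    using gram_schmidt_exists[OF L] by blast
  note orth = is_gram_schmidtD(1)[OF gs] and tri = is_gram_schmidtD(4)[OF gs]
    and dec = is_gram_schmidtD(5)[OF gs]
  have unit: "cdot L (w i) (w i) = 1 \<or> (\<forall>l. w i l = 0)" if "i < q" for i
    using is_gram_schmidtD(2)[OF gs that] by blast
  have w1: "cmod (w i l) \<le> 1" if "i < q" "l \<in> L" for i l
    using unit[OF that(1)] cmod_le_1_if_cdot_self[OF L _ that(2)] by auto
  define t where "t = (\<lambda>e i. cdot L (w i) e)"
  \<comment> \<open>Expanding \<open>b j\<close> in the orthogonal family isolates
    \<open>R i j\<close>. Together with triangularity this eliminates all \<open>j < i\<close> from
    coordinate \<open>i\<close>.\<close>
  have cdot_b: "cdot L (w i) (b j) = (if cdot L (w i) (w i) = 1 then R i j else 0)" if "i < q" "j < q" for i j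
  proof -
    have "cdot L (w i) (b j) = cdot L (w i) (\<lambda>l. \<Sum>k<q. w k l * R k j)"
      unfolding cdot_def using dec[OF that(2)] by (intro sum.cong) auto
    also have "\<dots> = (\<Sum>k<q. cdot L (w i) (w k) * R k j)" by (rule cdot_sum_right)
    also have "\<dots> = (\<Sum>k<q. if k = i then cdot L (w i) (w i) * R i j else 0)"
      using orth that(1) by (intro sum.cong) auto
    also have "\<dots> = cdot L (w i) (w i) * R i j" using that(1) by simp
    also have "\<dots> = (if cdot L (w i) (w i) = 1 then R i j else 0)"
      using unit[OF that(1)] by (auto simp: cdot_def)
    finally show ?thesis .
  qed
  \<comment> \<open>Dominates the constants of both estimates: \<open>card L * (q * C)\<close>,
    which multiplies \<open>r i\<close>, and \<open>card L\<close>, which multiplies \<eta>.\<close>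
  define K where "K = real (card L) * (real q * C + 1)"
  have K0: "0 \<le> K" using C by (simp add: K_def)
  have t_le: "cmod (t e i) \<le> K * min (r i) \<eta>" and e_eq: "\<And>l. l \<in> L \<Longrightarrow> e l = (\<Sum>i<q. w i l * t e i)"
    if e: "e \<in> E" and i: "i < q" for e i
  proof -
    obtain y where y: "\<And>j. j < q \<Longrightarrow> cmod (y j) \<le> r j" "\<And>l. l \<in> L \<Longrightarrow> e l = (\<Sum>j<q. b j l * y j)"
      using E_span[OF e] by (metis (no_types, lifting) mult.commute sum.cong)
    have t_eq: "t e k = (\<Sum>j<q. cdot L (w k) (b j) * y j)" for k
    proof -
      have "t e k = cdot L (w k) (\<lambda>l. \<Sum>j<q. b j l * y j)"
        unfolding t_def cdot_def using y(2) by (intro sum.cong) auto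
      then show ?thesis by (simp only: cdot_sum_right)
    qed
    have term_le: "cmod (cdot L (w i) (b j) * y j) \<le> real (card L) * C * r i" if "j < q" for j
    proof (cases "j < i")
      case True
      then show ?thesis using cdot_b[OF i that] tri[OF True] C r0[OF i] by simp
    next
      case False
      have "cmod (y j) \<le> r i" using y(1)[OF that] r_anti[of i j] False that by linarith
      moreover have "cmod (cdot L (w i) (b j)) \<le> real (card L) * C"
        using w1[OF i] b[OF that] L by (intro cmod_cdot_le) auto
      ultimately show ?thesis using C by (auto simp: norm_mult intro!: mult_mono)
    qed
    have "cmod (t e i) \<le> (\<Sum>j<q. cmod (cdot L (w i) (b j) * y j))"
      unfolding t_eq by (rule norm_sum)
    also have "\<dots> \<le> (\<Sum>j<q. real (card L) * C * r i)" using term_le by (intro sum_mono) auto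
    also have "\<dots> = real (card L) * (real q * C) * r i" by simp
    also have "\<dots> \<le> K * r i" unfolding K_def using r0[OF i] by (intro mult_right_mono mult_left_mono) auto
    finally have "cmod (t e i) \<le> K * r i" .
    moreover have "cmod (t e i) \<le> K * \<eta>"
    proof -
      have "cmod (t e i) \<le> real (card L) * \<eta>"
        unfolding t_def using w1[OF i] E_int[OF e] L by (intro cmod_cdot_le) auto
      also have "\<dots> \<le> K * \<eta>" unfolding K_def using \<eta> C
        by (intro mult_right_mono) (auto simp: algebra_simps)
      finally show ?thesis .
    qed
    ultimately show "cmod (t e i) \<le> K * min (r i) \<eta>" by (auto simp: min_def)
    fix l assume l: "l \<in> L"
    have wt: "w k l * t e k = (\<Sum>j<q. w k l * R k j * y j)" if "k < q" for k
    proof (cases "\<forall>l. w k l = 0")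
      case False
      then have "cdot L (w k) (w k) = 1" using unit[OF that] by blast
      then show ?thesis unfolding t_eq using cdot_b[OF that]
        by (simp add: sum_distrib_left mult.assoc)
    qed simp
    have "e l = (\<Sum>j<q. \<Sum>k<q. w k l * R k j * y j)"
      unfolding y(2)[OF l] by (intro sum.cong) (auto simp: dec[OF _ l] sum_distrib_right)
    also have "\<dots> = (\<Sum>k<q. w k l * t e k)" using wt by (subst sum.swap) auto
    finally show "e l = (\<Sum>i<q. w i l * t e i)" .
  qed
  \<comment> \<open>With this mesh, equal roundings force the entries of two points to differ by at
    most \<open>q * (2 / N) < 1\<close>, and Gaussian integers that close coincide.\<close>
  define N where "N = 4 * (real q + 1)"
  have N0: "0 < N" by (simp add: N_def add_pos_nonneg)
  define c where "c = (\<lambda>i. N * (K * min (r i) \<eta>))"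
  have c0: "0 \<le> c i" if "i < q" for i using N0 K0 r0[OF that] \<eta> by (simp add: c_def)
  define F where "F = (\<lambda>i. {\<lfloor>- c i\<rfloor>..\<lfloor>c i\<rfloor>} \<times> {\<lfloor>- c i\<rfloor>..\<lfloor>c i\<rfloor>})"
  define \<phi> where "\<phi> = (\<lambda>e. \<lambda>i\<in>{..<q}. (\<lfloor>N * Re (t e i)\<rfloor>, \<lfloor>N * Im (t e i)\<rfloor>))"
  have \<phi>_in: "\<phi> ` E \<subseteq> PiE {..<q} F"
  proof (intro image_subsetI PiE_I)
    fix e i assume e: "e \<in> E" and "i \<in> {..<q}"
    then have i: "i < q" by simp
    have "\<bar>Re (t e i)\<bar> \<le> K * min (r i) \<eta>" "\<bar>Im (t e i)\<bar> \<le> K * min (r i) \<eta>"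
      using t_le[OF e i] abs_Re_le_cmod[of "t e i"] abs_Im_le_cmod[of "t e i"] by linarith+
    then have "\<bar>N * Re (t e i)\<bar> \<le> c i" "\<bar>N * Im (t e i)\<bar> \<le> c i"
      using N0 by (auto simp: c_def abs_mult)
    then show "\<phi> e i \<in> F i" using i by (auto simp: \<phi>_def F_def intro!: floor_mono)
  qed (simp add: \<phi>_def)
  have inj: "inj_on \<phi> E"
  proof (rule inj_onI)
    fix e e' assume e: "e \<in> E" and e': "e' \<in> E" and eq: "\<phi> e = \<phi> e'"
    have close: "cmod (t e i - t e' i) \<le> 2 / N" if "i < q" for i
    proof -
      have "\<phi> e i = \<phi> e' i" using eq by simp
      then have "\<lfloor>N * Re (t e i)\<rfloor> = \<lfloor>N * Re (t e' i)\<rfloor>" "\<lfloor>N * Im (t e i)\<rfloor> = \<lfloor>N * Im (t e' i)\<rfloor>"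
        using that by (simp_all add: \<phi>_def)
      then have "\<bar>Re (t e i - t e' i)\<bar> \<le> 1 / N" "\<bar>Im (t e i - t e' i)\<bar> \<le> 1 / N"
        using floor_eq_abs_diff N0 by auto
      then show ?thesis using cmod_le[of "t e i - t e' i"] by simp
    qed
    show "e = e'"
    proof (rule extensionalityI[of _ L])
      fix l assume l: "l \<in> L"
      \<comment> \<open>\<open>e_eq\<close> presupposes some \<open>i < q\<close>; for
        \<open>q = 0\<close> the span condition already makes both points zero on
        \<open>L\<close>.\<close>
      have "e l = (\<Sum>i<q. w i l * t e i)" "e' l = (\<Sum>i<q. w i l * t e' i)"
        using e_eq[OF e _ l] e_eq[OF e' _ l] E_span[OF e] E_span[OF e'] l by (cases "q = 0"; auto)+
      then have "e l - e' l = (\<Sum>i<q. w i l * (t e i - t e' i))"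
        by (simp add: right_diff_distrib sum_subtractf)
      also have "cmod \<dots> \<le> (\<Sum>i<q. cmod (w i l * (t e i - t e' i)))" by (rule norm_sum)
      also have "\<dots> \<le> (\<Sum>i<q. 1 * (2 / N))"
        unfolding norm_mult using w1[OF _ l] close N0 by (intro sum_mono mult_mono) auto
      also have "\<dots> < 1" by (simp add: N_def field_simps)
      finally have "cmod (e l - e' l) < 1" .
      then show "e l = e' l"
        using gaussian_int_eq_0[OF gaussian_int_diff] E_int[OF e l] E_int[OF e' l] by fastforce
    qed (use e e' E_ext in auto)
  qed
  have finF: "finite (PiE {..<q} F)" by (intro finite_PiE) (auto simp: F_def)
  have "card E \<le> card (PiE {..<q} F)" using card_inj_on_le[OF inj \<phi>_in finF] .
  then have "real (card E) \<le> (\<Prod>i<q. real (card (F i)))"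
    by (simp add: card_PiE flip: of_nat_prod)
  also have "\<dots> \<le> (\<Prod>i<q. (8 * (real q + 1) * (real (card L) + 1) * (real q * C + 1) * (min (r i) \<eta> + 1))\<^sup>2)"
  proof (intro prod_mono conjI)
    fix i assume "i \<in> {..<q}"
    then have i: "i < q" by simp
    have m0: "0 \<le> min (r i) \<eta>" using r0[OF i] \<eta> by simp
    have A: "1 \<le> (real q + 1) * ((real (card L) + 1) * (real q * C + 1))"
      using C by (intro mult_ge1_I) auto
    have "real (card {\<lfloor>- c i\<rfloor>..\<lfloor>c i\<rfloor>}) \<le> 2 * c i + 2" by (rule card_floor_interval[OF c0[OF i]])
    also have "\<dots> \<le> 8 * ((real q + 1) * ((real (card L) + 1) * (real q * C + 1)) * min (r i) \<eta>)
        + 8 * ((real q + 1) * ((real (card L) + 1) * (real q * C + 1)))"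
    proof (intro add_mono)
      have "2 * c i = 8 * ((real q + 1) * (real (card L) * (real q * C + 1)) * min (r i) \<eta>)"
        by (simp add: c_def N_def K_def)
      also have "\<dots> \<le> 8 * ((real q + 1) * ((real (card L) + 1) * (real q * C + 1)) * min (r i) \<eta>)"
        using C m0 by (intro mult_left_mono mult_right_mono) auto
      finally show "2 * c i \<le> 8 * ((real q + 1) * ((real (card L) + 1) * (real q * C + 1)) * min (r i) \<eta>)" .
    qed (use A in linarith)
    also have "\<dots> = 8 * (real q + 1) * (real (card L) + 1) * (real q * C + 1) * (min (r i) \<eta> + 1)"
      by (simp add: algebra_simps)
    finally have "(real (card {\<lfloor>- c i\<rfloor>..\<lfloor>c i\<rfloor>}))\<^sup>2
      \<le> (8 * (real q + 1) * (real (card L) + 1) * (real q * C + 1) * (min (r i) \<eta> + 1))\<^sup>2"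
      by (intro power_mono) auto
    then show "real (card (F i)) \<le> (8 * (real q + 1) * (real (card L) + 1) * (real q * C + 1) * (min (r i) \<eta> + 1))\<^sup>2"
      by (simp only: F_def card_cartesian_product of_nat_mult power2_eq_square)
  qed auto
  finally show "real (card E) \<le> (\<Prod>i<q. (8 * (real q + 1) * (real (card L) + 1) * (real q * C + 1) * (min (r i) \<eta> + 1))\<^sup>2)" .
qed

subsection \<open>Complete pivoting\<close>

text \<open>A zero pivot leaves \<open>H\<close> unchanged because \<open>x / 0 = 0\<close>, so the
  elimination is defined for every matrix.\<close>

definition schur :: "nat \<Rightarrow> nat \<Rightarrow> (nat \<times> nat \<Rightarrow> complex) \<Rightarrow> nat \<times> nat \<Rightarrow> complex" where
  "schur a b H = (\<lambda>(i, j). H (i, j) - H (i, b) * H (a, j) / H (a, b))"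

text \<open>\<open>\<beta> k\<close> belongs to the stage of the elimination with \<open>Suc k\<close> columns left. The pivot need not be
  the largest entry, which keeps the sets simple for the volume estimate.\<close>
primrec small_stages :: "nat \<Rightarrow> nat set \<Rightarrow> nat set \<Rightarrow> (nat \<Rightarrow> real) \<Rightarrow> (nat \<times> nat \<Rightarrow> complex) \<Rightarrow> bool" where
  "small_stages 0 I J \<beta> H \<longleftrightarrow> True"
| "small_stages (Suc n) I J \<beta> H \<longleftrightarrow> (\<exists>a\<in>I. \<exists>b\<in>J. (\<forall>i\<in>I. \<forall>j\<in>J. cmod (H (i, j)) \<le> \<beta> n) \<and>
     small_stages n (I - {a}) (J - {b}) \<beta> (schur a b H))"

text \<open>The interface between the two halves of the proof, bundled so that it can be carried
  through one induction. \<open>P\<close> plays the role of the singular values in increasing order.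
  The upper bound on \<open>P\<close> serves channels with bounded entries, the implication to
  \<open>small_stages\<close> serves the probability estimate, and the last clause serves counting:
  it inverts \<open>H\<close> approximately, with coefficients inversely proportional to
  \<open>P k\<close>.\<close>

definition pivot_profile ::
    "nat \<Rightarrow> nat set \<Rightarrow> nat set \<Rightarrow> (nat \<times> nat \<Rightarrow> complex) \<Rightarrow> (nat \<Rightarrow> real) \<Rightarrow> (nat \<Rightarrow> nat \<Rightarrow> complex) \<Rightarrow> bool"
  where "pivot_profile n I J H P u \<longleftrightarrow>
     (\<forall>i j. i \<le> j \<longrightarrow> j < n \<longrightarrow> P i \<le> P j) \<and> (\<forall>k<n. 0 \<le> P k) \<and>
     (\<forall>k<n. \<forall>j\<in>J. cmod (u k j) \<le> fact n) \<and>
     (\<forall>B. (\<forall>i\<in>I. \<forall>j\<in>J. cmod (H (i, j)) \<le> B) \<longrightarrow> (\<forall>k<n. P k \<le> 2 ^ n * B)) \<and>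
     (\<forall>\<beta>. (\<forall>k<n. P k \<le> \<beta> k) \<longrightarrow> small_stages n I J \<beta> H) \<and>
     ((\<forall>k<n. 0 < P k) \<longrightarrow> (\<forall>X s. (\<forall>i\<in>I. cmod (\<Sum>j\<in>J. H (i, j) * X j) \<le> s) \<longrightarrow>
        (\<exists>y. (\<forall>k<n. cmod (y k) * P k \<le> 2 ^ n * s) \<and> (\<forall>j\<in>J. X j = (\<Sum>k<n. y k * u k j)))))"

lemma pivot_profileD:
  assumes "pivot_profile n I J H P u"
  shows "\<And>i j. i \<le> j \<Longrightarrow> j < n \<Longrightarrow> P i \<le> P j"
    and "\<And>k. k < n \<Longrightarrow> 0 \<le> P k"
    and "\<And>k j. k < n \<Longrightarrow> j \<in> J \<Longrightarrow> cmod (u k j) \<le> fact n"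
    and "\<And>B k. (\<And>i j. i \<in> I \<Longrightarrow> j \<in> J \<Longrightarrow> cmod (H (i, j)) \<le> B) \<Longrightarrow> k < n \<Longrightarrow> P k \<le> 2 ^ n * B"
    and "\<And>\<beta>. (\<And>k. k < n \<Longrightarrow> P k \<le> \<beta> k) \<Longrightarrow> small_stages n I J \<beta> H"
    and "\<And>X s. (\<And>k. k < n \<Longrightarrow> 0 < P k) \<Longrightarrow> (\<And>i. i \<in> I \<Longrightarrow> cmod (\<Sum>j\<in>J. H (i, j) * X j) \<le> s) \<Longrightarrow>
      \<exists>y. (\<forall>k<n. cmod (y k) * P k \<le> 2 ^ n * s) \<and> (\<forall>j\<in>J. X j = (\<Sum>k<n. y k * u k j))"
proof -
  note pp = assms[unfolded pivot_profile_def]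
  show "\<And>i j. i \<le> j \<Longrightarrow> j < n \<Longrightarrow> P i \<le> P j"
    by (rule pp[THEN conjunct1, rule_format])
  show "\<And>k. k < n \<Longrightarrow> 0 \<le> P k"
    by (rule pp[THEN conjunct2, THEN conjunct1, rule_format])
  show "\<And>k j. k < n \<Longrightarrow> j \<in> J \<Longrightarrow> cmod (u k j) \<le> fact n"
    by (rule pp[THEN conjunct2, THEN conjunct2, THEN conjunct1, rule_format])
  show "\<And>B k. (\<And>i j. i \<in> I \<Longrightarrow> j \<in> J \<Longrightarrow> cmod (H (i, j)) \<le> B) \<Longrightarrow> k < n \<Longrightarrow> P k \<le> 2 ^ n * B"
    by (rule pp[THEN conjunct2, THEN conjunct2, THEN conjunct2, THEN conjunct1, rule_format])
  show "\<And>\<beta>. (\<And>k. k < n \<Longrightarrow> P k \<le> \<beta> k) \<Longrightarrow> small_stages n I J \<beta> H"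
    by (rule pp[THEN conjunct2, THEN conjunct2, THEN conjunct2, THEN conjunct2, THEN conjunct1, rule_format])
  show "\<And>X s. (\<And>k. k < n \<Longrightarrow> 0 < P k) \<Longrightarrow> (\<And>i. i \<in> I \<Longrightarrow> cmod (\<Sum>j\<in>J. H (i, j) * X j) \<le> s) \<Longrightarrow>
      \<exists>y. (\<forall>k<n. cmod (y k) * P k \<le> 2 ^ n * s) \<and> (\<forall>j\<in>J. X j = (\<Sum>k<n. y k * u k j))"
    by (rule pp[THEN conjunct2, THEN conjunct2, THEN conjunct2, THEN conjunct2, THEN conjunct2, rule_format])
qed

text \<open>Complete pivoting keeps all multipliers bounded by \<open>1\<close>, so up to constants the pivots play the
  role of the singular values. The factor \<open>2 ^ Suc n\<close> in the profile compensates the possible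
  doubling of the entries in each step and makes the profile exactly monotone.\<close>
lemma pivot_profile_exists:
  assumes "finite I" "finite J" "card J = n" "n \<le> card I"
  shows "\<exists>P u. pivot_profile n I J H P u"
  using assms
proof (induction n arbitrary: I J H)
  case 0
  then have "J = {}" by simp
  then show ?case by (simp add: pivot_profile_def)
next
  case (Suc n)
  have ne: "I \<times> J \<noteq> {}" and fin: "finite (I \<times> J)" using Suc.prems by auto
  define h where "h = Max ((\<lambda>p. cmod (H p)) ` (I \<times> J))"
  have "h \<in> (\<lambda>p. cmod (H p)) ` (I \<times> J)" unfolding h_def using ne fin by (intro Max_in) auto
  then obtain a b where ab: "a \<in> I" "b \<in> J" and hab: "h = cmod (H (a, b))" by auto
  have h_max: "cmod (H (i, j)) \<le> h" if "i \<in> I" "j \<in> J" for i j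
    unfolding h_def using that fin by (intro Max_ge) auto
  have h0: "0 \<le> h" unfolding hab by simp
  \<comment> \<open>Valid for \<open>h = 0\<close> as well, since the quotient is then 0.\<close>
  have mult_le: "cmod (H (i, b) / H (a, b)) \<le> 1" if "i \<in> I" for i
    using h_max[OF that ab(2)] hab by (simp add: norm_divide divide_le_eq_1)
  have mult_le': "cmod (H (a, j) / H (a, b)) \<le> 1" if "j \<in> J" for j
    using h_max[OF ab(1) that] hab by (simp add: norm_divide divide_le_eq_1)
  define H' where "H' = schur a b H"
  have H'_le: "cmod (H' (i, j)) \<le> 2 * h" if "i \<in> I" "j \<in> J" for i j
  proof -
    have "cmod (H' (i, j)) \<le> cmod (H (i, j)) + cmod (H (i, b) / H (a, b)) * cmod (H (a, j))"
      unfolding H'_def schur_def prod.case norm_mult[symmetric]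
      by (rule order_trans[OF norm_triangle_ineq4]) simp
    also have "\<dots> \<le> h + 1 * h"
      using h_max that ab mult_le[OF that(1)] by (intro add_mono mult_mono) auto
    finally show ?thesis by simp
  qed
  define I' where "I' = I - {a}"
  define J' where "J' = J - {b}"
  have IJ': "finite I'" "finite J'" "card J' = n" "n \<le> card I'" "I' \<subseteq> I" "J' \<subseteq> J"
    using Suc.prems ab by (auto simp: I'_def J'_def)
  obtain P' u' where pp: "pivot_profile n I' J' H' P' u'"
    using Suc.IH[OF IJ'(1-4)] by blast
  note pp' = pivot_profileD[OF pp]
  define P where "P = (\<lambda>k. if k < n then P' k else 2 ^ Suc n * h)"
  \<comment> \<open>Back substitution: entry \<open>b\<close> is chosen so that the pivot row
    annihilates \<open>u k\<close> for \<open>k < n\<close> when the pivot is nonzero. The last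
    vector is the unit vector at \<open>b\<close>, the direction of the pivot itself.\<close>
  define u where "u = (\<lambda>k j. if k < n then
      if j = b then - (\<Sum>j\<in>J'. H (a, j) / H (a, b) * u' k j) else u' k j
      else if j = b then 1 else 0)"
  have P'_le: "P' k \<le> 2 ^ n * (2 * h)" if "k < n" for k
    using pp'(4)[OF H'_le that] IJ' by blast
  have "pivot_profile (Suc n) I J H P u"
    unfolding pivot_profile_def
  proof (intro conjI allI impI ballI)
    fix i j assume "i \<le> j" "j < Suc n"
    then show "P i \<le> P j" using pp'(1)[of i j] P'_le[of i] by (auto simp: P_def)
  next
    fix k assume "k < Suc n"
    then show "0 \<le> P k" using pp'(2)[of k] h0 by (auto simp: P_def)
  next
    fix k j assume k: "k < Suc n" and j: "j \<in> J"
    have f1: "(1::real) \<le> fact (Suc n)" by (rule fact_ge_1)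
    show "cmod (u k j) \<le> fact (Suc n)"
    proof (cases "k < n")
      case True
      have "cmod (u k b) \<le> (\<Sum>j\<in>J'. cmod (H (a, j) / H (a, b) * u' k j))"
        using True by (simp add: u_def del: norm_mult norm_divide) (rule norm_sum)
      also have "\<dots> \<le> (\<Sum>j\<in>J'. 1 * fact n)"
        unfolding norm_mult using True mult_le' pp'(3) IJ' by (intro sum_mono mult_mono) auto
      also have "\<dots> = real n * fact n" using IJ' by simp
      also have "\<dots> \<le> fact (Suc n)" by (simp add: algebra_simps)
      finally have "cmod (u k b) \<le> fact (Suc n)" .
      moreover have "cmod (u k j) \<le> fact (Suc n)" if "j \<noteq> b"
      proof -
        have "cmod (u k j) \<le> fact n" using True that j pp'(3)[of k j] by (simp add: u_def J'_def)
        also have "\<dots> \<le> fact (Suc n)" by (rule fact_mono) simp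
        finally show ?thesis .
      qed
      ultimately show ?thesis by blast
    next
      case False
      then show ?thesis using f1 by (auto simp: u_def simp del: fact_Suc)
    qed
  next
    fix B k assume B: "\<forall>i\<in>I. \<forall>j\<in>J. cmod (H (i, j)) \<le> B" and k: "k < Suc n"
    have "P k \<le> 2 ^ Suc n * h" using k P'_le[of k] by (auto simp: P_def)
    also have "\<dots> \<le> 2 ^ Suc n * B" using B ab hab by (intro mult_left_mono) auto
    finally show "P k \<le> 2 ^ Suc n * B" .
  next
    fix \<beta> assume \<beta>: "\<forall>k<Suc n. P k \<le> \<beta> k"
    then have "2 ^ Suc n * h \<le> \<beta> n" by (auto simp: P_def)
    moreover have "h \<le> 2 ^ Suc n * h" using h0 mult_right_mono[of 1 "2 ^ Suc n" h] by (simp add: one_le_power del: power_Suc)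
    ultimately have "\<forall>i\<in>I. \<forall>j\<in>J. cmod (H (i, j)) \<le> \<beta> n" using h_max by fastforce
    moreover have "small_stages n I' J' \<beta> H'"
    proof (rule pp'(5))
      fix k assume "k < n"
      then show "P' k \<le> \<beta> k" using \<beta>[rule_format, of k] by (simp add: P_def)
    qed
    ultimately show "small_stages (Suc n) I J \<beta> H"
      using ab unfolding small_stages.simps I'_def J'_def H'_def by blast
  next
    fix X s assume P0: "\<forall>k<Suc n. 0 < P k" and X: "\<forall>i\<in>I. cmod (\<Sum>j\<in>J. H (i, j) * X j) \<le> s"
    have hpos: "0 < h" using P0[rule_format, of n] by (simp add: P_def zero_less_mult_iff)
    then have hab0: "H (a, b) \<noteq> 0" using hab by auto
    define z where "z = (\<Sum>j\<in>J. H (a, j) * X j)"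
    have z: "cmod z \<le> s" using X ab by (simp add: z_def)
    have split: "(\<Sum>j\<in>J. H (i, j) * X j) = H (i, b) * X b + (\<Sum>j\<in>J'. H (i, j) * X j)" for i
      unfolding J'_def using Suc.prems(2) ab(2) by (rule sum.remove)
    have Xb: "X b = z / H (a, b) - (\<Sum>j\<in>J'. H (a, j) / H (a, b) * X j)"
      using hab0 unfolding z_def split
      by (simp add: add_divide_distrib sum_divide_distrib)
    \<comment> \<open>Clearing the pivot column subtracts from each row a multiple of the pivot row,
      of modulus at most 1, so the bound on the images at most doubles.\<close>
    have "\<exists>y. (\<forall>k<n. cmod (y k) * P' k \<le> 2 ^ n * (2 * s)) \<and> (\<forall>j\<in>J'. X j = (\<Sum>k<n. y k * u' k j))"
    proof (rule pp'(6))
      fix k assume "k < n" then show "0 < P' k" using P0[rule_format, of k] by (simp add: P_def)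
    next
      fix i assume i: "i \<in> I'"
      then have iI: "i \<in> I" using IJ' by blast
      have "(\<Sum>j\<in>J'. H' (i, j) * X j)
          = (\<Sum>j\<in>J'. H (i, j) * X j) - H (i, b) / H (a, b) * (\<Sum>j\<in>J'. H (a, j) * X j)"
        by (simp add: H'_def schur_def left_diff_distrib sum_subtractf sum_distrib_left mult.assoc)
      also have "\<dots> = (\<Sum>j\<in>J. H (i, j) * X j) - H (i, b) / H (a, b) * z"
        using hab0 unfolding z_def split by (simp add: field_simps)
      finally have eq: "(\<Sum>j\<in>J'. H' (i, j) * X j) = (\<Sum>j\<in>J. H (i, j) * X j) - H (i, b) / H (a, b) * z" .
      have "cmod (H (i, b) / H (a, b) * z) \<le> 1 * s"
        unfolding norm_mult using mult_le[OF iI] z by (intro mult_mono) auto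
      then show "cmod (\<Sum>j\<in>J'. H' (i, j) * X j) \<le> 2 * s"
        unfolding eq using X[rule_format, OF iI] norm_triangle_ineq4[of "\<Sum>j\<in>J. H (i, j) * X j" "H (i, b) / H (a, b) * z"]
        by linarith
    qed
    then obtain y' where y': "\<And>k. k < n \<Longrightarrow> cmod (y' k) * P' k \<le> 2 ^ n * (2 * s)"
      "\<And>j. j \<in> J' \<Longrightarrow> X j = (\<Sum>k<n. y' k * u' k j)" by blast
    define y where "y = (\<lambda>k. if k < n then y' k else z / H (a, b))"
    have "X j = (\<Sum>k<Suc n. y k * u k j)" if "j \<in> J" for j
    proof (cases "j = b")
      case True
      have "(\<Sum>j\<in>J'. H (a, j) / H (a, b) * X j)
          = (\<Sum>j\<in>J'. \<Sum>k<n. y' k * (H (a, j) / H (a, b) * u' k j))"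
        by (intro sum.cong refl) (simp add: y'(2) sum_distrib_left mult_ac)
      also have "\<dots> = (\<Sum>k<n. y' k * (\<Sum>j\<in>J'. H (a, j) / H (a, b) * u' k j))"
        by (subst sum.swap) (simp add: sum_distrib_left)
      also have "\<dots> = - (\<Sum>k<n. y k * u k b)"
        by (simp add: y_def u_def sum_negf)
      finally have "X b = z / H (a, b) + (\<Sum>k<n. y k * u k b)" using Xb by simp
      then show ?thesis using True by (simp add: y_def u_def)
    next
      case False
      then have "X j = (\<Sum>k<n. y' k * u' k j)" using that y'(2) by (simp add: J'_def)
      also have "\<dots> = (\<Sum>k<n. y k * u k j)" using False by (intro sum.cong) (auto simp: y_def u_def)
      finally show ?thesis using False by (simp add: u_def)
    qed
    moreover have "cmod (y k) * P k \<le> 2 ^ Suc n * s" if "k < Suc n" for k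
    proof (cases "k < n")
      case True
      then show ?thesis using y'(1)[of k] by (simp add: y_def P_def)
    next
      case False
      have "cmod (y k) * P k = 2 ^ Suc n * cmod z"
        using False hpos hab by (simp add: y_def P_def norm_divide)
      also have "\<dots> \<le> 2 ^ Suc n * s" using z by (intro mult_left_mono) auto
      finally show ?thesis .
    qed
    ultimately show "\<exists>y. (\<forall>k<Suc n. cmod (y k) * P k \<le> 2 ^ Suc n * s) \<and> (\<forall>j\<in>J. X j = (\<Sum>k<Suc n. y k * u k j))"
      by blast
  qed
  then show ?case by blast
qed

subsection \<open>Gaussian volume of matrices with small pivots\<close>

lemma sets_CN[simp, measurable_cong]: "sets CN = sets borel"
  by (simp add: CN_def)

lemma space_CN[simp]: "space CN = UNIV"
  by (simp add: CN_def)

text \<open>Variance 1 per real component, twice that of \<open>CN\<close>: this wider Gaussian is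
  the integrable majorant in the tail bound below.\<close>

lemma nn_integral_std_normal_complex:
  "(\<integral>\<^sup>+z. ennreal (exp (- (cmod z)\<^sup>2 / 2) / (2 * pi)) \<partial>lborel) = 1"
proof -
  have one: "(\<integral>\<^sup>+x. ennreal (std_normal_density x) \<partial>lborel) = 1"
    by (subst nn_integral_eq_integral) simp_all
  have eq: "ennreal (exp (- (cmod z)\<^sup>2 / 2) / (2 * pi))
      = (\<Prod>b\<in>Basis. ennreal (std_normal_density (z \<bullet> b)))" for z
  proof -
    have "(\<Prod>b\<in>Basis. ennreal (std_normal_density (z \<bullet> b)))
        = ennreal (std_normal_density (Re z) * std_normal_density (Im z))"
      by (simp add: Basis_complex_def inner_complex_def ennreal_mult)
    also have "std_normal_density (Re z) * std_normal_density (Im z)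
        = exp (- (Re z)\<^sup>2 / 2 + - (Im z)\<^sup>2 / 2) / (sqrt (2 * pi) * sqrt (2 * pi))"
      unfolding std_normal_density_def exp_add by simp
    also have "\<dots> = exp (- (cmod z)\<^sup>2 / 2) / (2 * pi)"
      by (simp add: cmod_power2 add_divide_distrib)
    finally show ?thesis by simp
  qed
  have "(\<integral>\<^sup>+z. ennreal (exp (- (cmod z)\<^sup>2 / 2) / (2 * pi)) \<partial>lborel)
      = (\<Prod>b\<in>(Basis :: complex set). \<integral>\<^sup>+x. ennreal (std_normal_density x) \<partial>lborel)"
    unfolding eq by (rule nn_integral_lborel_prod) auto
  then show ?thesis using one by simp
qed

text \<open>Half of the exponent of the density pays for the tail, the other half is twice the
  density of the wider Gaussian. For \<open>R = 0\<close> this yields the total mass bound 2, which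
  is all that is used about the mass of \<open>CN\<close>.\<close>

lemma emeasure_CN_tail:
  assumes "0 \<le> R"
  shows "emeasure CN {z. R \<le> cmod z} \<le> ennreal (2 * exp (- R\<^sup>2 / 2))"
proof -
  have "emeasure CN {z. R \<le> cmod z}
      = (\<integral>\<^sup>+z. ennreal (exp (- (cmod z)\<^sup>2) / pi) * indicator {z. R \<le> cmod z} z \<partial>lborel)"
    unfolding CN_def by (rule emeasure_density) auto
  also have "\<dots> \<le> (\<integral>\<^sup>+z. ennreal (2 * exp (- R\<^sup>2 / 2)) * ennreal (exp (- (cmod z)\<^sup>2 / 2) / (2 * pi)) \<partial>lborel)"
  proof (rule nn_integral_mono)
    fix z :: complex
    show "ennreal (exp (- (cmod z)\<^sup>2) / pi) * indicator {z. R \<le> cmod z} z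
      \<le> ennreal (2 * exp (- R\<^sup>2 / 2)) * ennreal (exp (- (cmod z)\<^sup>2 / 2) / (2 * pi))"
    proof (cases "R \<le> cmod z")
      case True
      then have "R\<^sup>2 \<le> (cmod z)\<^sup>2" using assms by (rule power_mono)
      then have "exp (- (cmod z)\<^sup>2) \<le> exp (- R\<^sup>2 / 2 + - (cmod z)\<^sup>2 / 2)" by simp
      then have "exp (- (cmod z)\<^sup>2) / pi \<le> 2 * exp (- R\<^sup>2 / 2) * (exp (- (cmod z)\<^sup>2 / 2) / (2 * pi))"
        unfolding exp_add by (simp add: divide_right_mono)
      then show ?thesis using True by (simp add: ennreal_mult[symmetric] ennreal_leI)
    qed simp
  qed
  also have "\<dots> = ennreal (2 * exp (- R\<^sup>2 / 2))"
    by (subst nn_integral_cmult) (simp_all only: nn_integral_std_normal_complex mult_1_right, measurable)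
  finally show ?thesis .
qed

lemma finite_measure_CN: "finite_measure CN"
proof
  have "emeasure CN (space CN) \<le> ennreal 2" using emeasure_CN_tail[of 0] by simp
  then show "emeasure CN (space CN) \<noteq> \<infinity>" by (auto simp: top_unique)
qed

section \<open>Product measures: comparison with Lebesgue measure, and translation\<close>

interpretation CN: finite_measure CN by (rule finite_measure_CN)

interpretation PCN: product_sigma_finite "\<lambda>_. CN"
  by standard

interpretation PL: product_sigma_finite "\<lambda>_. lborel :: complex measure"
  by standard

lemma nn_integral_CN_le:
  assumes [measurable]: "f \<in> borel_measurable borel"
  shows "(\<integral>\<^sup>+z. f z \<partial>CN) \<le> (\<integral>\<^sup>+z. f z \<partial>lborel)"
proof -
  have "(\<integral>\<^sup>+z. f z \<partial>CN) = (\<integral>\<^sup>+z. ennreal (exp (- (cmod z)\<^sup>2) / pi) * f z \<partial>lborel)"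
    unfolding CN_def by (rule nn_integral_density) auto
  also have "\<dots> \<le> (\<integral>\<^sup>+z. 1 * f z \<partial>lborel)"
  proof (intro nn_integral_mono mult_right_mono)
    fix z :: complex
    have "exp (- (cmod z)\<^sup>2) / pi \<le> 1 / 1" using pi_gt3 by (intro frac_le) auto
    then show "ennreal (exp (- (cmod z)\<^sup>2) / pi) \<le> 1" by simp
  qed auto
  finally show ?thesis by simp
qed

text \<open>By Fubini one factor \<open>CN\<close> at a time is exchanged for Lebesgue
  measure.\<close>

lemma nn_integral_PiM_CN_le:
  assumes "finite K" "f \<in> borel_measurable (PiM K (\<lambda>_. lborel :: complex measure))"
  shows "(\<integral>\<^sup>+x. f x \<partial>PiM K (\<lambda>_. CN)) \<le> (\<integral>\<^sup>+x. f x \<partial>PiM K (\<lambda>_. lborel))"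
  using assms
proof (induction K arbitrary: f rule: finite_induct)
  case empty
  then show ?case by (simp add: PiM_empty)
next
  case (insert i K)
  have sets_eq: "sets (PiM A (\<lambda>_. CN)) = sets (PiM A (\<lambda>_. lborel))" for A :: "'a set"
    by (intro sets_PiM_cong) auto
  have f1: "f \<in> borel_measurable (PiM (insert i K) (\<lambda>_. CN))"
    using insert.prems measurable_cong_sets[OF sets_eq refl] by blast
  have upd[measurable]: "(\<lambda>(x, y). f (x(i := y))) \<in> borel_measurable (PiM K (\<lambda>_. lborel) \<Otimes>\<^sub>M lborel)"
    using measurable_comp[OF measurable_add_dim insert.prems] by (simp add: comp_def split_beta)
  have "(\<integral>\<^sup>+x. f x \<partial>PiM (insert i K) (\<lambda>_. CN)) = (\<integral>\<^sup>+x. (\<integral>\<^sup>+y. f (x(i := y)) \<partial>CN) \<partial>PiM K (\<lambda>_. CN))"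
    by (rule PCN.product_nn_integral_insert[OF insert.hyps f1])
  also have "\<dots> \<le> (\<integral>\<^sup>+x. (\<integral>\<^sup>+y. f (x(i := y)) \<partial>lborel) \<partial>PiM K (\<lambda>_. CN))"
  proof (intro nn_integral_mono nn_integral_CN_le)
    fix x assume "x \<in> space (PiM K (\<lambda>_. CN))"
    then have "x \<in> space (PiM K (\<lambda>_. lborel :: complex measure))" by (simp add: space_PiM)
    from measurable_Pair2[OF upd this] show "(\<lambda>y. f (x(i := y))) \<in> borel_measurable borel"
      by simp
  qed
  also have "\<dots> \<le> (\<integral>\<^sup>+x. (\<integral>\<^sup>+y. f (x(i := y)) \<partial>lborel) \<partial>PiM K (\<lambda>_. lborel))"
    by (rule insert.IH, rule lborel.borel_measurable_nn_integral, rule upd)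
  also have "\<dots> = (\<integral>\<^sup>+x. f x \<partial>PiM (insert i K) (\<lambda>_. lborel))"
    by (rule PL.product_nn_integral_insert[OF insert.hyps insert.prems, symmetric])
  finally show ?case .
qed

text \<open>The product measure is determined by its values on boxes, where the shift acts on each
  factor separately.\<close>

lemma distr_PiM_lborel_shift:
  fixes c :: "'i \<Rightarrow> complex"
  assumes "finite K"
  shows "distr (PiM K (\<lambda>_. lborel)) (PiM K (\<lambda>_. lborel)) (\<lambda>x. \<lambda>k\<in>K. x k - c k) = PiM K (\<lambda>_. lborel)"
proof (rule PL.PiM_eqI[OF assms])
  have meas: "(\<lambda>x. \<lambda>k\<in>K. x k - c k) \<in> measurable (PiM K (\<lambda>_. lborel)) (PiM K (\<lambda>_. lborel))"
    by measurable
  fix A :: "'i \<Rightarrow> complex set" assume A: "\<And>i. i \<in> K \<Longrightarrow> A i \<in> sets lborel"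
  have B: "(\<lambda>z. z - c i) -` A i \<in> sets lborel" if "i \<in> K" for i
    using measurable_sets[of "\<lambda>z. z - c i" borel borel "A i"] A[OF that] by simp
  have "emeasure (distr (PiM K (\<lambda>_. lborel)) (PiM K (\<lambda>_. lborel)) (\<lambda>x. \<lambda>k\<in>K. x k - c k)) (PiE K A)
      = emeasure (PiM K (\<lambda>_. lborel)) ((\<lambda>x. \<lambda>k\<in>K. x k - c k) -` PiE K A \<inter> space (PiM K (\<lambda>_. lborel)))"
    using meas A assms by (intro emeasure_distr sets_PiM_I_finite) auto
  also have "(\<lambda>x. \<lambda>k\<in>K. x k - c k) -` PiE K A \<inter> space (PiM K (\<lambda>_. lborel))
      = PiE K (\<lambda>i. (\<lambda>z. z - c i) -` A i)"
    by (auto simp: space_PiM PiE_iff)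
  also have "emeasure (PiM K (\<lambda>_. lborel)) \<dots> = (\<Prod>i\<in>K. emeasure lborel ((\<lambda>z. z - c i) -` A i))"
    using B assms by (intro PL.emeasure_PiM) auto
  also have "\<dots> = (\<Prod>i\<in>K. emeasure lborel (A i))"
  proof (intro prod.cong refl)
    fix i assume i: "i \<in> K"
    have "emeasure lborel (A i) = emeasure (distr lborel borel ((+) (- c i))) (A i)"
      by (simp add: lborel_distr_plus)
    also have "\<dots> = emeasure lborel ((\<lambda>z. z - c i) -` A i)"
    proof -
      have "(+) (- c i) = (\<lambda>z. z - c i)" by auto
      then show ?thesis using A[OF i] by (subst emeasure_distr) auto
    qed
    finally show "emeasure lborel ((\<lambda>z. z - c i) -` A i) = emeasure lborel (A i)" by simp
  qed
  finally show "emeasure (distr (PiM K (\<lambda>_. lborel)) (PiM K (\<lambda>_. lborel)) (\<lambda>x. \<lambda>k\<in>K. x k - c k)) (PiE K A)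
      = (\<Prod>i\<in>K. emeasure lborel (A i))" .
qed simp

text \<open>All entries met during the elimination are formed from entries in
  \<open>I \<times> J\<close>. This permits replacing a Schur complement by a translated matrix that
  agrees with it only there.\<close>

lemma small_stages_cong:
  assumes "\<And>i j. i \<in> I \<Longrightarrow> j \<in> J \<Longrightarrow> H (i, j) = H' (i, j)"
  shows "small_stages n I J \<beta> H = small_stages n I J \<beta> H'"
  using assms
proof (induction n arbitrary: I J H H')
  case (Suc n)
  have "small_stages n (I - {a}) (J - {b}) \<beta> (schur a b H) = small_stages n (I - {a}) (J - {b}) \<beta> (schur a b H')"
    if "a \<in> I" "b \<in> J" for a b
    using that Suc.prems by (intro Suc.IH) (auto simp: schur_def)
  then show ?case using Suc.prems by (auto simp del: split_paired_All split_paired_Ex)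
qed simp

text \<open>\<open>F\<close> is a general measurable family rather than the coordinate map, so that
  the induction hypothesis applies to \<open>schur a b (F \<omega>)\<close>.\<close>

lemma small_stages_measurable:
  assumes "finite I" "finite J" "\<And>i j. i \<in> I \<Longrightarrow> j \<in> J \<Longrightarrow> (\<lambda>\<omega>. F \<omega> (i, j)) \<in> borel_measurable M"
  shows "Measurable.pred M (\<lambda>\<omega>. small_stages n I J \<beta> (F \<omega>))"
  using assms
proof (induction n arbitrary: I J F)
  case (Suc n)
  have *: "Measurable.pred M (\<lambda>\<omega>. small_stages n (I - {a}) (J - {b}) \<beta> (schur a b (F \<omega>)))"
    if ab: "a \<in> I" "b \<in> J" for a b
  proof (rule Suc.IH)
    fix i j assume ij: "i \<in> I - {a}" "j \<in> J - {b}"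
    have [measurable]: "(\<lambda>\<omega>. F \<omega> (i, j)) \<in> borel_measurable M" "(\<lambda>\<omega>. F \<omega> (i, b)) \<in> borel_measurable M"
      "(\<lambda>\<omega>. F \<omega> (a, j)) \<in> borel_measurable M" "(\<lambda>\<omega>. F \<omega> (a, b)) \<in> borel_measurable M"
      using ij ab by (auto intro!: Suc.prems(3))
    show "(\<lambda>\<omega>. schur a b (F \<omega>) (i, j)) \<in> borel_measurable M"
      unfolding schur_def prod.case by measurable
  qed (use Suc.prems in auto)
  have "Measurable.pred M (\<lambda>\<omega>. cmod (F \<omega> (i, j)) \<le> \<beta> n)" if "i \<in> I" "j \<in> J" for i j
  proof -
    note [measurable] = Suc.prems(3)[OF that]
    show ?thesis by measurable
  qed
  then show ?case unfolding small_stages.simps using Suc.prems(1,2) *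
    by (intro pred_intros_finite pred_intros_logic) auto
qed simp

lemma emeasure_lborel_disc_le:
  assumes "0 \<le> \<beta>"
  shows "emeasure lborel {z :: complex. cmod z \<le> \<beta>} \<le> ennreal (4 * \<beta>\<^sup>2)"
proof -
  have "{z :: complex. cmod z \<le> \<beta>} \<subseteq> cbox (Complex (- \<beta>) (- \<beta>)) (Complex \<beta> \<beta>)"
  proof
    fix z :: complex assume "z \<in> {z. cmod z \<le> \<beta>}"
    then have "\<bar>Re z\<bar> \<le> \<beta>" "\<bar>Im z\<bar> \<le> \<beta>"
      using abs_Re_le_cmod[of z] abs_Im_le_cmod[of z] by auto
    then show "z \<in> cbox (Complex (- \<beta>) (- \<beta>)) (Complex \<beta> \<beta>)"
      by (auto simp: in_cbox_complex_iff)
  qed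
  then have "emeasure lborel {z :: complex. cmod z \<le> \<beta>} \<le> emeasure lborel (cbox (Complex (- \<beta>) (- \<beta>)) (Complex \<beta> \<beta>))"
    by (intro emeasure_mono) auto
  also have "\<dots> = ennreal (4 * \<beta>\<^sup>2)"
    using assms by (subst emeasure_lborel_cbox) (auto simp: Basis_complex_def inner_complex_def power2_eq_square)
  finally show ?thesis .
qed

text \<open>Subtracting the rank-one part from the entries outside the pivot row and column is a
  translation once that row and column are fixed, so the volume factorises.\<close>
lemma emeasure_small_stages_lborel:
  assumes "finite I" "finite J" "card J = n" "card I = n + d" "\<And>k. k < n \<Longrightarrow> 0 \<le> \<beta> k"
  shows "emeasure (PiM (I \<times> J) (\<lambda>_. lborel)) {H \<in> space (PiM (I \<times> J) (\<lambda>_. lborel)). small_stages n I J \<beta> H}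
    \<le> (\<Prod>k<n. ennreal (real (d + k + 1) * real (k + 1) * (4 * (\<beta> k)\<^sup>2) ^ (d + 2 * k + 1)))"
  using assms
proof (induction n arbitrary: I J)
  case 0
  then have "J = {}" by simp
  then show ?case by (simp add: PiM_empty)
next
  case (Suc n)
  let ?L = "\<lambda>K. PiM K (\<lambda>_ :: nat \<times> nat. lborel :: complex measure)"
  define V where "V = (\<Prod>k<n. ennreal (real (d + k + 1) * real (k + 1) * (4 * (\<beta> k)\<^sup>2) ^ (d + 2 * k + 1)))"
  \<comment> \<open>The event with its first pivot position fixed. The union over all positions
    costs the factor \<open>(d + n + 1) * (n + 1)\<close>.\<close>
  define S where "S = (\<lambda>a b. {H \<in> space (?L (I \<times> J)). (\<forall>i\<in>I. \<forall>j\<in>J. cmod (H (i, j)) \<le> \<beta> n) \<and>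
     small_stages n (I - {a}) (J - {b}) \<beta> (schur a b H)})"
  have \<beta>n: "0 \<le> \<beta> n" using Suc.prems by simp
  have S_sets: "S a b \<in> sets (?L (I \<times> J))" if ab: "a \<in> I" "b \<in> J" for a b
  proof -
    have comp: "(\<lambda>H. H (i, j)) \<in> borel_measurable (?L (I \<times> J))" if "i \<in> I" "j \<in> J" for i j
      using measurable_component_singleton[of "(i, j)" "I \<times> J" "\<lambda>_. lborel :: complex measure"] that by simp
    have 1: "Measurable.pred (?L (I \<times> J)) (\<lambda>H. small_stages n (I - {a}) (J - {b}) \<beta> (schur a b H))"
    proof (rule small_stages_measurable)
      fix i j assume ij: "i \<in> I - {a}" "j \<in> J - {b}"
      have [measurable]: "(\<lambda>H. H (i, j)) \<in> borel_measurable (?L (I \<times> J))"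
        "(\<lambda>H. H (i, b)) \<in> borel_measurable (?L (I \<times> J))"
        "(\<lambda>H. H (a, j)) \<in> borel_measurable (?L (I \<times> J))"
        "(\<lambda>H. H (a, b)) \<in> borel_measurable (?L (I \<times> J))"
        using ij ab by (auto intro!: comp)
      show "(\<lambda>H. schur a b H (i, j)) \<in> borel_measurable (?L (I \<times> J))"
        unfolding schur_def prod.case by measurable
    qed (use Suc.prems in auto)
    have 2: "Measurable.pred (?L (I \<times> J)) (\<lambda>H. cmod (H (i, j)) \<le> \<beta> n)" if "i \<in> I" "j \<in> J" for i j
    proof -
      note [measurable] = comp[OF that]
      show ?thesis by measurable
    qed
    have "Measurable.pred (?L (I \<times> J)) (\<lambda>H. (\<forall>i\<in>I. \<forall>j\<in>J. cmod (H (i, j)) \<le> \<beta> n) \<and>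
       small_stages n (I - {a}) (J - {b}) \<beta> (schur a b H))"
      using 1 2 Suc.prems by (intro pred_intros_logic pred_intros_finite) auto
    then show ?thesis unfolding S_def by (simp add: pred_def)
  qed
  have S_le: "emeasure (?L (I \<times> J)) (S a b) \<le> ennreal ((4 * (\<beta> n)\<^sup>2) ^ (d + 2 * n + 1)) * V"
    if ab: "a \<in> I" "b \<in> J" for a b
  proof -
    define I' where "I' = I - {a}"
    define J' where "J' = J - {b}"
    define K' where "K' = I' \<times> J'"
    \<comment> \<open>The cross formed by the pivot row and column. It has
      \<open>(n + d + 1) + (n + 1) - 1 = d + 2 * n + 1\<close> entries, each confined to a disc of
      radius \<open>\<beta> n\<close>; this is the origin of the exponent.\<close>
    define K where "K = I \<times> J - K'"
    have fin: "finite K" "finite K'" using Suc.prems by (auto simp: K_def K'_def I'_def J'_def)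
    have disj: "K \<inter> K' = {}" by (auto simp: K_def)
    have un: "K \<union> K' = I \<times> J" by (auto simp: K_def K'_def I'_def J'_def)
    have cI': "card I' = n + d" and cJ': "card J' = n"
      using Suc.prems ab by (auto simp: I'_def J'_def)
    have "card K = card (I \<times> J) - card K'"
      unfolding K_def using fin by (intro card_Diff_subset) (auto simp: K'_def I'_def J'_def)
    also have "\<dots> = d + 2 * n + 1"
      using Suc.prems cI' cJ' by (simp add: K'_def card_cartesian_product)
    finally have cK: "card K = d + 2 * n + 1" .
    define A where "A = {H \<in> space (?L K'). small_stages n I' J' \<beta> H}"
    have A_sets: "A \<in> sets (?L K')"
    proof -
      have "Measurable.pred (?L K') (\<lambda>H. small_stages n I' J' \<beta> H)"
      proof (rule small_stages_measurable)
        fix i j assume "i \<in> I'" "j \<in> J'"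
        then show "(\<lambda>H. H (i, j)) \<in> borel_measurable (?L K')"
          using measurable_component_singleton[of "(i, j)" K' "\<lambda>_. lborel :: complex measure"] by (simp add: K'_def)
      qed (use Suc.prems in \<open>auto simp: I'_def J'_def\<close>)
      then show ?thesis unfolding A_def by (simp add: pred_def)
    qed
    have IH: "emeasure (?L K') A \<le> V"
      unfolding A_def K'_def V_def
      by (rule Suc.IH) (use Suc.prems cI' cJ' in \<open>auto simp: I'_def J'_def\<close>)
    define D where "D = PiE K (\<lambda>_. {z. cmod z \<le> \<beta> n})"
    have disc: "{z :: complex. cmod z \<le> \<beta> n} \<in> sets lborel" by simp
    have D_sets: "D \<in> sets (?L K)" unfolding D_def using fin disc by (intro sets_PiM_I_finite) auto
    have inner: "(\<integral>\<^sup>+y. indicator (S a b) (merge K K' (x, y)) \<partial>?L K') \<le> indicator D x * V"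
      if x: "x \<in> space (?L K)" for x
    proof -
      \<comment> \<open>The rank-one correction involves entries of the cross only, so it is
        constant in \<open>y\<close>.\<close>
      define c where "c = (\<lambda>(i, j). x (i, b) * x (a, j) / x (a, b))"
      define \<tau> where "\<tau> = (\<lambda>y. \<lambda>k\<in>K'. y k - c k)"
      have \<tau>_meas: "\<tau> \<in> measurable (?L K') (?L K')" unfolding \<tau>_def by measurable
      \<comment> \<open>An upper estimate: the size constraint of this stage is kept on the cross
        and dropped on \<open>K'\<close>.\<close>
      have pt: "indicator (S a b) (merge K K' (x, y)) \<le> indicator D x * (indicator A (\<tau> y) :: ennreal)"
        if y: "y \<in> space (?L K')" for y
      proof (cases "merge K K' (x, y) \<in> S a b")
        case True
        have mx: "merge K K' (x, y) k = x k" if "k \<in> K" for k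
          using that disj by simp
        have my: "merge K K' (x, y) k = y k" if "k \<in> K'" for k
          using that disj by (auto simp: merge_def)
        have "cmod (x k) \<le> \<beta> n" if "k \<in> K" for k
        proof -
          have "cmod (merge K K' (x, y) k) \<le> \<beta> n"
            using True that un unfolding S_def by (cases k) blast
          then show ?thesis by (simp only: mx[OF that])
        qed
        then have "x \<in> D" using x by (auto simp: D_def space_PiM PiE_iff)
        moreover have "small_stages n I' J' \<beta> (\<tau> y)"
        proof -
          have "small_stages n I' J' \<beta> (\<tau> y) = small_stages n I' J' \<beta> (schur a b (merge K K' (x, y)))"
          proof (rule small_stages_cong)
            fix i j assume ij: "i \<in> I'" "j \<in> J'"
            then have k: "(i, j) \<in> K'" "(i, b) \<in> K" "(a, j) \<in> K" "(a, b) \<in> K"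
              using ab by (auto simp: K_def K'_def I'_def J'_def)
            show "\<tau> y (i, j) = schur a b (merge K K' (x, y)) (i, j)"
              unfolding schur_def prod.case mx[OF k(2)] mx[OF k(3)] mx[OF k(4)] my[OF k(1)]
              using k(1) by (simp add: \<tau>_def c_def)
          qed
          then show ?thesis using True by (simp add: S_def I'_def J'_def)
        qed
        moreover have "\<tau> y \<in> space (?L K')" using measurable_space[OF \<tau>_meas y] .
        ultimately show ?thesis by (simp add: A_def indicator_def)
      qed simp
      have "(\<integral>\<^sup>+y. indicator (S a b) (merge K K' (x, y)) \<partial>?L K')
          \<le> (\<integral>\<^sup>+y. indicator D x * indicator A (\<tau> y) \<partial>?L K')"
        using pt by (intro nn_integral_mono) auto
      also have "\<dots> = indicator D x * (\<integral>\<^sup>+y. indicator A (\<tau> y) \<partial>?L K')"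
        by (intro nn_integral_cmult measurable_compose[OF \<tau>_meas] borel_measurable_indicator A_sets)
      also have "(\<integral>\<^sup>+y. indicator A (\<tau> y) \<partial>?L K') = (\<integral>\<^sup>+y. indicator A y \<partial>distr (?L K') (?L K') \<tau>)"
        using A_sets \<tau>_meas by (intro nn_integral_distr[symmetric]) auto
      also have "distr (?L K') (?L K') \<tau> = ?L K'"
        unfolding \<tau>_def by (rule distr_PiM_lborel_shift[OF fin(2)])
      also have "(\<integral>\<^sup>+y. indicator A y \<partial>?L K') = emeasure (?L K') A"
        using A_sets by simp
      finally show ?thesis using IH by (meson mult_left_mono order_trans zero_le)
    qed
    have "emeasure (?L (I \<times> J)) (S a b) = (\<integral>\<^sup>+H. indicator (S a b) H \<partial>?L (K \<union> K'))"
      unfolding un using S_sets[OF ab] by simp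
    also have "\<dots> = (\<integral>\<^sup>+x. (\<integral>\<^sup>+y. indicator (S a b) (merge K K' (x, y)) \<partial>?L K') \<partial>?L K)"
      using S_sets[OF ab] un by (intro PL.product_nn_integral_fold[OF disj fin]) auto
    also have "\<dots> \<le> (\<integral>\<^sup>+x. indicator D x * V \<partial>?L K)"
      using inner by (intro nn_integral_mono) auto
    also have "\<dots> = emeasure (?L K) D * V"
      using D_sets by (subst nn_integral_multc) auto
    also have "emeasure (?L K) D = (\<Prod>k\<in>K. emeasure lborel {z :: complex. cmod z \<le> \<beta> n})"
      unfolding D_def using fin disc by (intro PL.emeasure_PiM) auto
    also have "\<dots> \<le> (\<Prod>k\<in>K. ennreal (4 * (\<beta> n)\<^sup>2))"
      using emeasure_lborel_disc_le[OF \<beta>n] by (intro prod_mono_ennreal) auto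
    also have "\<dots> = ennreal ((4 * (\<beta> n)\<^sup>2) ^ (d + 2 * n + 1))"
      unfolding prod_constant cK by (rule ennreal_power) simp
    finally show ?thesis by (meson mult_right_mono zero_le)
  qed
  have "{H \<in> space (?L (I \<times> J)). small_stages (Suc n) I J \<beta> H} = (\<Union>p\<in>I \<times> J. S (fst p) (snd p))"
    unfolding S_def by (auto simp del: split_paired_All split_paired_Ex) force
  then have "emeasure (?L (I \<times> J)) {H \<in> space (?L (I \<times> J)). small_stages (Suc n) I J \<beta> H}
      = emeasure (?L (I \<times> J)) (\<Union>p\<in>I \<times> J. S (fst p) (snd p))" by simp
  also have "\<dots> \<le> (\<Sum>p\<in>I \<times> J. emeasure (?L (I \<times> J)) (S (fst p) (snd p)))"
    using Suc.prems S_sets by (intro emeasure_subadditive_finite) auto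
  also have "\<dots> \<le> (\<Sum>p\<in>I \<times> J. ennreal ((4 * (\<beta> n)\<^sup>2) ^ (d + 2 * n + 1)) * V)"
    using S_le by (intro sum_mono) auto
  also have "\<dots> = of_nat ((d + n + 1) * (n + 1)) * (ennreal ((4 * (\<beta> n)\<^sup>2) ^ (d + 2 * n + 1)) * V)"
    using Suc.prems by (simp add: card_cartesian_product add_ac)
  also have "\<dots> = V * ennreal (real (d + n + 1) * real (n + 1) * (4 * (\<beta> n)\<^sup>2) ^ (d + 2 * n + 1))"
  proof -
    have e: "ennreal (real (d + n + 1) * real (n + 1) * (4 * (\<beta> n)\<^sup>2) ^ (d + 2 * n + 1))
      = of_nat ((d + n + 1) * (n + 1)) * ennreal ((4 * (\<beta> n)\<^sup>2) ^ (d + 2 * n + 1))"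
      unfolding ennreal_of_nat_eq_real_of_nat of_nat_mult by (rule ennreal_mult) auto
    show ?thesis unfolding e by (simp only: mult_ac)
  qed
  also have "\<dots> = (\<Prod>k<Suc n. ennreal (real (d + k + 1) * real (k + 1) * (4 * (\<beta> k)\<^sup>2) ^ (d + 2 * k + 1)))"
    unfolding V_def by simp
  finally show ?case .
qed

subsection \<open>The number of visited nodes\<close>

text \<open>Splits a sum over the column-major \<open>vec\<close> into time slots \<open>t\<close>
  and antennas \<open>a\<close>.\<close>

lemma sum_lessThan_mult:
  fixes f :: "nat \<Rightarrow> 'a :: comm_monoid_add"
  shows "(\<Sum>j<p * q. f j) = (\<Sum>t<q. \<Sum>a<p. f (a + p * t))"
proof -
  have *: "sum f {t * p..<t * p + p} = (\<Sum>a<p. f (a + p * t))" for t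
  proof -
    have "sum f {t * p..<t * p + p} = sum f {0 + p * t..<p + p * t}"
      by (simp add: ac_simps)
    also have "\<dots> = (\<Sum>a<p. f (a + p * t))"
      unfolding sum.shift_bounds_nat_ivl lessThan_atLeast0 ..
    finally show ?thesis .
  qed
  show ?thesis
    unfolding mult.commute[of p q] sum.nat_group[of f p q, symmetric] * ..
qed

text \<open>The numbering of the frame, \<open>j = t + q * k\<close> with the pivot index outermost.
  This nesting makes the radii monotone in \<open>j\<close>, as
  \<open>card_gaussian_int_points\<close> demands.\<close>

lemma sum_lessThan_div_mod:
  fixes f :: "nat \<Rightarrow> nat \<Rightarrow> 'a :: comm_monoid_add"
  shows "(\<Sum>j<n * q. f (j div q) (j mod q)) = (\<Sum>k<n. \<Sum>t<q. f k t)"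
proof -
  have "(\<Sum>j<n * q. f (j div q) (j mod q)) = (\<Sum>k<n. \<Sum>t<q. f ((t + q * k) div q) ((t + q * k) mod q))"
    unfolding mult.commute[of n q] by (rule sum_lessThan_mult)
  also have "\<dots> = (\<Sum>k<n. \<Sum>t<q. f k t)"
  proof (intro sum.cong refl)
    fix k t assume "t \<in> {..<q}"
    then have "(t + q * k) div q = k" "(t + q * k) mod q = t" by simp_all
    then show "f ((t + q * k) div q) ((t + q * k) mod q) = f k t" by (simp only:)
  qed
  finally show ?thesis .
qed

lemma prod_lessThan_div:
  fixes h :: "nat \<Rightarrow> 'a :: comm_monoid_mult"
  assumes "0 < q"
  shows "(\<Prod>j<n * q. h (j div q)) = (\<Prod>k<n. h k ^ q)"
proof -
  have "(\<Prod>j\<in>{k * q..<k * q + q}. h (j div q)) = (\<Prod>j\<in>{k * q..<k * q + q}. h k)" for k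
  proof (rule prod.cong[OF refl])
    fix j assume "j \<in> {k * q..<k * q + q}"
    then have "q * k \<le> j" "j < q * Suc k" by (simp_all add: mult.commute)
    then have "j div q = k" by (rule div_nat_eqI)
    then show "h (j div q) = h k" by (simp only:)
  qed
  then have *: "(\<Prod>j\<in>{k * q..<k * q + q}. h (j div q)) = h k ^ q" for k by (simp only: prod_constant) simp
  show ?thesis unfolding prod.nat_group[of "\<lambda>j. h (j div q)" q n, symmetric] * ..
qed

text \<open>The leading diagonal block of \<open>R\<close> is invertible, so the leading entries can
  be solved for such that the first \<open>p\<close> coordinates of \<open>R\<close> times
  \<open>c\<close> vanish. Triangularity leaves in the others exactly the residual of the trailing
  block.\<close>

lemma thin_QR_extend:
  assumes qr: "is_thin_QR m n M Q R"
    and inj: "\<forall>c. (\<forall>l<m. (\<Sum>j<n. M l j * c j) = 0) \<longrightarrow> (\<forall>j<n. c j = 0)"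
    and p: "p \<le> n"
  obtains c where "\<forall>j\<in>{p..<n}. c j = e j"
    and "\<forall>l<m. (\<Sum>j<n. M l j * c j) = (\<Sum>i\<in>{p..<n}. Q l i * (\<Sum>j\<in>{p..<n}. R i j * e j))"
proof -
  have tri: "\<And>i j. i < n \<Longrightarrow> j < n \<Longrightarrow> j < i \<Longrightarrow> R i j = 0"
    and MQR: "\<And>l j. l < m \<Longrightarrow> j < n \<Longrightarrow> M l j = (\<Sum>i<n. Q l i * R i j)"
    using qr[unfolded is_thin_QR_def, THEN conjunct2, THEN conjunct1]
      qr[unfolded is_thin_QR_def, THEN conjunct2, THEN conjunct2] by simp_all
  have Mc: "(\<Sum>j<n. M l j * c j) = (\<Sum>i<n. Q l i * (\<Sum>j<n. R i j * c j))" if "l < m" for l c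
  proof -
    have "(\<Sum>j<n. M l j * c j) = (\<Sum>j<n. \<Sum>i<n. Q l i * (R i j * c j))"
      using MQR[OF that] by (intro sum.cong) (auto simp: sum_distrib_right mult.assoc)
    then show ?thesis by (subst (asm) sum.swap) (simp add: sum_distrib_left)
  qed
  have split: "(\<Sum>j<n. f j) = (\<Sum>j<p. f j) + (\<Sum>j\<in>{p..<n}. f j)" for f :: "nat \<Rightarrow> complex"
    unfolding lessThan_atLeast0 using p by (intro sum.atLeastLessThan_concat[symmetric]) auto
  have "full_rank_gen p R"
    unfolding full_rank_gen_def
  proof (intro allI impI)
    fix c i assume c: "\<forall>j<p. (\<Sum>i<p. R j i * c i) = 0" and i: "i < p"
    \<comment> \<open>Padding by zeros turns a kernel vector of the leading block into one of
      \<open>M\<close>.\<close>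
    define c' where "c' = (\<lambda>j. if j < p then c j else 0)"
    have "(\<Sum>j<n. R i j * c' j) = 0" if "i < n" for i
    proof -
      have "(\<Sum>j<n. R i j * c' j) = (\<Sum>j<p. R i j * c j)"
        using p by (intro sum.mono_neutral_cong_right) (auto simp: c'_def)
      also have "\<dots> = 0"
      proof (cases "i < p")
        case False
        then show ?thesis using tri[OF that] p by (intro sum.neutral) auto
      qed (use c in simp)
      finally show ?thesis .
    qed
    then have "(\<Sum>j<n. M l j * c' j) = 0" if "l < m" for l using Mc[OF that] by simp
    then have "c' i = 0" using inj[rule_format, of c' i] i p by simp
    then show "c i = 0" using i by (simp add: c'_def)
  qed
  then obtain Z where "\<forall>i<p. \<forall>j<p. (\<Sum>k<p. Z i k * R k j) = (if i = j then 1 else 0)"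
    and Z: "\<forall>i<p. \<forall>j<p. (\<Sum>k<p. R i k * Z k j) = (if i = j then 1 else 0)"
    by (rule full_rank_gen_inverse)
  define v where "v = (\<lambda>i. \<Sum>j\<in>{p..<n}. R i j * e j)"
  define c where "c = (\<lambda>j. if j < p then - (\<Sum>i<p. Z j i * v i) else e j)"
  have tail: "(\<Sum>j\<in>{p..<n}. R i j * c j) = v i" for i
    unfolding v_def by (intro sum.cong) (auto simp: c_def)
  have head: "(\<Sum>j<p. R i j * c j) = - v i" if "i < p" for i
  proof -
    have "(\<Sum>j<p. R i j * c j) = - (\<Sum>j<p. \<Sum>k<p. R i j * Z j k * v k)"
      by (simp add: c_def sum_distrib_left sum_negf mult.assoc)
    also have "(\<Sum>j<p. \<Sum>k<p. R i j * Z j k * v k) = (\<Sum>k<p. (\<Sum>j<p. R i j * Z j k) * v k)"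
      by (subst sum.swap) (simp add: sum_distrib_right)
    also have "\<dots> = (\<Sum>k<p. if k = i then v i else 0)"
      using Z that by (intro sum.cong) auto
    also have "\<dots> = v i" using that by simp
    finally show ?thesis .
  qed
  show thesis
  proof (rule that; intro ballI allI impI)
    fix j assume "j \<in> {p..<n}" then show "c j = e j" by (simp add: c_def)
  next
    fix l assume l: "l < m"
    have lower: "(\<Sum>j<p. R i j * c j) = 0" if "i \<in> {p..<n}" for i
      using that tri by (intro sum.neutral) auto
    show "(\<Sum>j<n. M l j * c j) = (\<Sum>i\<in>{p..<n}. Q l i * (\<Sum>j\<in>{p..<n}. R i j * e j))"
      unfolding Mc[OF l] split[of "\<lambda>i. Q l i * (\<Sum>j<n. R i j * c j)"]
      unfolding split tail using head lower by (simp add: v_def)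
  qed
qed

section \<open>Lattice points at one level for a fixed channel with positive pivots\<close>

context
  fixes nr nt T :: nat and G B :: "nat \<Rightarrow> nat \<Rightarrow> complex"
    and \<theta> :: real and H :: "nat \<times> nat \<Rightarrow> complex" and P :: "nat \<Rightarrow> real" and u :: "nat \<Rightarrow> nat \<Rightarrow> complex"
  assumes nr: "0 < nr" and nt: "0 < nt" and T: "0 < T"
    and B: "\<And>i j. i < nt * T \<Longrightarrow> j < nt * T \<Longrightarrow> (\<Sum>k<nt * T. B i k * G k j) = (if i = j then 1 else 0)"
    and \<theta>: "\<theta> \<noteq> 0"
    and profile: "pivot_profile nt {..<nr} {..<nt} H P u"
    and P_pos: "\<And>k. k < nt \<Longrightarrow> 0 < P k"
begin

text \<open>The vector \<open>u k\<close> is placed in time slot \<open>t\<close> of an otherwise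
  zero codeword and pulled back by the inverse generator \<open>B\<close>, where
  \<open>k = j div T\<close> and \<open>t = j mod T\<close>.\<close>

definition frame :: "nat \<Rightarrow> nat \<Rightarrow> complex" where
  "frame j i = (\<Sum>a<nt. B i (a + nt * (j mod T)) * u (j div T) a)"

text \<open>\<open>M\<close> applies \<open>H\<close> to each column of the codeword
  \<open>G c\<close> separately and scales by \<theta>. Hence every column has image at most
  \<open>S / \<bar>\<theta>\<bar>\<close> and its own expansion from the pivot profile;
  \<open>B\<close> transports these expansions back to \<open>c\<close>.\<close>

lemma frame_span:
  assumes S: "\<And>l. l < nr * T \<Longrightarrow> cmod (\<Sum>j<nt * T. Mmat nr nt G \<theta> H l j * c j) \<le> S"
  shows "\<exists>y. (\<forall>j<nt * T. cmod (y j) \<le> 2 ^ nt * S / (\<bar>\<theta>\<bar> * P (j div T))) \<and>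
    (\<forall>i<nt * T. c i = (\<Sum>j<nt * T. y j * frame j i))"
proof -
  define x where "x = (\<lambda>j. \<Sum>i<nt * T. G j i * c i)"
  have M_x: "(\<Sum>j<nt * T. Mmat nr nt G \<theta> H l j * c j)
      = complex_of_real \<theta> * (\<Sum>a<nt. H (l mod nr, a) * x (a + nt * (l div nr)))" for l
  proof -
    have "(\<Sum>j<nt * T. Mmat nr nt G \<theta> H l j * c j)
      = (\<Sum>j<nt * T. \<Sum>a<nt. complex_of_real \<theta> * (H (l mod nr, a) * (G (a + nt * (l div nr)) j * c j)))"
      by (simp add: Mmat_def sum_distrib_left sum_distrib_right mult.assoc)
    also have "\<dots> = (\<Sum>a<nt. \<Sum>j<nt * T. complex_of_real \<theta> * (H (l mod nr, a) * (G (a + nt * (l div nr)) j * c j)))"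
      by (rule sum.swap)
    also have "\<dots> = complex_of_real \<theta> * (\<Sum>a<nt. H (l mod nr, a) * x (a + nt * (l div nr)))"
      by (simp add: x_def sum_distrib_left)
    finally show ?thesis .
  qed
  define Y where "Y = (\<lambda>t y. (\<forall>k<nt. cmod (y k) * P k \<le> 2 ^ nt * (S / \<bar>\<theta>\<bar>)) \<and>
    (\<forall>a\<in>{..<nt}. x (a + nt * t) = (\<Sum>k<nt. y k * u k a)))"
  have "\<exists>y. Y t y" if t: "t < T" for t
    unfolding Y_def
  proof (rule pivot_profileD(6)[OF profile])
    fix b assume "b \<in> {..<nr}"
    then have b: "b < nr" by simp
    have l: "b + nr * t < nr * T"
    proof -
      have "b + nr * t < nr * Suc t" using b by simp
      also have "\<dots> \<le> nr * T" using t by (intro mult_le_mono2) simp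
      finally show ?thesis .
    qed
    have "(b + nr * t) mod nr = b" "(b + nr * t) div nr = t" using b by auto
    then have "cmod (complex_of_real \<theta> * (\<Sum>a<nt. H (b, a) * x (a + nt * t))) \<le> S"
      using S[OF l] unfolding M_x by simp
    then show "cmod (\<Sum>a<nt. H (b, a) * x (a + nt * t)) \<le> S / \<bar>\<theta>\<bar>"
      using \<theta> by (simp add: norm_mult field_simps)
  qed (use P_pos in auto)
  then obtain y where Yy: "\<And>t. t < T \<Longrightarrow> Y t (y t)" by metis
  have y: "\<And>t k. t < T \<Longrightarrow> k < nt \<Longrightarrow> cmod (y t k) * P k \<le> 2 ^ nt * (S / \<bar>\<theta>\<bar>)"
    "\<And>t a. t < T \<Longrightarrow> a < nt \<Longrightarrow> x (a + nt * t) = (\<Sum>k<nt. y t k * u k a)"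
    using Yy by (simp_all add: Y_def)
  have "c i = (\<Sum>j<nt * T. y (j mod T) (j div T) * frame j i)" if i: "i < nt * T" for i
  proof -
    have "(\<Sum>j<nt * T. B i j * x j) = (\<Sum>j<nt * T. \<Sum>k<nt * T. B i j * G j k * c k)"
      by (simp add: x_def sum_distrib_left mult.assoc)
    also have "\<dots> = (\<Sum>k<nt * T. (\<Sum>j<nt * T. B i j * G j k) * c k)"
      by (subst sum.swap) (simp add: sum_distrib_right)
    also have "\<dots> = (\<Sum>k<nt * T. if k = i then c i else 0)"
      using B[OF i] by (intro sum.cong) auto
    also have "\<dots> = c i" using i by simp
    finally have "c i = (\<Sum>j<nt * T. B i j * x j)" by simp
    also have "\<dots> = (\<Sum>t<T. \<Sum>a<nt. B i (a + nt * t) * x (a + nt * t))"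
      by (rule sum_lessThan_mult)
    also have "\<dots> = (\<Sum>t<T. \<Sum>a<nt. \<Sum>k<nt. y t k * (B i (a + nt * t) * u k a))"
    proof (intro sum.cong refl)
      fix t a assume "t \<in> {..<T}" "a \<in> {..<nt}"
      then have "B i (a + nt * t) * x (a + nt * t) = B i (a + nt * t) * (\<Sum>k<nt. y t k * u k a)"
        by (simp add: y(2))
      also have "\<dots> = (\<Sum>k<nt. y t k * (B i (a + nt * t) * u k a))"
        unfolding sum_distrib_left by (intro sum.cong refl) (rule mult.left_commute)
      finally show "B i (a + nt * t) * x (a + nt * t) = (\<Sum>k<nt. y t k * (B i (a + nt * t) * u k a))" .
    qed
    also have "\<dots> = (\<Sum>t<T. \<Sum>k<nt. y t k * (\<Sum>a<nt. B i (a + nt * t) * u k a))"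
    proof (rule sum.cong[OF refl])
      fix t
      have "(\<Sum>a<nt. \<Sum>k<nt. y t k * (B i (a + nt * t) * u k a)) = (\<Sum>k<nt. \<Sum>a<nt. y t k * (B i (a + nt * t) * u k a))"
        by (rule sum.swap)
      then show "(\<Sum>a<nt. \<Sum>k<nt. y t k * (B i (a + nt * t) * u k a)) = (\<Sum>k<nt. y t k * (\<Sum>a<nt. B i (a + nt * t) * u k a))"
        by (simp only: sum_distrib_left)
    qed
    also have "\<dots> = (\<Sum>k<nt. \<Sum>t<T. y t k * (\<Sum>a<nt. B i (a + nt * t) * u k a))"
      by (rule sum.swap)
    also have "\<dots> = (\<Sum>j<nt * T. y (j mod T) (j div T) * frame j i)"
      unfolding frame_def
      by (rule sum_lessThan_div_mod[symmetric, of "\<lambda>k t. y t k * (\<Sum>a<nt. B i (a + nt * t) * u k a)"])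
    finally show ?thesis .
  qed
  moreover have "cmod (y (j mod T) (j div T)) \<le> 2 ^ nt * S / (\<bar>\<theta>\<bar> * P (j div T))" if "j < nt * T" for j
  proof -
    have "j div T < nt" using that by (rule less_mult_imp_div_less)
    then show ?thesis using y(1)[of "j mod T" "j div T"] P_pos[of "j div T"] T \<theta>
      by (simp add: field_simps)
  qed
  ultimately show ?thesis by (intro exI[of _ "\<lambda>j. y (j mod T) (j div T)"]) auto
qed

text \<open>The case \<open>S = 0\<close> of \<open>frame_span\<close>, in which all coefficients
  vanish.\<close>

lemma Mmat_inj:
  assumes "\<And>l. l < nr * T \<Longrightarrow> (\<Sum>j<nt * T. Mmat nr nt G \<theta> H l j * c j) = 0" "i < nt * T"
  shows "c i = 0"
proof -
  obtain y where y: "\<And>j. j < nt * T \<Longrightarrow> cmod (y j) \<le> 2 ^ nt * 0 / (\<bar>\<theta>\<bar> * P (j div T))"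
    "c i = (\<Sum>j<nt * T. y j * frame j i)"
    using frame_span[of c 0] assms by auto
  then have "y j = 0" if "j < nt * T" for j using y(1)[OF that] by simp
  then show ?thesis using y(2) by simp
qed

lemma frame_le:
  assumes "\<And>i j. i < nt * T \<Longrightarrow> j < nt * T \<Longrightarrow> cmod (B i j) \<le> g" "j < nt * T" "i < nt * T"
  shows "cmod (frame j i) \<le> real nt * (g * fact nt)"
proof -
  have jd: "j div T < nt" using assms(2) by (rule less_mult_imp_div_less)
  have idx: "a + nt * (j mod T) < nt * T" if "a < nt" for a
  proof -
    have "a + nt * (j mod T) < nt * Suc (j mod T)" using that by simp
    also have "\<dots> \<le> nt * T" using T by (intro mult_le_mono2) (simp add: Suc_leI)
    finally show ?thesis .
  qed
  have "cmod (frame j i) \<le> (\<Sum>a<nt. cmod (B i (a + nt * (j mod T)) * u (j div T) a))"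
    unfolding frame_def by (rule norm_sum)
  also have "\<dots> \<le> (\<Sum>a<nt. g * fact nt)"
    unfolding norm_mult using assms(1)[OF assms(3) idx] pivot_profileD(3)[OF profile jd] order_trans[OF norm_ge_zero assms(1)[OF assms(3,2)]]
    by (intro sum_mono mult_mono) auto
  finally show ?thesis by simp
qed

text \<open>The bound is uniform in the level \<open>p\<close>, because the completed vectors are
  expanded in the full frame and \<open>card L\<close> is at most \<kappa>. Every pivot belongs to
  \<open>T\<close> frame vectors, and real and imaginary parts are rounded separately, which gives
  the exponent \<open>2 * T\<close>.\<close>

lemma card_level_le:
  assumes qr: "is_thin_QR (nr * T) (nt * T) (Mmat nr nt G \<theta> H) Q R"
    and g: "\<And>i j. i < nt * T \<Longrightarrow> j < nt * T \<Longrightarrow> cmod (B i j) \<le> g"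
    and \<eta>: "0 \<le> \<eta>" and \<xi>: "0 \<le> \<xi>" and p: "p \<le> nt * T"
  shows "real (card {sh \<in> PiE {p..<nt * T} (\<lambda>_. Qset \<eta>).
      (\<Sum>i\<in>{p..<nt * T}. (cmod (rv i - (\<Sum>j\<in>{p..<nt * T}. R i j * sh j)))\<^sup>2) \<le> \<xi>\<^sup>2})
    \<le> (8 * (real (nt * T) + 1) ^ 2 * (real (nt * T) * (real nt * (g * fact nt)) + 1)
        * (2 ^ nt * (2 * real (nt * T)) + 4)) ^ (2 * (nt * T))
      * (\<Prod>k<nt. (min (\<xi> / (\<bar>\<theta>\<bar> * P k)) \<eta> + 1) ^ (2 * T))"
    (is "real (card ?S) \<le> ?K * ?\<Pi>")
proof (cases "?S = {}")
  case True
  have "0 \<le> ?K * ?\<Pi>"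
    using \<eta> \<xi> P_pos by (intro mult_nonneg_nonneg prod_nonneg zero_le_even_power) auto
  then show ?thesis unfolding True by simp
next
  case False
  define \<kappa> where "\<kappa> = nt * T"
  define L where "L = {p..<\<kappa>}"
  have \<kappa>0: "0 < \<kappa>" using nt T by (simp add: \<kappa>_def)
  have g0: "0 \<le> g" using g[of 0 0] \<kappa>0 order_trans[OF norm_ge_zero] by (auto simp: \<kappa>_def)
  obtain s0 where s0: "s0 \<in> ?S" using False by blast
  \<comment> \<open>Translation by one counted point removes \<open>rv\<close>, hence the noise and
    the transmitted symbols, and preserves the cardinality.\<close>
  define \<delta> where "\<delta> = (\<lambda>sh :: nat \<Rightarrow> complex. \<lambda>i\<in>L. sh i - s0 i)"
  define E where "E = \<delta> ` ?S"
  have inj: "inj_on \<delta> ?S"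
  proof (rule inj_onI)
    fix x y assume xy: "x \<in> ?S" "y \<in> ?S" "\<delta> x = \<delta> y"
    show "x = y"
    proof (rule extensionalityI[of _ L])
      fix i assume "i \<in> L"
      then show "x i = y i" using fun_cong[OF xy(3), of i] by (simp add: \<delta>_def)
    qed (use xy in \<open>auto simp: PiE_def L_def \<kappa>_def\<close>)
  qed
  have res: "cmod (rv i - (\<Sum>j\<in>L. R i j * sh j)) \<le> \<xi>" if "sh \<in> ?S" "i \<in> L" for sh i
  proof -
    have "(cmod (rv i - (\<Sum>j\<in>L. R i j * sh j)))\<^sup>2 \<le> (\<Sum>i\<in>L. (cmod (rv i - (\<Sum>j\<in>L. R i j * sh j)))\<^sup>2)"
      using that(2) by (intro member_le_sum) (auto simp: L_def)
    also have "\<dots> \<le> \<xi>\<^sup>2" using that(1) by (simp add: L_def \<kappa>_def)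
    finally show ?thesis using \<xi> by (rule power2_le_imp_le)
  qed
  \<comment> \<open>\<open>2 * \<xi>\<close> comes from the two residuals, \<kappa> from summing
    over columns of \<open>Q\<close> with entries of modulus at most 1, and \<open>2 ^ nt\<close>
    from the pivot profile.\<close>
  define r where "r = (\<lambda>j. 2 ^ nt * (2 * real \<kappa> * \<xi>) / (\<bar>\<theta>\<bar> * P (j div T)))"
  have jd: "j div T < nt" if "j < \<kappa>" for j using that unfolding \<kappa>_def by (rule less_mult_imp_div_less)
  have Q1: "cmod (Q l i) \<le> 1" if "l < nr * T" "i < \<kappa>" for l i
  proof -
    have "cdot {..<nr * T} (\<lambda>l. Q l i) (\<lambda>l. Q l i) = 1"
      using qr that(2) by (simp add: is_thin_QR_def cdot_def \<kappa>_def)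
    then show ?thesis using cmod_le_1_if_cdot_self[of "{..<nr * T}" "\<lambda>l. Q l i" l] that(1) by simp
  qed
  have card_E: "real (card E)
    \<le> (\<Prod>i<\<kappa>. (8 * (real \<kappa> + 1) * (real (card L) + 1) * (real \<kappa> * (real nt * (g * fact nt)) + 1) * (min (r i) (4 * \<eta>) + 1))\<^sup>2)"
  proof (rule card_gaussian_int_points[where b = frame])
    show "finite L" by (simp add: L_def)
    show "0 \<le> real nt * (g * fact nt)" using g0 by simp
    show "0 \<le> 4 * \<eta>" using \<eta> by simp
    show "0 \<le> r j" if "j < \<kappa>" for j
      using P_pos[OF jd[OF that]] \<xi> by (simp add: r_def)
    show "r j \<le> r i" if "i \<le> j" "j < \<kappa>" for i j
    proof -
      have "i div T \<le> j div T" using that(1) by (rule div_le_mono)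
      then have "P (i div T) \<le> P (j div T)" using jd[OF that(2)] by (rule pivot_profileD(1)[OF profile])
      moreover have "0 < P (i div T)" using jd that by (intro P_pos) auto
      ultimately show ?thesis unfolding r_def using \<theta> \<xi>
        by (intro divide_left_mono mult_left_mono mult_pos_pos) auto
    qed
    show "cmod (frame j l) \<le> real nt * (g * fact nt)" if "j < \<kappa>" "l \<in> L" for j l
      using that g by (intro frame_le) (auto simp: L_def \<kappa>_def)
    show "E \<subseteq> extensional L" by (auto simp: E_def \<delta>_def)
    \<comment> \<open>Real and imaginary parts of a difference are each at most
      \<open>2 * \<eta>\<close> in modulus, whence the 4.\<close>
    show "gaussian_int (e l) \<and> cmod (e l) \<le> 4 * \<eta>" if eE: "e \<in> E" and l: "l \<in> L" for e l
    proof -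
      obtain sh where sh: "sh \<in> ?S" "e = \<delta> sh" using eE by (auto simp: E_def)
      have "sh l \<in> Qset \<eta>" "s0 l \<in> Qset \<eta>" using sh(1) s0 l by (auto simp: L_def \<kappa>_def PiE_iff)
      then show ?thesis
        using cmod_le[of "sh l - s0 l"] l sh(2) by (auto simp: Qset_def gaussian_int_def \<delta>_def)
    qed
    show "\<exists>y. (\<forall>j<\<kappa>. cmod (y j) \<le> r j) \<and> (\<forall>l\<in>L. e l = (\<Sum>j<\<kappa>. y j * frame j l))" if eE: "e \<in> E" for e
    proof -
      obtain sh where sh: "sh \<in> ?S" "e = \<delta> sh" using eE by (auto simp: E_def)
      have Re: "cmod (\<Sum>j\<in>L. R i j * e j) \<le> 2 * \<xi>" if "i \<in> L" for i
      proof -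
        have "(\<Sum>j\<in>L. R i j * e j) = (rv i - (\<Sum>j\<in>L. R i j * s0 j)) - (rv i - (\<Sum>j\<in>L. R i j * sh j))"
          unfolding sh(2) by (simp add: \<delta>_def right_diff_distrib sum_subtractf)
        then show ?thesis
          using norm_triangle_ineq4[of "rv i - (\<Sum>j\<in>L. R i j * s0 j)" "rv i - (\<Sum>j\<in>L. R i j * sh j)"]
            res[OF s0 that] res[OF sh(1) that] by simp
      qed
      obtain c where c: "\<forall>j\<in>{p..<nt * T}. c j = e j"
        "\<forall>l<nr * T. (\<Sum>j<nt * T. Mmat nr nt G \<theta> H l j * c j)
          = (\<Sum>i\<in>{p..<nt * T}. Q l i * (\<Sum>j\<in>{p..<nt * T}. R i j * e j))"
        by (rule thin_QR_extend[OF qr _ p]) (use Mmat_inj in blast)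
      have "cmod (\<Sum>j<nt * T. Mmat nr nt G \<theta> H l j * c j) \<le> 2 * real \<kappa> * \<xi>" if l: "l < nr * T" for l
      proof -
        have "cmod (\<Sum>j<nt * T. Mmat nr nt G \<theta> H l j * c j) \<le> (\<Sum>i\<in>L. cmod (Q l i * (\<Sum>j\<in>L. R i j * e j)))"
          unfolding c(2)[rule_format, OF l] L_def \<kappa>_def by (rule norm_sum)
        also have "\<dots> \<le> (\<Sum>i\<in>L. 1 * (2 * \<xi>))"
          unfolding norm_mult using Q1[OF l] Re by (intro sum_mono mult_mono) (auto simp: L_def)
        also have "\<dots> = real (card L) * (2 * \<xi>)" by simp
        also have "\<dots> \<le> real \<kappa> * (2 * \<xi>)" using \<xi> by (intro mult_right_mono) (auto simp: L_def)
        finally show ?thesis by (simp add: mult_ac)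
      qed
      from frame_span[OF this] obtain y where
        "\<forall>j<\<kappa>. cmod (y j) \<le> r j" "\<forall>i<\<kappa>. c i = (\<Sum>j<\<kappa>. y j * frame j i)"
        unfolding r_def \<kappa>_def by blast
      then show ?thesis using c(1) by (intro exI[of _ y]) (auto simp: L_def \<kappa>_def)
    qed
  qed
  define K where "K = 8 * (real \<kappa> + 1) ^ 2 * (real \<kappa> * (real nt * (g * fact nt)) + 1) * (2 ^ nt * (2 * real \<kappa>) + 4)"
  have "real (card ?S) = real (card E)" unfolding E_def using inj by (simp add: card_image)
  also have "\<dots> \<le> (\<Prod>i<\<kappa>. (8 * (real \<kappa> + 1) * (real (card L) + 1) * (real \<kappa> * (real nt * (g * fact nt)) + 1) * (min (r i) (4 * \<eta>) + 1))\<^sup>2)"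
    by (rule card_E)
  also have "\<dots> \<le> (\<Prod>i<\<kappa>. (K * (min (\<xi> / (\<bar>\<theta>\<bar> * P (i div T))) \<eta> + 1))\<^sup>2)"
  proof (intro prod_mono conjI power_mono)
    fix i assume "i \<in> {..<\<kappa>}"
    then have i: "i < \<kappa>" by simp
    define a where "a = \<xi> / (\<bar>\<theta>\<bar> * P (i div T))"
    define m where "m = 2 ^ nt * (2 * real \<kappa>)"
    have a0: "0 \<le> a" using P_pos[OF jd[OF i]] \<xi> by (simp add: a_def)
    have m0: "0 \<le> m" by (simp add: m_def)
    have ri: "r i = m * a" by (simp add: r_def m_def a_def)
    \<comment> \<open>Moves both constants out of the minimum, so that they end up in the
      prefactor.\<close>
    have "min (m * a) (4 * \<eta>) \<le> (m + 4) * min a \<eta>"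
    proof (cases "a \<le> \<eta>")
      case True
      then have "min (m * a) (4 * \<eta>) \<le> m * a" "(m + 4) * min a \<eta> = m * a + 4 * a"
        by (simp_all add: algebra_simps)
      then show ?thesis using a0 by linarith
    next
      case False
      then have "min (m * a) (4 * \<eta>) \<le> 4 * \<eta>" "(m + 4) * min a \<eta> = m * \<eta> + 4 * \<eta>"
        by (simp_all add: algebra_simps)
      then show ?thesis using mult_nonneg_nonneg[OF m0 \<eta>] by linarith
    qed
    then have mm: "min (r i) (4 * \<eta>) + 1 \<le> (m + 4) * (min a \<eta> + 1)"
      unfolding ri using m0 by (simp add: algebra_simps)
    have cL: "real (card L) \<le> real \<kappa>" by (simp add: L_def)
    have r0: "0 \<le> min (r i) (4 * \<eta>)" unfolding ri using a0 m0 \<eta> by simp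
    have "8 * (real \<kappa> + 1) * (real (card L) + 1) * (real \<kappa> * (real nt * (g * fact nt)) + 1) * (min (r i) (4 * \<eta>) + 1)
      \<le> 8 * (real \<kappa> + 1) * (real \<kappa> + 1) * (real \<kappa> * (real nt * (g * fact nt)) + 1) * ((m + 4) * (min a \<eta> + 1))"
      using cL mm r0 g0 by (intro mult_mono add_mono order_refl) auto
    then show "8 * (real \<kappa> + 1) * (real (card L) + 1) * (real \<kappa> * (real nt * (g * fact nt)) + 1) * (min (r i) (4 * \<eta>) + 1)
      \<le> K * (min (\<xi> / (\<bar>\<theta>\<bar> * P (i div T))) \<eta> + 1)"
      unfolding K_def a_def m_def power2_eq_square by (simp only: mult.assoc)
    show "0 \<le> 8 * (real \<kappa> + 1) * (real (card L) + 1) * (real \<kappa> * (real nt * (g * fact nt)) + 1) * (min (r i) (4 * \<eta>) + 1)"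
      using r0 g0 by simp
  qed auto
  also have "\<dots> = (\<Prod>i<\<kappa>. K\<^sup>2) * (\<Prod>i<\<kappa>. (min (\<xi> / (\<bar>\<theta>\<bar> * P (i div T))) \<eta> + 1)\<^sup>2)"
    by (simp only: power_mult_distrib prod.distrib)
  also have "(\<Prod>i<\<kappa>. K\<^sup>2) = ?K" by (simp add: K_def \<kappa>_def power_mult)
  also have "(\<Prod>i<\<kappa>. (min (\<xi> / (\<bar>\<theta>\<bar> * P (i div T))) \<eta> + 1)\<^sup>2) = ?\<Pi>"
    unfolding \<kappa>_def using prod_lessThan_div[OF T, of "\<lambda>k. (min (\<xi> / (\<bar>\<theta>\<bar> * P k)) \<eta> + 1)\<^sup>2" nt]
    by (simp add: power_mult)
  finally show ?thesis .
qed

end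

text \<open>\<open>C\<close> is obtained before the channel, the noise and all parameters that
  depend on \<rho>; this uniformity is what lets it disappear from the exponents. The estimate holds
  for every thin QR decomposition, hence for the one selected by \<open>SOME\<close>.\<close>

lemma sd_count_le:
  assumes "1 \<le> nt" "nt \<le> nr" "1 \<le> T" "full_rank_gen (nt * T) G"
  obtains C where "0 < C" and "\<And>H W s \<eta> \<theta> xi2 P u. pivot_profile nt {..<nr} {..<nt} H P u \<Longrightarrow>
    (\<And>k. k < nt \<Longrightarrow> 0 < P k) \<Longrightarrow> \<theta> \<noteq> 0 \<Longrightarrow> 0 \<le> \<eta> \<Longrightarrow> 0 \<le> xi2 \<Longrightarrow>
    real (sd_count nr nt T G \<eta> \<theta> xi2 H W s)
      \<le> C * (\<Prod>k<nt. (min (sqrt xi2 / (\<bar>\<theta>\<bar> * P k)) \<eta> + 1) ^ (2 * T))"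
proof -
  obtain B where B: "\<forall>i<nt * T. \<forall>j<nt * T. (\<Sum>k<nt * T. B i k * G k j) = (if i = j then 1 else 0)"
    and "\<forall>i<nt * T. \<forall>j<nt * T. (\<Sum>k<nt * T. G i k * B k j) = (if i = j then 1 else 0)"
    using assms(4) by (rule full_rank_gen_inverse)
  define g where "g = (\<Sum>p\<in>{..<nt * T} \<times> {..<nt * T}. cmod (B (fst p) (snd p)))"
  have g: "cmod (B i j) \<le> g" if "i < nt * T" "j < nt * T" for i j
    unfolding g_def using that member_le_sum[of "(i, j)" "{..<nt * T} \<times> {..<nt * T}" "\<lambda>p. cmod (B (fst p) (snd p))"] by simp
  have g0: "0 \<le> g" unfolding g_def by (intro sum_nonneg) auto
  define K where "K = (8 * (real (nt * T) + 1) ^ 2 * (real (nt * T) * (real nt * (g * fact nt)) + 1)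
        * (2 ^ nt * (2 * real (nt * T)) + 4)) ^ (2 * (nt * T))"
  have K0: "0 < K" unfolding K_def using g0 by (intro zero_less_power mult_pos_pos add_nonneg_pos) auto
  show thesis
  proof (rule that[of "real (nt * T) * K"])
    show "0 < real (nt * T) * K" using K0 assms by simp
  next
    fix H W s \<eta> \<theta> xi2 P u
    assume pp: "pivot_profile nt {..<nr} {..<nt} H P u" and P0: "\<And>k. k < nt \<Longrightarrow> 0 < P k"
      and \<theta>: "\<theta> \<noteq> (0 :: real)" and \<eta>: "0 \<le> (\<eta> :: real)" and xi2: "0 \<le> (xi2 :: real)"
    have pos: "0 < nr" "0 < nt" "0 < T" using assms by auto
    define QR where "QR = (SOME QR. is_thin_QR (nr * T) (nt * T) (Mmat nr nt G \<theta> H) (fst QR) (snd QR))"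
    have "\<exists>Q R. is_thin_QR (nr * T) (nt * T) (Mmat nr nt G \<theta> H) Q R"
      by (rule thin_QR_exists) (rule Mmat_inj[OF pos B[rule_format] \<theta> pp P0])
    then have "\<exists>QR. is_thin_QR (nr * T) (nt * T) (Mmat nr nt G \<theta> H) (fst QR) (snd QR)" by auto
    then have qr: "is_thin_QR (nr * T) (nt * T) (Mmat nr nt G \<theta> H) (fst QR) (snd QR)"
      unfolding QR_def by (rule someI_ex)
    define rv where "rv = (\<lambda>i. \<Sum>l<nr * T. cnj (fst QR l i) * rcv nt T G \<theta> H W s (l mod nr) (l div nr))"
    define \<Phi> where "\<Phi> = (\<Prod>k<nt. (min (sqrt xi2 / (\<bar>\<theta>\<bar> * P k)) \<eta> + 1) ^ (2 * T))"
    have "real (sd_count nr nt T G \<eta> \<theta> xi2 H W s)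
      = (\<Sum>k\<in>{1..nt * T}. real (card {sh \<in> PiE {nt * T - k..<nt * T} (\<lambda>_. Qset \<eta>).
      (\<Sum>i\<in>{nt * T - k..<nt * T}. (cmod (rv i - (\<Sum>j\<in>{nt * T - k..<nt * T}. snd QR i j * sh j)))\<^sup>2) \<le> (sqrt xi2)\<^sup>2}))"
      unfolding sd_count_def Let_def QR_def[symmetric] rv_def using xi2 by simp
    also have "\<dots> \<le> (\<Sum>k\<in>{1..nt * T}. K * \<Phi>)"
      unfolding K_def \<Phi>_def
      by (intro sum_mono card_level_le[OF pos B[rule_format] \<theta> pp P0 qr g \<eta>]) (use xi2 in auto)
    also have "\<dots> = real (nt * T) * K * \<Phi>" by simp
    finally show "real (sd_count nr nt T G \<eta> \<theta> xi2 H W s) \<le> real (nt * T) * K * \<Phi>" .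
  qed
qed

subsection \<open>Probability bounds\<close>

lemma emeasure_PiM_CN_le:
  assumes "finite K" "\<And>k. k \<in> K \<Longrightarrow> A k \<in> sets borel" "\<And>k. k \<in> K \<Longrightarrow> emeasure CN (A k) \<le> ennreal (c k)"
    "\<And>k. k \<in> K \<Longrightarrow> 0 \<le> c k"
  shows "emeasure (PiM K (\<lambda>_. CN)) (PiE K A) \<le> ennreal (\<Prod>k\<in>K. c k)"
proof -
  have "emeasure (PiM K (\<lambda>_. CN)) (PiE K A) = (\<Prod>k\<in>K. emeasure CN (A k))"
    using assms by (intro PCN.emeasure_PiM) auto
  also have "\<dots> \<le> (\<Prod>k\<in>K. ennreal (c k))" using assms by (intro prod_mono_ennreal) auto
  also have "\<dots> = ennreal (\<Prod>k\<in>K. c k)" using assms by (intro prod_ennreal) auto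
  finally show ?thesis .
qed

lemma emeasure_CN_le_2: "emeasure CN A \<le> ennreal 2"
proof -
  have "emeasure CN A \<le> emeasure CN (space CN)" by (rule emeasure_space)
  also have "\<dots> \<le> ennreal 2" using emeasure_CN_tail[of 0] by simp
  finally show ?thesis .
qed

lemma emeasure_PiM_CN_space_le:
  assumes "finite K"
  shows "emeasure (PiM K (\<lambda>_. CN)) (space (PiM K (\<lambda>_. CN))) \<le> ennreal (2 ^ card K)"
  using emeasure_PiM_CN_le[OF assms, of "\<lambda>_. UNIV" "\<lambda>_. 2"] emeasure_CN_le_2
  by (simp add: space_PiM)

text \<open>Union bound over the large entry, each of the other coordinates contributing the mass
  bound 2.\<close>

lemma emeasure_PiM_CN_tail:
  assumes "finite K" "0 \<le> R"
  shows "{H \<in> space (PiM K (\<lambda>_. CN)). \<exists>k\<in>K. R \<le> cmod (H k)} \<in> sets (PiM K (\<lambda>_. CN))"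
    and "emeasure (PiM K (\<lambda>_. CN)) {H \<in> space (PiM K (\<lambda>_. CN)). \<exists>k\<in>K. R \<le> cmod (H k)}
      \<le> ennreal (real (card K) * 2 ^ card K * exp (- R\<^sup>2 / 2))"
proof -
  define A where "A = (\<lambda>k j :: 'a. if j = k then {z. R \<le> cmod z} else UNIV)"
  have eq: "{H \<in> space (PiM K (\<lambda>_. CN)). \<exists>k\<in>K. R \<le> cmod (H k)} = (\<Union>k\<in>K. PiE K (A k))"
    by (auto simp: space_PiM A_def PiE_iff split: if_splits)
  have A_borel: "A k j \<in> sets borel" for k j by (auto simp: A_def)
  have A_sets: "PiE K (A k) \<in> sets (PiM K (\<lambda>_. CN))" for k
    using assms A_borel by (intro sets_PiM_I_finite) auto
  show "{H \<in> space (PiM K (\<lambda>_. CN)). \<exists>k\<in>K. R \<le> cmod (H k)} \<in> sets (PiM K (\<lambda>_. CN))"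
    unfolding eq using assms A_sets by (intro sets.finite_UN) auto
  have "emeasure (PiM K (\<lambda>_. CN)) (PiE K (A k)) \<le> ennreal (2 ^ card K * exp (- R\<^sup>2 / 2))" if "k \<in> K" for k
  proof -
    have "emeasure (PiM K (\<lambda>_. CN)) (PiE K (A k))
        \<le> ennreal (\<Prod>j\<in>K. if j = k then 2 * exp (- R\<^sup>2 / 2) else 2)"
      using assms A_borel emeasure_CN_tail[OF assms(2)] emeasure_CN_le_2
      by (intro emeasure_PiM_CN_le) (auto simp: A_def)
    also have "(\<Prod>j\<in>K. if j = k then 2 * exp (- R\<^sup>2 / 2) else 2) = (\<Prod>j\<in>K. 2 * (if j = k then exp (- R\<^sup>2 / 2) else 1))"
      by (intro prod.cong) auto
    also have "\<dots> = 2 ^ card K * exp (- R\<^sup>2 / 2)"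
      using that assms(1) by (simp add: prod.distrib prod.delta)
    finally show ?thesis .
  qed
  then have "(\<Sum>k\<in>K. emeasure (PiM K (\<lambda>_. CN)) (PiE K (A k))) \<le> (\<Sum>k\<in>K. ennreal (2 ^ card K * exp (- R\<^sup>2 / 2)))"
    by (intro sum_mono)
  also have "\<dots> = ennreal (real (card K) * 2 ^ card K * exp (- R\<^sup>2 / 2))"
    by (simp add: ennreal_of_nat_eq_real_of_nat ennreal_mult[symmetric] mult.assoc)
  finally show "emeasure (PiM K (\<lambda>_. CN)) {H \<in> space (PiM K (\<lambda>_. CN)). \<exists>k\<in>K. R \<le> cmod (H k)}
      \<le> ennreal (real (card K) * 2 ^ card K * exp (- R\<^sup>2 / 2))"
    unfolding eq using emeasure_subadditive_finite[of K "\<lambda>k. PiE K (A k)" "PiM K (\<lambda>_. CN)"] assms(1) A_sets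
    by (auto intro: order_trans)
qed

lemma emeasure_small_stages_CN:
  assumes "finite I" "finite J" "card J = n" "card I = n + d" "\<And>k. k < n \<Longrightarrow> 0 \<le> \<beta> k"
  shows "{H \<in> space (PiM (I \<times> J) (\<lambda>_. CN)). small_stages n I J \<beta> H} \<in> sets (PiM (I \<times> J) (\<lambda>_. CN))"
    and "emeasure (PiM (I \<times> J) (\<lambda>_. CN)) {H \<in> space (PiM (I \<times> J) (\<lambda>_. CN)). small_stages n I J \<beta> H}
    \<le> ennreal (\<Prod>k<n. real (d + k + 1) * real (k + 1) * (4 * (\<beta> k)\<^sup>2) ^ (d + 2 * k + 1))"
proof -
  let ?L = "PiM (I \<times> J) (\<lambda>_. lborel :: complex measure)" and ?N = "PiM (I \<times> J) (\<lambda>_. CN)"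
  define A where "A = {H \<in> space ?N. small_stages n I J \<beta> H}"
  have sets_eq: "sets ?N = sets ?L" by (intro sets_PiM_cong) auto
  have space_eq: "space ?N = space ?L" by (rule sets_eq_imp_space_eq[OF sets_eq])
  have "Measurable.pred ?N (\<lambda>H. small_stages n I J \<beta> H)"
  proof (rule small_stages_measurable)
    fix i j assume "i \<in> I" "j \<in> J"
    then show "(\<lambda>H. H (i, j)) \<in> borel_measurable ?N"
      using measurable_component_singleton[of "(i, j)" "I \<times> J" "\<lambda>_. CN"]
        measurable_cong_sets[OF refl sets_CN] by auto
  qed (use assms in auto)
  then show A_sets: "{H \<in> space ?N. small_stages n I J \<beta> H} \<in> sets ?N"
    by (simp add: pred_def)
  have "emeasure ?N A = (\<integral>\<^sup>+H. indicator A H \<partial>?N)" using A_sets by (simp add: A_def)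
  also have "\<dots> \<le> (\<integral>\<^sup>+H. indicator A H \<partial>?L)"
    using A_sets sets_eq assms by (intro nn_integral_PiM_CN_le) (auto simp: A_def)
  also have "\<dots> = emeasure ?L A" using A_sets sets_eq by (simp add: A_def)
  also have "\<dots> \<le> (\<Prod>k<n. ennreal (real (d + k + 1) * real (k + 1) * (4 * (\<beta> k)\<^sup>2) ^ (d + 2 * k + 1)))"
    unfolding A_def space_eq by (rule emeasure_small_stages_lborel[OF assms])
  also have "\<dots> = ennreal (\<Prod>k<n. real (d + k + 1) * real (k + 1) * (4 * (\<beta> k)\<^sup>2) ^ (d + 2 * k + 1))"
    by (intro prod_ennreal) auto
  finally show "emeasure ?N {H \<in> space ?N. small_stages n I J \<beta> H}
    \<le> ennreal (\<Prod>k<n. real (d + k + 1) * real (k + 1) * (4 * (\<beta> k)\<^sup>2) ^ (d + 2 * k + 1))"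
    unfolding A_def .
qed

section \<open>From channel events to the full system space\<close>

lemma finite_Qset: "finite (Qset \<eta>)"
proof -
  have "Qset \<eta> \<subseteq> (\<lambda>(a, b). Complex (of_int a) (of_int b)) ` ({- \<lceil>\<eta>\<rceil>..\<lceil>\<eta>\<rceil>} \<times> {- \<lceil>\<eta>\<rceil>..\<lceil>\<eta>\<rceil>})"
  proof
    fix s assume s: "s \<in> Qset \<eta>"
    then obtain a b where ab: "Re s = of_int a" "Im s = of_int b"
      by (auto simp: Qset_def elim!: Ints_cases)
    then have "\<bar>real_of_int a\<bar> \<le> \<eta>" "\<bar>real_of_int b\<bar> \<le> \<eta>" using s by (auto simp: Qset_def)
    then have "a \<in> {- \<lceil>\<eta>\<rceil>..\<lceil>\<eta>\<rceil>}" "b \<in> {- \<lceil>\<eta>\<rceil>..\<lceil>\<eta>\<rceil>}"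
      by (simp_all add: abs_le_iff) linarith+
    then show "s \<in> (\<lambda>(a, b). Complex (of_int a) (of_int b)) ` ({- \<lceil>\<eta>\<rceil>..\<lceil>\<eta>\<rceil>} \<times> {- \<lceil>\<eta>\<rceil>..\<lceil>\<eta>\<rceil>})"
      using ab by (intro image_eqI[of _ _ "(a, b)"]) (auto simp: complex_eq_iff)
  qed
  then show ?thesis by (rule finite_subset) auto
qed

text \<open>A non-measurable event \<open>E\<close> has junk measure \<open>0\<close>.\<close>
lemma Pr_sys_le:
  fixes E :: "(nat \<times> nat \<Rightarrow> complex) \<Rightarrow> (nat \<times> nat \<Rightarrow> complex) \<Rightarrow> (nat \<Rightarrow> complex) \<Rightarrow> bool"
  assumes \<eta>: "0 \<le> \<eta>" and c: "0 \<le> c"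
    and S: "S \<in> sets (PiM ({..<nr} \<times> {..<nt}) (\<lambda>_. CN))"
    and S_le: "emeasure (PiM ({..<nr} \<times> {..<nt}) (\<lambda>_. CN)) S \<le> ennreal c"
    and E: "\<And>H W s. H \<in> space (PiM ({..<nr} \<times> {..<nt}) (\<lambda>_. CN)) \<Longrightarrow> E H W s \<Longrightarrow> H \<in> S"
  shows "Pr_sys nr nt T \<eta> E \<le> c * 2 ^ (nr * T)"
proof -
  let ?H = "PiM ({..<nr} \<times> {..<nt}) (\<lambda>_. CN)" and ?W = "PiM ({..<nr} \<times> {..<T}) (\<lambda>_. CN)"
    and ?U = "uniform_count_measure (PiE {..<nt * T} (\<lambda>_. Qset \<eta>))"
  let ?M = "sys_space nr nt T \<eta>"
  define X where "X = {\<omega> \<in> space ?M. E (fst (fst \<omega>)) (snd (fst \<omega>)) (snd \<omega>)}"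
  define Y where "Y = (S \<times> space ?W) \<times> space ?U"
  \<comment> \<open>A nonempty constellation makes the uniform measure a probability measure: the
    symbols contribute the factor 1, the noise at most \<open>2 ^ (nr * T)\<close>.\<close>
  have "0 \<in> Qset \<eta>" using \<eta> by (simp add: Qset_def)
  then have ne: "PiE {..<nt * T} (\<lambda>_. Qset \<eta>) \<noteq> {}" by (auto simp: PiE_eq_empty_iff)
  have fin: "finite (PiE {..<nt * T} (\<lambda>_. Qset \<eta>))" by (intro finite_PiE) (auto simp: finite_Qset)
  interpret U: prob_space ?U by (rule prob_space_uniform_count_measure[OF fin ne])
  interpret W: sigma_finite_measure ?W by (rule PCN.sigma_finite) simp
  have Y_sets: "Y \<in> sets ?M" unfolding Y_def sys_space_def using S by (intro pair_measureI) auto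
  have "emeasure ?M Y = emeasure (?H \<Otimes>\<^sub>M ?W) (S \<times> space ?W) * emeasure ?U (space ?U)"
    unfolding Y_def sys_space_def using S by (intro U.emeasure_pair_measure_Times pair_measureI) auto
  also have "\<dots> = emeasure ?H S * emeasure ?W (space ?W)"
    using S by (subst W.emeasure_pair_measure_Times) (auto simp: U.emeasure_space_1)
  also have "\<dots> \<le> ennreal c * ennreal (2 ^ (nr * T))"
    using S_le emeasure_PiM_CN_space_le[of "{..<nr} \<times> {..<T}"]
    by (intro mult_mono) (auto simp: card_cartesian_product)
  also have "\<dots> = ennreal (c * 2 ^ (nr * T))" using c by (simp add: ennreal_mult)
  finally have Y_le: "emeasure ?M Y \<le> ennreal (c * 2 ^ (nr * T))" .
  have "X \<subseteq> Y"
  proof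
    fix \<omega> assume \<omega>: "\<omega> \<in> X"
    then have "\<omega> \<in> (space ?H \<times> space ?W) \<times> space ?U"
      by (simp add: X_def sys_space_def space_pair_measure)
    then show "\<omega> \<in> Y" using \<omega> E unfolding X_def Y_def by auto
  qed
  have "emeasure (completion ?M) X \<le> emeasure (completion ?M) Y"
    using \<open>X \<subseteq> Y\<close> Y_sets by (intro emeasure_mono) auto
  also have "\<dots> = emeasure ?M Y" using Y_sets by simp
  finally have "emeasure (completion ?M) X \<le> ennreal (c * 2 ^ (nr * T))" using Y_le by (rule order_trans)
  then have "measure (completion ?M) X \<le> c * 2 ^ (nr * T)"
    unfolding measure_def using c by (intro enn2real_leI) auto
  then show ?thesis unfolding Pr_sys_def X_def .
qed

text \<open>Trades an asymptotic exponent for two-sided power bounds with arbitrarily small loss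
  \<delta>, the form in which \<eta> and \<theta> enter the estimates.\<close>

lemma dot_eq_bounds:
  assumes "dot_eq f a" "0 < \<delta>"
  shows "eventually (\<lambda>\<rho>. f \<rho> > 0 \<and> \<rho> powr (a - \<delta>) \<le> f \<rho> \<and> f \<rho> \<le> \<rho> powr (a + \<delta>)) at_top"
proof -
  have pos: "eventually (\<lambda>\<rho>. f \<rho> > 0) at_top" and lim: "((\<lambda>\<rho>. log 2 (f \<rho>) / log 2 \<rho>) \<longlongrightarrow> a) at_top"
    using assms(1) by (auto simp: dot_eq_def)
  have "eventually (\<lambda>\<rho>. a - \<delta> < log 2 (f \<rho>) / log 2 \<rho>) at_top"
    using lim assms(2) by (intro order_tendstoD(1)) auto
  moreover have "eventually (\<lambda>\<rho>. log 2 (f \<rho>) / log 2 \<rho> < a + \<delta>) at_top"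
    using lim assms(2) by (intro order_tendstoD(2)) auto
  ultimately show ?thesis
    using pos eventually_gt_at_top[of "1 :: real"]
  proof eventually_elim
    case (elim \<rho>)
    have l: "0 < log 2 \<rho>" using elim by simp
    have eq: "f \<rho> = 2 powr log 2 (f \<rho>)" using elim by simp
    have r: "\<rho> powr t = 2 powr (t * log 2 \<rho>)" for t
      using elim by (simp add: powr_def log_def)
    have "(a - \<delta>) * log 2 \<rho> < log 2 (f \<rho>)" using elim(1) l by (simp add: pos_less_divide_eq)
    moreover have "log 2 (f \<rho>) < (a + \<delta>) * log 2 \<rho>" using elim(2) l by (simp add: pos_divide_less_eq)
    ultimately have "2 powr ((a - \<delta>) * log 2 \<rho>) \<le> 2 powr log 2 (f \<rho>)" "2 powr log 2 (f \<rho>) \<le> 2 powr ((a + \<delta>) * log 2 \<rho>)"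
      by simp_all
    then show ?case using elim(3) unfolding r eq[symmetric] by blast
  qed
qed

text \<open>Scaling by \<open>d / (d + \<epsilon>)\<close> makes \<open>a\<close> feasible for
  \<open>d\<close>. All weights are at least 1, so \<open>a k \<le> d + \<epsilon>\<close> and the
  scaling moves each coordinate by at most \<epsilon>; each summand of the objective is Lipschitz
  with constant \<open>T\<close>.\<close>

lemma cbar_perturb:
  fixes a :: "nat \<Rightarrow> real"
  assumes nt: "1 \<le> nt" "nt \<le> nr" and d: "0 \<le> d" and \<epsilon>: "0 \<le> \<epsilon>"
    and anti: "\<And>k. Suc k < nt \<Longrightarrow> a (Suc k) \<le> a k" and a0: "\<And>k. k < nt \<Longrightarrow> 0 \<le> a k"
    and le: "(\<Sum>k<nt. real (nr - nt + 2 * k + 1) * a k) \<le> d + \<epsilon>"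
  shows "(\<Sum>k<nt. real T * max 0 (min (r / real nt - 1 + a k) (r / real nt))) \<le> cbar nt nr T r d + real (nt * T) * \<epsilon>"
proof -
  define f where "f = (\<lambda>t. real T * max 0 (min (r / real nt - 1 + t) (r / real nt)))"
  \<comment> \<open>For \<open>d + \<epsilon> = 0\<close> all \<open>a k\<close> vanish and the
    value 0 is a valid factor.\<close>
  define q where "q = (if d + \<epsilon> = 0 then 0 else d / (d + \<epsilon>))"
  have q: "0 \<le> q" "q \<le> 1" using d \<epsilon> by (auto simp: q_def divide_le_eq_1)
  define \<alpha> where "\<alpha> = (\<lambda>i. q * a (i - 1))"
  have a_le: "a k \<le> d + \<epsilon>" if "k < nt" for k
  proof -
    have "a k \<le> real (nr - nt + 2 * k + 1) * a k"
      using a0[OF that] mult_right_mono[of 1 "real (nr - nt + 2 * k + 1)" "a k"] by simp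
    also have "\<dots> \<le> (\<Sum>k<nt. real (nr - nt + 2 * k + 1) * a k)"
      using that a0 by (intro member_le_sum) auto
    finally show ?thesis using le by linarith
  qed
  have gap: "a k - q * a k \<le> \<epsilon>" if "k < nt" for k
  proof (cases "d + \<epsilon> = 0")
    case True
    then show ?thesis using a_le[OF that] \<epsilon> d by (simp add: q_def)
  next
    case False
    then have pos: "0 < d + \<epsilon>" using d \<epsilon> by linarith
    have "a k - q * a k = a k * (\<epsilon> / (d + \<epsilon>))" using pos by (simp add: q_def field_simps)
    also have "\<dots> \<le> (d + \<epsilon>) * (\<epsilon> / (d + \<epsilon>))" using a_le[OF that] \<epsilon> pos by (intro mult_right_mono) auto
    finally show ?thesis using pos by simp
  qed
  have shift: "(\<Sum>i=1..nt. g i) = (\<Sum>k<nt. g (Suc k))" for g :: "nat \<Rightarrow> real"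
    by (simp add: sum.atLeast1_atMost_eq)
  have "(\<Sum>i=1..nt. (real nr - real nt + 2 * real i - 1) * \<alpha> i) = q * (\<Sum>k<nt. real (nr - nt + 2 * k + 1) * a k)"
    unfolding shift sum_distrib_left using nt(2)
    by (intro sum.cong) (auto simp: \<alpha>_def of_nat_diff algebra_simps)
  also have "\<dots> \<le> q * (d + \<epsilon>)" using le q by (intro mult_left_mono) auto
  also have "\<dots> \<le> d" using d \<epsilon> by (auto simp: q_def)
  finally have feas: "(\<Sum>i=1..nt. (real nr - real nt + 2 * real i - 1) * \<alpha> i) \<le> d" .
  have mono: "\<forall>i\<in>{1..<nt}. \<alpha> (Suc i) \<le> \<alpha> i"
  proof
    fix i assume i: "i \<in> {1..<nt}"
    then have "a (Suc (i - 1)) \<le> a (i - 1)" by (intro anti) auto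
    then show "\<alpha> (Suc i) \<le> \<alpha> i" using q i by (auto simp: \<alpha>_def intro!: mult_left_mono)
  qed
  have nonneg: "0 \<le> \<alpha> nt" using a0[of "nt - 1"] nt q by (simp add: \<alpha>_def)
  define V where "V = {(\<Sum>i=1..nt. real T * max 0 (min (r / real nt - 1 + \<alpha> i) (r / real nt))) | \<alpha>.
      (\<Sum>i=1..nt. (real nr - real nt + 2 * real i - 1) * \<alpha> i) \<le> d \<and>
      (\<forall>i\<in>{1..<nt}. \<alpha> (Suc i) \<le> \<alpha> i) \<and> 0 \<le> \<alpha> nt}"
  \<comment> \<open>A real \<open>Sup\<close> dominates the elements of a set bounded above; the
    truncation of each term at \<open>r / nt\<close> provides the bound.\<close>
  have "bdd_above V"
  proof (rule bdd_aboveI)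
    fix v assume "v \<in> V"
    then obtain \<alpha>' where v: "v = (\<Sum>i=1..nt. real T * max 0 (min (r / real nt - 1 + \<alpha>' i) (r / real nt)))"
      by (auto simp: V_def)
    show "v \<le> (\<Sum>i=1..nt. real T * max 0 (r / real nt))"
      unfolding v by (intro sum_mono mult_left_mono) auto
  qed
  moreover have "(\<Sum>i=1..nt. f (\<alpha> i)) \<in> V"
    unfolding V_def f_def using feas mono nonneg by blast
  ultimately have "(\<Sum>i=1..nt. f (\<alpha> i)) \<le> cbar nt nr T r d"
    unfolding cbar_def V_def[symmetric] by (intro cSup_upper)
  moreover have "(\<Sum>k<nt. f (a k)) \<le> (\<Sum>k<nt. f (\<alpha> (Suc k)) + real T * \<epsilon>)"
  proof (rule sum_mono)
    fix k assume "k \<in> {..<nt}"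
    then have "max 0 (min (r / real nt - 1 + a k) (r / real nt))
        \<le> max 0 (min (r / real nt - 1 + \<alpha> (Suc k)) (r / real nt)) + \<epsilon>"
      using gap[of k] \<epsilon> by (auto simp: \<alpha>_def max_def min_def)
    then show "f (a k) \<le> f (\<alpha> (Suc k)) + real T * \<epsilon>"
      unfolding f_def distrib_left[symmetric] by (intro mult_left_mono) auto
  qed
  ultimately have "(\<Sum>k<nt. f (a k)) \<le> cbar nt nr T r d + real (nt * T) * \<epsilon>"
    unfolding shift by (simp add: sum.distrib mult.assoc)
  then show ?thesis by (simp only: f_def)
qed

subsection \<open>Exponents\<close>

text \<open>The radius is a positive power of \<rho>, so the Gaussian tail decays faster than every
  power.\<close>

lemma eventually_exp_powr_le:
  fixes A B \<delta> e :: real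
  assumes "0 < \<delta>" "0 < B"
  shows "eventually (\<lambda>\<rho>. A * exp (- (\<rho> powr \<delta> / B)\<^sup>2 / 2) \<le> \<rho> powr e) at_top"
proof -
  have "((\<lambda>\<rho>::real. A * exp (- (\<rho> powr \<delta> / B)\<^sup>2 / 2) * \<rho> powr (- e)) \<longlongrightarrow> 0) at_top"
    using assms by real_asymp
  then have "eventually (\<lambda>\<rho>. A * exp (- (\<rho> powr \<delta> / B)\<^sup>2 / 2) * \<rho> powr (- e) < 1) at_top"
    by (rule order_tendstoD) simp
  then show ?thesis using eventually_gt_at_top[of 0]
    by eventually_elim (simp add: powr_minus field_simps)
qed

lemma eventually_sqrt_log_le_powr:
  fixes z \<delta> :: real
  assumes "0 < \<delta>" "0 < z"
  shows "eventually (\<lambda>\<rho>. sqrt (z * log 2 \<rho>) \<le> \<rho> powr \<delta>) at_top"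
  using assms unfolding log_def by real_asymp

lemma eventually_const_le_powr:
  fixes C \<delta> :: real
  assumes "0 < \<delta>"
  shows "eventually (\<lambda>\<rho>. C \<le> \<rho> powr \<delta>) at_top"
  using assms by real_asymp

text \<open>For \<open>p\<^sup>2 = \<rho> powr (- \<alpha>)\<close> and \<open>\<rho> > 1\<close>
  this is \<alpha> in units of \<delta>, rounded down and truncated to the range from 0 to
  \<open>K\<close>. The alternative \<open>m = 0\<close> keeps the set nonempty for
  \<open>p > 1\<close>.\<close>

definition grid_level :: "real \<Rightarrow> real \<Rightarrow> nat \<Rightarrow> real \<Rightarrow> nat" where
  "grid_level \<rho> \<delta> K p = Max {m. m \<le> K \<and> (m = 0 \<or> p \<le> \<rho> powr (- (real m * \<delta> / 2)))}"

text \<open>The lower bound on \<open>p\<close> is confined to levels below \<open>K\<close>, since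
  the top level also collects everything smaller. The last claim makes the rounded exponents inherit
  the order of the pivots, reversed.\<close>

lemma grid_level:
  shows "grid_level \<rho> \<delta> K p \<le> K"
    and "grid_level \<rho> \<delta> K p = 0 \<or> p \<le> \<rho> powr (- (real (grid_level \<rho> \<delta> K p) * \<delta> / 2))"
    and "grid_level \<rho> \<delta> K p < K \<Longrightarrow> \<rho> powr (- ((real (grid_level \<rho> \<delta> K p) * \<delta> + \<delta>) / 2)) < p"
    and "p \<le> p' \<Longrightarrow> grid_level \<rho> \<delta> K p' \<le> grid_level \<rho> \<delta> K p"
proof -
  define S where "S = (\<lambda>p. {m. m \<le> K \<and> (m = 0 \<or> p \<le> \<rho> powr (- (real m * \<delta> / 2)))})"
  have eq: "grid_level \<rho> \<delta> K p = Max (S p)" for p by (simp add: grid_level_def S_def)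
  have fin: "finite (S p)" for p unfolding S_def by (rule finite_subset[of _ "{..K}"]) auto
  have ne: "S p \<noteq> {}" for p by (auto simp: S_def)
  have "grid_level \<rho> \<delta> K p \<in> S p" unfolding eq using fin ne by (rule Max_in)
  then show "grid_level \<rho> \<delta> K p \<le> K"
    and "grid_level \<rho> \<delta> K p = 0 \<or> p \<le> \<rho> powr (- (real (grid_level \<rho> \<delta> K p) * \<delta> / 2))"
    unfolding S_def by auto
  show "\<rho> powr (- ((real (grid_level \<rho> \<delta> K p) * \<delta> + \<delta>) / 2)) < p" if less: "grid_level \<rho> \<delta> K p < K"
  proof -
    have "Suc (grid_level \<rho> \<delta> K p) \<notin> S p"
    proof
      assume "Suc (grid_level \<rho> \<delta> K p) \<in> S p"
      then have "Suc (grid_level \<rho> \<delta> K p) \<le> grid_level \<rho> \<delta> K p"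
        unfolding eq[of p] using fin by (intro Max_ge)
      then show False by simp
    qed
    then show ?thesis using less by (auto simp: S_def not_le algebra_simps add_divide_distrib)
  qed
  show "grid_level \<rho> \<delta> K p' \<le> grid_level \<rho> \<delta> K p" if "p \<le> p'"
    unfolding eq using fin ne that by (intro Max_mono) (auto simp: S_def)
qed

text \<open>In each factor \<xi> and \<theta> lose \<delta> each and the rounding of
  \<open>P k\<close> loses \<open>\<delta> / 2\<close>, hence \<open>5 / 2 * \<delta>\<close> and,
  after the power \<open>2 * T\<close>, \<open>5 * T * \<delta>\<close>. One further \<delta>
  absorbs the constants, the \<open>4 ^ (nt * T)\<close> arising from
  \<open>1 + y \<le> 2 * y\<close> for \<open>y \<ge> 1\<close>.\<close>

lemma count_exponent_le:
  fixes a P :: "nat \<Rightarrow> real" and N :: real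
  assumes \<rho>: "1 < \<rho>" and \<delta>: "0 < \<delta>" and C: "0 < C" "C * 4 ^ (nt * T) \<le> \<rho> powr \<delta>"
    and \<xi>: "0 \<le> \<xi>" "\<xi> \<le> \<rho> powr \<delta>" and \<eta>: "0 \<le> \<eta>" "\<eta> \<le> \<rho> powr (q / 2 + \<delta>)"
    and \<theta>: "\<rho> powr ((1 - q) / 2 - \<delta>) \<le> \<theta>"
    and P: "\<And>k. k < nt \<Longrightarrow> \<rho> powr (- ((a k + \<delta>) / 2)) < P k"
    and N: "N \<le> C * (\<Prod>k<nt. (min (\<xi> / (\<theta> * P k)) \<eta> + 1) ^ (2 * T))"
    and x: "\<rho> powr x \<le> N"
  shows "x \<le> (\<Sum>k<nt. real T * max 0 (min (q - 1 + a k) q)) + (5 * real (nt * T) + 1) * \<delta>"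
proof -
  define g where "g = (\<lambda>k. max 0 (min (q - 1 + a k) q))"
  have mono: "\<rho> powr s \<le> \<rho> powr t" if "s \<le> t" for s t using that \<rho> by (intro powr_mono) auto
  have term_le: "(min (\<xi> / (\<theta> * P k)) \<eta> + 1) ^ (2 * T) \<le> 4 ^ T * \<rho> powr (real T * g k + 5 * real T * \<delta>)"
    and term_nonneg: "0 \<le> (min (\<xi> / (\<theta> * P k)) \<eta> + 1) ^ (2 * T)" if k: "k < nt" for k
  proof -
    have pos: "0 < \<rho> powr ((1 - q) / 2 - \<delta>)" "0 < \<rho> powr (- ((a k + \<delta>) / 2))" using \<rho> by auto
    have \<theta>0: "0 < \<theta>" using \<theta> pos by linarith
    have "\<xi> / (\<theta> * P k) \<le> \<rho> powr \<delta> / (\<rho> powr ((1 - q) / 2 - \<delta>) * \<rho> powr (- ((a k + \<delta>) / 2)))"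
      by (intro frac_le mult_mono mult_pos_pos)
        (use \<xi> \<theta> \<theta>0 P[OF k] pos powr_ge_zero[of \<rho> \<delta>] in linarith)+
    also have "\<dots> = \<rho> powr (\<delta> - ((1 - q) / 2 - \<delta> + - ((a k + \<delta>) / 2)))"
      by (simp only: powr_add powr_diff)
    also have "\<delta> - ((1 - q) / 2 - \<delta> + - ((a k + \<delta>) / 2)) = (q - 1 + a k) / 2 + 5 / 2 * \<delta>"
      by (simp add: field_simps)
    finally have 1: "\<xi> / (\<theta> * P k) \<le> \<rho> powr ((q - 1 + a k) / 2 + 5 / 2 * \<delta>)" .
    have 2: "\<eta> \<le> \<rho> powr (q / 2 + 5 / 2 * \<delta>)"
      using \<eta>(2) mono[of "q / 2 + \<delta>" "q / 2 + 5 / 2 * \<delta>"] \<delta> by linarith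
    have "min (\<xi> / (\<theta> * P k)) \<eta> \<le> \<rho> powr (g k / 2 + 5 / 2 * \<delta>)"
    proof (cases "q - 1 + a k \<le> q")
      case True
      then have "q - 1 + a k \<le> g k" by (auto simp: g_def)
      then have "(q - 1 + a k) / 2 + 5 / 2 * \<delta> \<le> g k / 2 + 5 / 2 * \<delta>"
        by (intro add_right_mono divide_right_mono) auto
      from 1 mono[OF this] show ?thesis by linarith
    next
      case False
      then have "q \<le> g k" by (auto simp: g_def)
      then have "q / 2 + 5 / 2 * \<delta> \<le> g k / 2 + 5 / 2 * \<delta>"
        by (intro add_right_mono divide_right_mono) auto
      from 2 mono[OF this] show ?thesis by linarith
    qed
    \<comment> \<open>The positive part in the objective originates here: the exponent must be
      nonnegative for the summand 1 to be absorbed.\<close>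
    moreover have "1 \<le> \<rho> powr (g k / 2 + 5 / 2 * \<delta>)"
      using mono[of 0 "g k / 2 + 5 / 2 * \<delta>"] \<rho> \<delta> by (simp add: g_def)
    ultimately have le: "min (\<xi> / (\<theta> * P k)) \<eta> + 1 \<le> 2 * \<rho> powr (g k / 2 + 5 / 2 * \<delta>)" by linarith
    have \<theta>P: "0 < \<theta> * P k" using \<theta> P[OF k] pos by (intro mult_pos_pos) linarith+
    then have "0 \<le> min (\<xi> / (\<theta> * P k)) \<eta>" using \<xi> \<eta> by simp
    then have nn: "0 \<le> min (\<xi> / (\<theta> * P k)) \<eta> + 1" by linarith
    then show "0 \<le> (min (\<xi> / (\<theta> * P k)) \<eta> + 1) ^ (2 * T)" by (rule zero_le_power)
    have "(min (\<xi> / (\<theta> * P k)) \<eta> + 1) ^ (2 * T) \<le> (2 * \<rho> powr (g k / 2 + 5 / 2 * \<delta>)) ^ (2 * T)"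
      using le nn by (rule power_mono)
    also have "\<dots> = 4 ^ T * \<rho> powr ((g k / 2 + 5 / 2 * \<delta>) * real (2 * T))"
      using \<rho> by (simp add: power_mult_distrib powr_powr[symmetric] powr_realpow power_mult del: of_nat_mult)
    also have "(g k / 2 + 5 / 2 * \<delta>) * real (2 * T) = real T * g k + 5 * real T * \<delta>"
      by (simp add: field_simps)
    finally show "(min (\<xi> / (\<theta> * P k)) \<eta> + 1) ^ (2 * T) \<le> 4 ^ T * \<rho> powr (real T * g k + 5 * real T * \<delta>)" .
  qed
  have "\<rho> powr x \<le> C * (\<Prod>k<nt. (min (\<xi> / (\<theta> * P k)) \<eta> + 1) ^ (2 * T))" using N x by linarith
  also have "\<dots> \<le> C * (\<Prod>k<nt. 4 ^ T * \<rho> powr (real T * g k + 5 * real T * \<delta>))"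
    using C term_le term_nonneg by (intro mult_left_mono prod_mono) auto
  also have "(\<Prod>k<nt. 4 ^ T * \<rho> powr (real T * g k + 5 * real T * \<delta>))
      = 4 ^ (nt * T) * \<rho> powr (\<Sum>k<nt. real T * g k + 5 * real T * \<delta>)"
    using \<rho> by (simp add: prod.distrib powr_sum power_mult[symmetric] mult.commute)
  also have "(\<Sum>k<nt. real T * g k + 5 * real T * \<delta>) = (\<Sum>k<nt. real T * g k) + 5 * real (nt * T) * \<delta>"
    by (simp add: sum.distrib)
  also have "C * (4 ^ (nt * T) * \<rho> powr ((\<Sum>k<nt. real T * g k) + 5 * real (nt * T) * \<delta>))
      \<le> \<rho> powr \<delta> * \<rho> powr ((\<Sum>k<nt. real T * g k) + 5 * real (nt * T) * \<delta>)"
    unfolding mult.assoc[symmetric] using C by (intro mult_right_mono) auto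
  also have "\<dots> = \<rho> powr ((\<Sum>k<nt. real T * g k) + (5 * real (nt * T) + 1) * \<delta>)"
    by (simp add: powr_add[symmetric] algebra_simps)
  finally show ?thesis using \<rho> by (simp add: g_def)
qed

text \<open>A large count forces the channel into the tail or into one of finitely many cells.
  Outside them the rounded exponents satisfy the constraint up to \<epsilon>, so the count exponent
  stays below \<open>x\<close>.\<close>

lemma sd_count_tail:
  fixes nt nr T :: nat and G :: "nat \<Rightarrow> nat \<Rightarrow> complex"
    and r d z x :: real and \<eta> \<theta> :: "real \<Rightarrow> real"
  assumes nt: "1 \<le> nt" "nt \<le> nr" and T: "1 \<le> T"
    and G: "full_rank_gen (nt * T) G"
    and \<eta>: "dot_eq \<eta> (r / (2 * real nt))"
    and \<theta>: "dot_eq (\<lambda>\<rho>. (\<theta> \<rho>)\<^sup>2) (1 - r / real nt)"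
    and d: "0 \<le> d" and z: "0 < z" and x: "cbar nt nr T r d < x"
  obtains \<epsilon> C where "0 < \<epsilon>" "0 < C" "eventually (\<lambda>\<rho>. Pr_sys nr nt T (\<eta> \<rho>) (\<lambda>H W s.
     \<rho> powr x \<le> real (sd_count nr nt T G (\<eta> \<rho>) (\<theta> \<rho>) (z * log 2 \<rho>) H W s)) \<le> C * \<rho> powr (- (d + \<epsilon>))) at_top"
proof -
  define gap where "gap = x - cbar nt nr T r d"
  define \<kappa> where "\<kappa> = real (nt * T)"
  \<comment> \<open>Half of the gap pays for relaxing \<open>d\<close> by \<epsilon> in
    \<open>cbar_perturb\<close>, the other half for the losses in \<delta> of
    \<open>count_exponent_le\<close>.\<close>
  define \<epsilon> where "\<epsilon> = gap / (2 * (\<kappa> + 1))"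
  define w where "w = (\<lambda>k. nr - nt + 2 * k + 1)"
  define W where "W = (\<Sum>k<nt. real (w k))"
  \<comment> \<open>The first bound serves the second half of the gap. The second keeps the loss
    \<open>2 * W * \<delta>\<close> in the cell volumes within
    \<open>\<epsilon> / 2\<close>.\<close>
  define \<delta> where "\<delta> = min (gap / (2 * (5 * \<kappa> + 1))) (\<epsilon> / (4 * (W + 1)))"
  \<comment> \<open>One coordinate at the top level already contributes at least
    \<open>d + \<epsilon>\<close> to the weighted sum, so truncation there is harmless.\<close>
  define K where "K = nat \<lceil>(d + \<epsilon>) / \<delta>\<rceil>"
  have gap0: "0 < gap" using x by (simp add: gap_def)
  have \<kappa>0: "0 \<le> \<kappa>" by (simp add: \<kappa>_def)
  have \<epsilon>0: "0 < \<epsilon>" using gap0 \<kappa>0 by (simp add: \<epsilon>_def)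
  have W0: "0 \<le> W" unfolding W_def by (intro sum_nonneg) auto
  have \<delta>0: "0 < \<delta>" using gap0 \<epsilon>0 \<kappa>0 W0 by (simp add: \<delta>_def)
  have \<kappa>\<epsilon>: "\<kappa> * \<epsilon> < gap / 2"
  proof -
    have "\<kappa> * \<epsilon> < (\<kappa> + 1) * \<epsilon>" using \<epsilon>0 by simp
    also have "\<dots> = gap / 2" using \<kappa>0 by (simp add: \<epsilon>_def field_simps)
    finally show ?thesis .
  qed
  have \<delta>1: "(5 * \<kappa> + 1) * \<delta> \<le> gap / 2"
  proof -
    have "\<delta> \<le> gap / (2 * (5 * \<kappa> + 1))" by (simp add: \<delta>_def)
    then have "(5 * \<kappa> + 1) * \<delta> \<le> (5 * \<kappa> + 1) * (gap / (2 * (5 * \<kappa> + 1)))"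
      using \<kappa>0 by (intro mult_left_mono) auto
    also have "\<dots> = gap / 2" using \<kappa>0 by (simp add: field_simps)
    finally show ?thesis .
  qed
  have \<delta>2: "2 * W * \<delta> \<le> \<epsilon> / 2"
  proof -
    have "\<delta> \<le> \<epsilon> / (4 * (W + 1))" by (simp add: \<delta>_def)
    then have "2 * W * \<delta> \<le> 2 * W * (\<epsilon> / (4 * (W + 1)))" using W0 by (intro mult_left_mono) auto
    also have "\<dots> = \<epsilon> / 2 * (W / (W + 1))" using W0 by (simp add: field_simps)
    also have "\<dots> \<le> \<epsilon> / 2 * 1" using W0 \<epsilon>0 by (intro mult_left_mono) auto
    finally show ?thesis by simp
  qed
  have K\<delta>: "d + \<epsilon> \<le> real K * \<delta>"
  proof -
    have "(d + \<epsilon>) / \<delta> \<le> real K" unfolding K_def by linarith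
    then show ?thesis using \<delta>0 by (simp add: pos_divide_le_eq)
  qed
  obtain C where C: "0 < C" and count: "\<And>H W s \<eta> \<theta> xi2 P u. pivot_profile nt {..<nr} {..<nt} H P u \<Longrightarrow>
    (\<And>k. k < nt \<Longrightarrow> 0 < P k) \<Longrightarrow> \<theta> \<noteq> 0 \<Longrightarrow> 0 \<le> \<eta> \<Longrightarrow> 0 \<le> xi2 \<Longrightarrow>
    real (sd_count nr nt T G \<eta> \<theta> xi2 H W s)
      \<le> C * (\<Prod>k<nt. (min (sqrt xi2 / (\<bar>\<theta>\<bar> * P k)) \<eta> + 1) ^ (2 * T))"
    using sd_count_le[OF nt T G] by blast
  let ?KK = "{..<nr} \<times> {..<nt}"
  let ?N = "PiM ?KK (\<lambda>_. CN)"
  \<comment> \<open>The rounded exponents that violate the relaxed constraint. The set is finite and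
    independent of \<rho>, so the union bound costs a constant only.\<close>
  define M where "M = {m \<in> PiE {..<nt} (\<lambda>_. {..K}). d + \<epsilon> \<le> (\<Sum>k<nt. real (w k) * (real (m k) * \<delta>))}"
  have finM: "finite M" unfolding M_def by (rule finite_subset[OF Collect_restrict]) (auto intro: finite_PiE)
  \<comment> \<open>The extra \<open>\<rho> powr \<delta>\<close> leaves room for pivots above 1,
    which sit at level 0.\<close>
  define \<beta> where "\<beta> = (\<lambda>\<rho> (m :: nat \<Rightarrow> nat) k. \<rho> powr (\<delta> - real (m k) * \<delta> / 2))"
  \<comment> \<open>The divisor \<open>2 ^ nt\<close> cancels the growth factor of the profile, so
    that off the tail all \<open>P k\<close> are at most
    \<open>\<rho> powr \<delta>\<close>.\<close>
  define Rad where "Rad = (\<lambda>\<rho>. \<rho> powr \<delta> / 2 ^ nt)"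
  define Tail where "Tail = (\<lambda>\<rho>. {H \<in> space ?N. \<exists>k\<in>?KK. Rad \<rho> \<le> cmod (H k)})"
  define Cell where "Cell = (\<lambda>\<rho> m. {H \<in> space ?N. small_stages nt {..<nr} {..<nt} (\<beta> \<rho> m) H})"
  define Cv where "Cv = (\<Prod>k<nt. real (nr - nt + k + 1) * real (k + 1) * 4 ^ w k)"
  have Cv0: "0 \<le> Cv" unfolding Cv_def by (intro prod_nonneg) auto
  define A where "A = real (card ?KK) * 2 ^ card ?KK"
  have Cell_le: "Cell \<rho> m \<in> sets ?N \<and> emeasure ?N (Cell \<rho> m) \<le> ennreal (Cv * \<rho> powr (- (d + \<epsilon> / 2)))"
    if \<rho>: "1 < \<rho>" and m: "m \<in> M" for \<rho> m
  proof
    have prem: "finite {..<nr}" "finite {..<nt}" "card {..<nt} = nt" "card {..<nr} = nt + (nr - nt)"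
      "\<And>k. k < nt \<Longrightarrow> 0 \<le> \<beta> \<rho> m k" using nt by (auto simp: \<beta>_def)
    show "Cell \<rho> m \<in> sets ?N" unfolding Cell_def by (rule emeasure_small_stages_CN(1)[OF prem])
    have "emeasure ?N (Cell \<rho> m)
        \<le> ennreal (\<Prod>k<nt. real (nr - nt + k + 1) * real (k + 1) * (4 * (\<beta> \<rho> m k)\<^sup>2) ^ w k)"
      unfolding Cell_def w_def by (rule emeasure_small_stages_CN(2)[OF prem])
    also have "(\<Prod>k<nt. real (nr - nt + k + 1) * real (k + 1) * (4 * (\<beta> \<rho> m k)\<^sup>2) ^ w k)
        = (\<Prod>k<nt. real (nr - nt + k + 1) * real (k + 1) * 4 ^ w k * \<rho> powr (real (w k) * (2 * \<delta> - real (m k) * \<delta>)))"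
    proof (rule prod.cong[OF refl])
      fix k
      have "((\<beta> \<rho> m k)\<^sup>2) ^ w k = \<rho> powr ((\<delta> - real (m k) * \<delta> / 2) * real (2 * w k))"
        using \<rho> by (simp add: \<beta>_def powr_powr[symmetric] powr_realpow power_mult del: of_nat_mult)
      also have "(\<delta> - real (m k) * \<delta> / 2) * real (2 * w k) = real (w k) * (2 * \<delta> - real (m k) * \<delta>)"
        by (simp add: field_simps)
      finally show "real (nr - nt + k + 1) * real (k + 1) * (4 * (\<beta> \<rho> m k)\<^sup>2) ^ w k
        = real (nr - nt + k + 1) * real (k + 1) * 4 ^ w k * \<rho> powr (real (w k) * (2 * \<delta> - real (m k) * \<delta>))"
        by (simp add: power_mult_distrib)
    qed
    also have "\<dots> = Cv * \<rho> powr (\<Sum>k<nt. real (w k) * (2 * \<delta> - real (m k) * \<delta>))"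
      unfolding Cv_def prod.distrib using \<rho> by (simp add: powr_sum)
    also have "(\<Sum>k<nt. real (w k) * (2 * \<delta> - real (m k) * \<delta>))
        = 2 * W * \<delta> - (\<Sum>k<nt. real (w k) * (real (m k) * \<delta>))"
      by (simp add: W_def right_diff_distrib sum_subtractf sum_distrib_left sum_distrib_right mult_ac)
    also have "ennreal (Cv * \<rho> powr (2 * W * \<delta> - (\<Sum>k<nt. real (w k) * (real (m k) * \<delta>))))
        \<le> ennreal (Cv * \<rho> powr (- (d + \<epsilon> / 2)))"
      using m \<delta>2 Cv0 \<rho> by (intro ennreal_leI mult_left_mono powr_mono) (auto simp: M_def)
    finally show "emeasure ?N (Cell \<rho> m) \<le> ennreal (Cv * \<rho> powr (- (d + \<epsilon> / 2)))" .
  qed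
  have "eventually (\<lambda>\<rho>. Pr_sys nr nt T (\<eta> \<rho>) (\<lambda>H W s.
     \<rho> powr x \<le> real (sd_count nr nt T G (\<eta> \<rho>) (\<theta> \<rho>) (z * log 2 \<rho>) H W s))
     \<le> (1 + real (card M) * Cv) * 2 ^ (nr * T) * \<rho> powr (- (d + \<epsilon> / 2))) at_top"
    \<comment> \<open>The bounds on the square of \<theta> are taken with
      \<open>2 * \<delta>\<close>, so that \<theta> itself loses only \<delta>.\<close>
    using dot_eq_bounds[OF \<eta> \<delta>0] dot_eq_bounds[OF \<theta>, of "2 * \<delta>", simplified, OF \<delta>0]
      eventually_sqrt_log_le_powr[OF \<delta>0 z] eventually_const_le_powr[OF \<delta>0, of "C * 4 ^ (nt * T)"]
      eventually_exp_powr_le[OF \<delta>0, of "2 ^ nt" A "- (d + \<epsilon> / 2)", simplified]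
      eventually_gt_at_top[of "1 :: real"]
  proof eventually_elim
    case (elim \<rho>)
    have \<rho>: "1 < \<rho>" by fact
    have \<eta>b: "0 \<le> \<eta> \<rho>" "\<eta> \<rho> \<le> \<rho> powr (r / real nt / 2 + \<delta>)" using elim by (simp_all add: mult.commute)
    have \<theta>b: "\<theta> \<rho> \<noteq> 0" "\<rho> powr ((1 - r / real nt) / 2 - \<delta>) \<le> \<bar>\<theta> \<rho>\<bar>"
    proof -
      show "\<theta> \<rho> \<noteq> 0" using elim by auto
      have "(\<rho> powr ((1 - r / real nt) / 2 - \<delta>))\<^sup>2 = \<rho> powr (1 - r / real nt - 2 * \<delta>)"
      proof -
        have "(\<rho> powr ((1 - r / real nt) / 2 - \<delta>))\<^sup>2 
            = \<rho> powr ((1 - r / real nt) / 2 - \<delta> + ((1 - r / real nt) / 2 - \<delta>))"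
          unfolding power2_eq_square by (rule powr_add[symmetric])
        also have "(1 - r / real nt) / 2 - \<delta> + ((1 - r / real nt) / 2 - \<delta>) = 1 - r / real nt - 2 * \<delta>"
        proof -
          have "y / 2 - \<delta> + (y / 2 - \<delta>) = y - 2 * \<delta>" for y by simp
          then show ?thesis .
        qed
        finally show ?thesis .
      qed
      also have "\<dots> \<le> \<bar>\<theta> \<rho>\<bar>\<^sup>2" using elim by simp
      finally show "\<rho> powr ((1 - r / real nt) / 2 - \<delta>) \<le> \<bar>\<theta> \<rho>\<bar>" by (rule power2_le_imp_le) simp
    qed
    have xi: "0 \<le> z * log 2 \<rho>" using z \<rho> by simp
    have Rad0: "0 \<le> Rad \<rho>" by (simp add: Rad_def)
    define S where "S = Tail \<rho> \<union> (\<Union>m\<in>M. Cell \<rho> m)"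
    have Tail_sets: "Tail \<rho> \<in> sets ?N"
      unfolding Tail_def using Rad0 by (intro emeasure_PiM_CN_tail(1)) auto
    have "emeasure ?N (Tail \<rho>) \<le> ennreal (real (card ?KK) * 2 ^ card ?KK * exp (- (Rad \<rho>)\<^sup>2 / 2))"
      unfolding Tail_def using Rad0 by (intro emeasure_PiM_CN_tail(2)) auto
    also have "\<dots> \<le> ennreal (\<rho> powr (- (d + \<epsilon> / 2)))"
      using elim unfolding A_def Rad_def by (intro ennreal_leI) simp
    finally have Tail_le: "emeasure ?N (Tail \<rho>) \<le> ennreal (\<rho> powr (- (d + \<epsilon> / 2)))" .
    have cells: "emeasure ?N (\<Union>m\<in>M. Cell \<rho> m) \<le> ennreal (real (card M) * Cv * \<rho> powr (- (d + \<epsilon> / 2)))"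
    proof -
      have "emeasure ?N (\<Union>m\<in>M. Cell \<rho> m) \<le> (\<Sum>m\<in>M. emeasure ?N (Cell \<rho> m))"
        using finM Cell_le[OF \<rho>] by (intro emeasure_subadditive_finite) auto
      also have "\<dots> \<le> (\<Sum>m\<in>M. ennreal (Cv * \<rho> powr (- (d + \<epsilon> / 2))))"
        using Cell_le[OF \<rho>] by (intro sum_mono) auto
      also have "\<dots> = ennreal (real (card M) * Cv * \<rho> powr (- (d + \<epsilon> / 2)))"
        using Cv0 by (simp add: ennreal_of_nat_eq_real_of_nat ennreal_mult[symmetric] mult.assoc)
      finally show ?thesis .
    qed
    have UN_sets: "(\<Union>m\<in>M. Cell \<rho> m) \<in> sets ?N"
      using finM Cell_le[OF \<rho>] by (intro sets.finite_UN) auto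
    have S_sets: "S \<in> sets ?N" unfolding S_def using Tail_sets UN_sets by (rule sets.Un)
    have "emeasure ?N S \<le> emeasure ?N (Tail \<rho>) + emeasure ?N (\<Union>m\<in>M. Cell \<rho> m)"
      unfolding S_def using Tail_sets UN_sets by (rule emeasure_subadditive)
    also have "\<dots> \<le> ennreal (\<rho> powr (- (d + \<epsilon> / 2))) + ennreal (real (card M) * Cv * \<rho> powr (- (d + \<epsilon> / 2)))"
      using Tail_le cells by (rule add_mono)
    also have "\<dots> = ennreal ((1 + real (card M) * Cv) * \<rho> powr (- (d + \<epsilon> / 2)))"
      using Cv0 by (subst ennreal_plus[symmetric]) (auto simp: distrib_right)
    finally have S_le: "emeasure ?N S \<le> ennreal ((1 + real (card M) * Cv) * \<rho> powr (- (d + \<epsilon> / 2)))" .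
    have "H \<in> S" if H: "H \<in> space ?N"
      and big: "\<rho> powr x \<le> real (sd_count nr nt T G (\<eta> \<rho>) (\<theta> \<rho>) (z * log 2 \<rho>) H W s)" for H W s
    proof (cases "H \<in> Tail \<rho>")
      case False
      then have small: "cmod (H (i, j)) \<le> Rad \<rho>" if "i \<in> {..<nr}" "j \<in> {..<nt}" for i j
        using H that unfolding Tail_def by force
      obtain P u where pp: "pivot_profile nt {..<nr} {..<nt} H P u"
        using pivot_profile_exists[of "{..<nr}" "{..<nt}" nt H] nt by auto
      have P_le: "P k \<le> \<rho> powr \<delta>" if "k < nt" for k
        using pivot_profileD(4)[OF pp small that] by (simp add: Rad_def)
      define m where "m = (\<lambda>k\<in>{..<nt}. grid_level \<rho> \<delta> K (P k))"
      have m_eq: "m k = grid_level \<rho> \<delta> K (P k)" if "k < nt" for k using that by (simp add: m_def)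
      have "P k \<le> \<beta> \<rho> m k" if k: "k < nt" for k
      proof (cases "m k = 0")
        case True
        then show ?thesis using P_le[OF k] by (simp add: \<beta>_def)
      next
        case False
        then have "P k \<le> \<rho> powr (- (real (m k) * \<delta> / 2))" using grid_level(2)[of \<rho> \<delta> K "P k"] m_eq[OF k] by simp
        also have "\<dots> \<le> \<beta> \<rho> m k" unfolding \<beta>_def using \<rho> \<delta>0 by (intro powr_mono) auto
        finally show ?thesis .
      qed
      then have "small_stages nt {..<nr} {..<nt} (\<beta> \<rho> m) H" by (rule pivot_profileD(5)[OF pp])
      then have cell: "H \<in> Cell \<rho> m" using H by (simp add: Cell_def)
      have mP: "m \<in> PiE {..<nt} (\<lambda>_. {..K})" using grid_level(1) by (auto simp: m_def)
      define a where "a = (\<lambda>k. real (m k) * \<delta>)"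
      have a0: "0 \<le> a k" for k using \<delta>0 by (simp add: a_def)
      have m_anti: "m j \<le> m i" if "i \<le> j" "j < nt" for i j
        using that pivot_profileD(1)[OF pp that] by (auto simp: m_eq intro!: grid_level(4))
      have "d + \<epsilon> \<le> (\<Sum>k<nt. real (w k) * a k)"
      proof (rule ccontr)
        assume "\<not> d + \<epsilon> \<le> (\<Sum>k<nt. real (w k) * a k)"
        then have less: "(\<Sum>k<nt. real (w k) * a k) < d + \<epsilon>" by simp
        \<comment> \<open>\<open>P 0\<close> is the smallest pivot and \<open>m 0\<close> the
          largest level. Below the top level all pivots have a positive lower bound, as the counting
          estimate demands; channels with a vanishing pivot have \<open>m 0 = K\<close> and are
          covered by \<open>M\<close>.\<close>
        have "m 0 \<noteq> K"
        proof
          assume "m 0 = K"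
          then have "d + \<epsilon> \<le> a 0" using K\<delta> by (simp add: a_def)
          also have "\<dots> \<le> real (w 0) * a 0" using a0[of 0] mult_right_mono[of 1 "real (w 0)" "a 0"] by (simp add: w_def)
          also have "\<dots> \<le> (\<Sum>k<nt. real (w k) * a k)"
            using nt a0 by (intro member_le_sum[of 0 "{..<nt}"]) auto
          finally show False using less by simp
        qed
        moreover have "m 0 \<le> K" using mP nt by (auto simp: PiE_iff)
        ultimately have "m 0 < K" by simp
        then have m_less: "m k < K" if "k < nt" for k using m_anti[of 0 k] that by simp
        have P_gt: "\<rho> powr (- ((a k + \<delta>) / 2)) < P k" if "k < nt" for k
          using grid_level(3)[of \<rho> \<delta> K "P k"] m_less[OF that] unfolding a_def m_eq[OF that] by blast
        have P0: "0 < P k" if "k < nt" for k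
          using P_gt[OF that] powr_ge_zero by (rule le_less_trans[rotated])
        have "x \<le> (\<Sum>k<nt. real T * max 0 (min (r / real nt - 1 + a k) (r / real nt))) + (5 * real (nt * T) + 1) * \<delta>"
          using count[OF pp P0 \<theta>b(1) \<eta>b(1) xi] big
          by (rule count_exponent_le[OF \<rho> \<delta>0 C elim(4) _ elim(3) \<eta>b \<theta>b(2) P_gt, rotated -2]) (use xi in auto)
        also have "(\<Sum>k<nt. real T * max 0 (min (r / real nt - 1 + a k) (r / real nt))) \<le> cbar nt nr T r d + real (nt * T) * \<epsilon>"
        proof (rule cbar_perturb[OF nt d])
          show "a (Suc k) \<le> a k" if "Suc k < nt" for k
            using m_anti[of k "Suc k"] that \<delta>0 by (auto simp: a_def intro!: mult_right_mono)
          show "(\<Sum>k<nt. real (nr - nt + 2 * k + 1) * a k) \<le> d + \<epsilon>"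
            using less unfolding w_def by linarith
        qed (use a0 \<epsilon>0 in auto)
        finally have "x \<le> cbar nt nr T r d + \<kappa> * \<epsilon> + (5 * \<kappa> + 1) * \<delta>" by (simp add: \<kappa>_def)
        then show False using \<kappa>\<epsilon> \<delta>1 by (simp add: gap_def)
      qed
      then have "m \<in> M" using mP by (simp add: M_def a_def)
      then show ?thesis using cell by (auto simp: S_def)
    qed (simp add: S_def)
    then have "Pr_sys nr nt T (\<eta> \<rho>) (\<lambda>H W s.
       \<rho> powr x \<le> real (sd_count nr nt T G (\<eta> \<rho>) (\<theta> \<rho>) (z * log 2 \<rho>) H W s))
       \<le> (1 + real (card M) * Cv) * \<rho> powr (- (d + \<epsilon> / 2)) * 2 ^ (nr * T)"
      using Cv0 by (intro Pr_sys_le[OF \<eta>b(1) _ S_sets S_le]) auto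
    then show ?case by (simp add: mult_ac)
  qed
  then show thesis
    using \<epsilon>0 Cv0 by (intro that[of "\<epsilon> / 2" "(1 + real (card M) * Cv) * 2 ^ (nr * T)"]) (auto simp: add_pos_nonneg)
qed

text \<open>Every \<open>x\<close> above \<open>cbar\<close> has a tail exponent strictly larger
  than \<open>d\<close>, so it lies in the set whose infimum is the complexity exponent.\<close>

theorem theorem2:
  fixes nt nr T :: nat and G :: "nat \<Rightarrow> nat \<Rightarrow> complex"
    and r d z :: real and \<eta> \<theta> :: "real \<Rightarrow> real" and \<Psi> :: "real \<Rightarrow> ereal"
  assumes "1 \<le> nt" and "nt \<le> nr" and "1 \<le> T"
    and "full_rank_gen (nt * T) G"
    and "0 \<le> r" and "r \<le> real nt"
    and "dot_eq \<eta> (r * real T / (2 * real (nt * T)))"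
    and "dot_eq (\<lambda>\<rho>. (\<theta> \<rho>)\<^sup>2) (1 - r * real T / real (nt * T))"
    and "dot_eq (\<lambda>\<rho>. Pr_sys nr nt T (\<eta> \<rho>) (mld_error nr nt T G (\<eta> \<rho>) (\<theta> \<rho>))) (- d)"
    and "d < z"
    and "\<forall>x. ((\<lambda>\<rho>. elog_ratio
              (Pr_sys nr nt T (\<eta> \<rho>) (\<lambda>H W s.
                 \<rho> powr x \<le> real (sd_count nr nt T G (\<eta> \<rho>) (\<theta> \<rho>) (z * log 2 \<rho>) H W s))) \<rho>)
           \<longlongrightarrow> - \<Psi> x) at_top"
  shows "Inf (ereal ` {x. ereal d < \<Psi> x}) \<le> ereal (cbar nt nr T r d)"
proof -
  have \<eta>: "dot_eq \<eta> (r / (2 * real nt))" and \<theta>: "dot_eq (\<lambda>\<rho>. (\<theta> \<rho>)\<^sup>2) (1 - r / real nt)"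
    using assms(1,3,7,8) by simp_all
  define p where "p = (\<lambda>\<rho>. Pr_sys nr nt T (\<eta> \<rho>) (mld_error nr nt T G (\<eta> \<rho>) (\<theta> \<rho>)))"
  define B :: real where "B = 2 ^ (nr * nt) * 2 ^ (nr * T)"
  \<comment> \<open>The error probability is bounded by a constant, so its exponent
    \<open>- d\<close> cannot be positive.\<close>
  have "eventually (\<lambda>\<rho>. log 2 (p \<rho>) / log 2 \<rho> \<le> log 2 B / log 2 \<rho>) at_top"
    using dot_eq_bounds[OF \<eta>, of 1, simplified] dot_eq_bounds[OF assms(9), of 1, simplified]
      eventually_gt_at_top[of "1 :: real"]
  proof eventually_elim
    case (elim \<rho>)
    have "p \<rho> \<le> B"
      unfolding p_def B_def using elim emeasure_PiM_CN_space_le[of "{..<nr} \<times> {..<nt}"]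
      by (intro Pr_sys_le[of _ _ "space (PiM ({..<nr} \<times> {..<nt}) (\<lambda>_. CN))"]) (auto simp: card_cartesian_product)
    then show ?case using elim by (intro divide_right_mono log_mono) (auto simp: p_def)
  qed
  moreover have "((\<lambda>\<rho>. log 2 (p \<rho>) / log 2 \<rho>) \<longlongrightarrow> - d) at_top"
    using assms(9) by (simp add: dot_eq_def p_def)
  moreover have "((\<lambda>\<rho>::real. log 2 B / log 2 \<rho>) \<longlongrightarrow> 0) at_top"
    unfolding log_def by real_asymp
  ultimately have "- d \<le> 0" by (intro tendsto_le[OF trivial_limit_at_top_linorder]) auto
  then have d: "0 \<le> d" by simp
  have main: "ereal d < \<Psi> x" if x: "cbar nt nr T r d < x" for x
  proof -
    define N where "N = (\<lambda>\<rho>. Pr_sys nr nt T (\<eta> \<rho>) (\<lambda>H W s.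
       \<rho> powr x \<le> real (sd_count nr nt T G (\<eta> \<rho>) (\<theta> \<rho>) (z * log 2 \<rho>) H W s)))"
    have z: "0 < z" using d assms(10) by simp
    obtain \<epsilon> C where \<epsilon>: "0 < \<epsilon>" and C: "0 < C"
      and ev: "eventually (\<lambda>\<rho>. N \<rho> \<le> C * \<rho> powr (- (d + \<epsilon>))) at_top"
      unfolding N_def by (rule sd_count_tail[OF assms(1-4) \<eta> \<theta> d z x])
    \<comment> \<open>Half of \<epsilon> absorbs \<open>C\<close>; the other half survives the limit
      and makes the inequality strict.\<close>
    have "eventually (\<lambda>\<rho>. C \<le> \<rho> powr (\<epsilon> / 2)) at_top" using \<epsilon> by (intro eventually_const_le_powr) simp
    then have "eventually (\<lambda>\<rho>. elog_ratio (N \<rho>) \<rho> \<le> ereal (- (d + \<epsilon> / 2))) at_top"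
      using ev eventually_gt_at_top[of "1 :: real"]
    proof eventually_elim
      case (elim \<rho>)
      show ?case
      proof (cases "N \<rho> \<le> 0")
        case False
        have "N \<rho> \<le> C * \<rho> powr (- (d + \<epsilon>))" by (rule elim(2))
        also have "\<dots> \<le> \<rho> powr (\<epsilon> / 2) * \<rho> powr (- (d + \<epsilon>))" using elim(1) by (intro mult_right_mono) auto
        also have "\<dots> = \<rho> powr (\<epsilon> / 2 + - (d + \<epsilon>))" by (rule powr_add[symmetric])
        also have "\<epsilon> / 2 + - (d + \<epsilon>) = - (d + \<epsilon> / 2)" by (simp add: field_simps)
        finally have "log 2 (N \<rho>) \<le> log 2 (\<rho> powr (- (d + \<epsilon> / 2)))" using False by (intro log_mono) auto
        also have "\<dots> = - (d + \<epsilon> / 2) * log 2 \<rho>" using elim(3) by (simp add: log_powr)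
        finally have "log 2 (N \<rho>) / log 2 \<rho> \<le> - (d + \<epsilon> / 2)" using elim(3) by (simp add: pos_divide_le_eq)
        then show ?thesis using False by (simp add: elog_ratio_def)
      qed (simp add: elog_ratio_def)
    qed
    moreover have "((\<lambda>\<rho>. elog_ratio (N \<rho>) \<rho>) \<longlongrightarrow> - \<Psi> x) at_top"
      using assms(11) unfolding N_def by blast
    ultimately have "- \<Psi> x \<le> ereal (- (d + \<epsilon> / 2))"
      by (intro tendsto_upperbound) auto
    then have "ereal (d + \<epsilon> / 2) \<le> \<Psi> x"
      by (metis ereal_minus_le_minus ereal_uminus_uminus uminus_ereal.simps(1))
    moreover have "ereal d < ereal (d + \<epsilon> / 2)" using \<epsilon> by simp
    ultimately show ?thesis by (rule less_le_trans[rotated])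
  qed
  show ?thesis
  proof (rule ccontr)
    assume "\<not> Inf (ereal ` {x. ereal d < \<Psi> x}) \<le> ereal (cbar nt nr T r d)"
    \<comment> \<open>The infimum may be infinite, so a real number strictly between the two sides
      is chosen; by \<open>main\<close> it would belong to the set.\<close>
    then obtain x where x: "ereal (cbar nt nr T r d) < ereal x" "ereal x < Inf (ereal ` {x. ereal d < \<Psi> x})"
      using ereal_dense2[of "ereal (cbar nt nr T r d)"] by (auto simp: not_le)
    then have "ereal d < \<Psi> x" using main by simp
    then have "Inf (ereal ` {x. ereal d < \<Psi> x}) \<le> ereal x" by (intro Inf_lower) auto
    then show False using x(2) by simp
  qed
qed

end
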